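(* Let $\zeta$ be any transcendental real number. Then \[\frac{1}{\overline{w}(\zeta)+2}\le \underline{\widehat{w}}^{\ast}(\zeta)\le\min\Big\{\underline{w}(\zeta),\frac{4}{\overline{w}(\zeta)}\Big\},\qquad \frac{1}{\underline{w}(\zeta)+2}\le \overline{\widehat{w}}^{\ast}(\zeta)\le\min\Big\{\overline{w}(\zeta),\frac{4}{\underline{w}(\zeta)}\Big\},\] and moreover $\theta(\zeta)=\frac{1}{\tau(\zeta)}=-\sigma(\zeta)$.
   Context: $H(P)$ is the maximum modulus of the coefficients of $P\in\mathbb{Z}[T]$; for real algebraic $\alpha$, $H(\alpha)$ is the height of its minimal polynomial with coprime integer coefficients. $w_n(\zeta)$: supremum of $w$ such that $0<|P(\zeta)|\le H(P)^{-w}$ has infinitely many solutions $P\in\mathbb{Z}[T]$ of degree $\le n$. $\lambda_n(\zeta)$: supremum of $\lambda$ such that $1\le|x|\le X$, $\max_{1\le i\le n}|\zeta^ix-y_i|\le X^{-\lambda}$ has an integer solution $(x,y_1,\dots,y_n)$ for arbitrarily large $X$. $\widehat{w}^{\ast}_n(\zeta)$: supremum of $w^\ast$ such that $H(\alpha)\le X$, $|\zeta-\alpha|\le H(\alpha)^{-1}X^{-w^\ast}$ has a real algebraic solution $\alpha$ of degree $\le n$ for all large $X$. Define $\overline{w}(\zeta)=\limsup w_n(\zeta)/n$, $\underline{w}(\zeta)=\liminf w_n(\zeta)/n$, $\underline{\widehat{w}}^{\ast}(\zeta)=\liminf \widehat{w}^{\ast}_n(\zeta)/n$, $\overline{\widehat{w}}^{\ast}(\zeta)=\limsup\widehat{w}^{\ast}_n(\zeta)/n$,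 $\theta(\zeta)=\liminf\frac{\log\widehat{w}^{\ast}_n(\zeta)}{\log n}$, $\tau(\zeta)=\limsup\frac{\log w_n(\zeta)}{\log n}$, $\sigma(\zeta)=\limsup\frac{\log\lambda_n(\zeta)}{\log n}$ (all limits as $n\to\infty$). Conventions: $1/\infty=0$, $1/0=\infty$.
   Formalization: The equality 1/τ(ζ) = −σ(ζ) is stated only when λ_1(ζ) < ∞, i.e. ζ is not a Liouville number; for Liouville numbers all λ_n(ζ) = ∞, so σ = ∞ while 1/τ = 0, and the equality fails. All other claims hold for every transcendental ζ. *)

theory Defs
  imports
    "HOL-Analysis.Analysis"
    "HOL-Computational_Algebra.Computational_Algebra"
begin

abbreviation ipoly :: "int poly \<Rightarrow> real \<Rightarrow> real" where
  "ipoly P x \<equiv> poly (map_poly of_int P) x"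

definition height :: "int poly \<Rightarrow> int" where
  "height P = (MAX i\<in>{..degree P}. \<bar>coeff P i\<bar>)"

text \<open>The sign of the leading coefficient is fixed only to make the polynomial unique.\<close>

definition is_int_min_poly :: "int poly \<Rightarrow> real \<Rightarrow> bool" where
  "is_int_min_poly P \<alpha> \<longleftrightarrow>
     P \<noteq> 0 \<and> ipoly P \<alpha> = 0 \<and> (\<forall>Q. Q \<noteq> 0 \<and> ipoly Q \<alpha> = 0 \<longrightarrow> degree P \<le> degree Q) \<and>
     Polynomial.content P = 1 \<and> lead_coeff P > 0"

definition int_min_poly :: "real \<Rightarrow> int poly" where
  "int_min_poly \<alpha> = (THE P. is_int_min_poly P \<alpha>)"

lemma ipoly_smult: "ipoly (smult c P) x = of_int c * ipoly P x"
proof -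
  have "map_poly of_int (smult c P) = smult (of_int c) (map_poly of_int P :: real poly)"
    by (intro poly_eqI) (simp add: coeff_map_poly)
  then show ?thesis by simp
qed

lemma ipoly_diff: "ipoly (P - Q) x = ipoly P x - ipoly Q x"
proof -
  have "map_poly of_int (P - Q) = (map_poly of_int P - map_poly of_int Q :: real poly)"
    by (intro poly_eqI) (simp add: coeff_map_poly)
  then show ?thesis by simp
qed

lemma ex1_int_min_poly:
  assumes "algebraic \<alpha>"
  shows "\<exists>!P. is_int_min_poly P \<alpha>"
proof (rule ex_ex1I)
  from assms obtain p where p: "\<And>i. coeff p i \<in> \<int>" "p \<noteq> 0" "poly p \<alpha> = 0"
    unfolding algebraic_def by blast
  define p' where "p' = map_poly floor p"
  have pp': "map_poly of_int p' = p"
    using p(1) by (intro poly_eqI) (auto simp: p'_def coeff_map_poly elim!: Ints_cases)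
  with p have "p' \<noteq> 0 \<and> ipoly p' \<alpha> = 0" by auto
  then obtain Q where Q: "Q \<noteq> 0" "ipoly Q \<alpha> = 0"
    and min: "\<And>R. R \<noteq> 0 \<Longrightarrow> ipoly R \<alpha> = 0 \<Longrightarrow> degree Q \<le> degree R"
    using ex_has_least_nat[of "\<lambda>Q. Q \<noteq> 0 \<and> ipoly Q \<alpha> = 0" p' degree] by blast
  define P where "P = smult (sgn (lead_coeff Q)) (primitive_part Q)"
  have Q_eq: "Q = smult (content Q) (primitive_part Q)" by simp
  have s: "sgn (lead_coeff Q) \<noteq> 0" using Q by (simp add: sgn_0_0)
  have c: "content Q > 0"
    using Q(1) by (metis abs_ge_zero content_eq_zero_iff normalize_content normalize_int_def
        order_less_le)
  have "ipoly Q \<alpha> = of_int (content Q) * ipoly (primitive_part Q) \<alpha>"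
    by (subst Q_eq) (simp only: ipoly_smult)
  with Q c have "ipoly (primitive_part Q) \<alpha> = 0" by simp
  then have root: "ipoly P \<alpha> = 0" by (simp add: P_def ipoly_smult)
  have deg: "degree P = degree Q" using s by (simp add: P_def)
  have cont: "content P = 1"
    using s Q(1) by (simp add: P_def content_primitive_part sgn_if)
  have "lead_coeff Q = content Q * lead_coeff (primitive_part Q)"
    by (metis Q_eq lead_coeff_smult)
  with c have "sgn (lead_coeff Q) = sgn (lead_coeff (primitive_part Q))"
    by (simp add: sgn_mult)
  then have "lead_coeff P = \<bar>lead_coeff (primitive_part Q)\<bar>"
    by (simp add: P_def abs_sgn mult.commute del: degree_primitive_part)
  moreover have "lead_coeff (primitive_part Q) \<noteq> 0" using Q(1)
    by (simp del: degree_primitive_part)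
  ultimately have "lead_coeff P > 0" by simp
  with root deg cont min show "\<exists>P. is_int_min_poly P \<alpha>"
    unfolding is_int_min_poly_def by (intro exI[of _ P]) auto
next
  fix P Q assume P: "is_int_min_poly P \<alpha>" and Q: "is_int_min_poly Q \<alpha>"
  define a b where "a = lead_coeff P" and "b = lead_coeff Q"
  have ab: "a > 0" "b > 0" and deg: "degree P = degree Q"
    using P Q by (auto simp: is_int_min_poly_def a_def b_def intro: antisym)
  define R where "R = smult b P - smult a Q"
  have "ipoly R \<alpha> = of_int b * ipoly P \<alpha> - of_int a * ipoly Q \<alpha>"
    by (simp add: R_def ipoly_smult ipoly_diff)
  then have root: "ipoly R \<alpha> = 0"
    using P Q by (simp add: is_int_min_poly_def)
  have "R = 0"
  proof (rule ccontr)
    assume R: "R \<noteq> 0"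
    have le: "degree R \<le> degree P"
      using deg ab by (simp add: R_def degree_diff_le)
    moreover have "coeff R (degree P) = 0"
      using deg by (simp add: R_def a_def b_def)
    ultimately have "degree R < degree P"
      using R by (metis leading_coeff_0_iff order_le_less)
    with P R root show False by (auto simp: is_int_min_poly_def)
  qed
  then have eq: "smult b P = smult a Q" by (simp add: R_def)
  then have "content (smult b P) = content (smult a Q)" by simp
  then have "a = b" using P Q ab by (simp add: is_int_min_poly_def)
  with eq ab show "P = Q" by (auto simp: poly_eq_iff)
qed

definition alg_degree :: "real \<Rightarrow> nat" where
  "alg_degree \<alpha> = degree (int_min_poly \<alpha>)"

definition alg_height :: "real \<Rightarrow> int" where
  "alg_height \<alpha> = height (int_min_poly \<alpha>)"

definition w_exp :: "nat \<Rightarrow> real \<Rightarrow> ereal" where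
  "w_exp n \<zeta> = Sup {ereal w | w.
     infinite {P. degree P \<le> n \<and> 0 < \<bar>ipoly P \<zeta>\<bar> \<and> \<bar>ipoly P \<zeta>\<bar> \<le> real_of_int (height P) powr - w}}"

definition lambda_exp :: "nat \<Rightarrow> real \<Rightarrow> ereal" where
  "lambda_exp n \<zeta> = Sup {ereal l | l.
     \<exists>\<^sub>F X :: real in at_top. \<exists>(x :: int) (y :: nat \<Rightarrow> int).
       1 \<le> \<bar>x\<bar> \<and> real_of_int \<bar>x\<bar> \<le> X \<and>
       (\<forall>i\<in>{1..n}. \<bar>\<zeta> ^ i * real_of_int x - real_of_int (y i)\<bar> \<le> X powr - l)}"

definition w_hat_star_exp :: "nat \<Rightarrow> real \<Rightarrow> ereal" where
  "w_hat_star_exp n \<zeta> = Sup {ereal w | w.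
     \<forall>\<^sub>F X :: real in at_top. \<exists>\<alpha> :: real.
       algebraic \<alpha> \<and> alg_degree \<alpha> \<le> n \<and> real_of_int (alg_height \<alpha>) \<le> X \<and>
       \<bar>\<zeta> - \<alpha>\<bar> \<le> inverse (real_of_int (alg_height \<alpha>)) * X powr - w}"

definition ereal_ln :: "ereal \<Rightarrow> ereal" where
  "ereal_ln x = (if x \<le> 0 then - \<infinity> else if x = \<infinity> then \<infinity> else ereal (ln (real_of_ereal x)))"

definition w_upper :: "real \<Rightarrow> ereal" where
  "w_upper \<zeta> = limsup (\<lambda>n. w_exp n \<zeta> / ereal (real n))"

definition w_lower :: "real \<Rightarrow> ereal" where
  "w_lower \<zeta> = liminf (\<lambda>n. w_exp n \<zeta> / ereal (real n))"

definition w_hat_star_upper :: "real \<Rightarrow> ereal" where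
  "w_hat_star_upper \<zeta> = limsup (\<lambda>n. w_hat_star_exp n \<zeta> / ereal (real n))"

definition w_hat_star_lower :: "real \<Rightarrow> ereal" where
  "w_hat_star_lower \<zeta> = liminf (\<lambda>n. w_hat_star_exp n \<zeta> / ereal (real n))"

definition theta_exp :: "real \<Rightarrow> ereal" where
  "theta_exp \<zeta> = liminf (\<lambda>n. ereal_ln (w_hat_star_exp n \<zeta>) / ereal (ln (real n)))"

definition tau_exp :: "real \<Rightarrow> ereal" where
  "tau_exp \<zeta> = limsup (\<lambda>n. ereal_ln (w_exp n \<zeta>) / ereal (ln (real n)))"

text \<open>
  If \<open>\<zeta>\<close> is a Liouville number, i.e. \<open>lambda_exp 1 \<zeta> = \<infinity>\<close>, then \<open>lambda_exp n \<zeta> = \<infinity>\<close> for all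
  \<open>n \<ge> 1\<close> (multiply a rational approximation \<open>p/q\<close> out by \<open>q ^ n\<close>), so \<open>sigma_exp \<zeta> = \<infinity>\<close>, while
  \<open>tau_exp \<zeta> = \<infinity>\<close> and \<open>1 / tau_exp \<zeta> = 0\<close>. The identity \<open>1 / tau_exp \<zeta> = - sigma_exp \<zeta>\<close> is therefore meaningful
  only for \<open>lambda_exp 1 \<zeta> < \<infinity>\<close>, in which case every \<open>lambda_exp n \<zeta>\<close> with \<open>n \<ge> 1\<close> is finite.
\<close>

definition sigma_exp :: "real \<Rightarrow> ereal" where
  "sigma_exp \<zeta> = limsup (\<lambda>n. ereal_ln (lambda_exp n \<zeta>) / ereal (ln (real n)))"

text \<open>Division on \<^typ>\<open>ereal\<close> satisfies the conventions \<open>1 / \<infinity> = 0\<close> and \<open>1 / 0 = \<infinity>\<close>.\<close>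

end

theory Submission
  imports "Berlekamp_Zassenhaus.Factor_Bound" Defs
begin

text \<open>
  Write \<open>w\<^sub>n\<close>, \<open>v\<^sub>n\<close> and \<open>\<lambda>\<^sub>n\<close> for \<open>w_exp n \<zeta>\<close>, \<open>w_hat_star_exp n \<zeta>\<close> and \<open>lambda_exp n \<zeta>\<close>. Besides
  \<open>n \<le> w\<^sub>n\<close> and \<open>1 \<le> v\<^sub>n \<le> w\<^sub>n\<close>, three inequalities give all the limit statements.

  \<^item> If \<open>2 n < w\<^sub>m\<close>, then \<open>v\<^sub>n \<le> 2 m\<close>. Take an irreducible \<open>Q\<close> of degree at most \<open>m\<close> with
    \<open>|Q(\<zeta>)|\<close> very small, and let \<open>P\<close> be the minimal polynomial of an approximation \<open>\<alpha>\<close> of height at most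
    \<open>X = |Q(\<zeta>)| powr (- 1 / (2 m))\<close>. If \<open>P\<close> and \<open>Q\<close> are coprime, both being small at \<open>\<zeta>\<close>
    contradicts the integrality of their resultant; otherwise \<open>P = \<plusminus> Q\<close> is not small enough.

  \<^item> If \<open>w\<^sub>m + 2 m \<le> N\<close>, then \<open>\<lambda>\<^sub>N \<le> 1 / m\<close>. An integer vector \<open>(y\<^sub>0, \<dots>, y\<^sub>N)\<close> that is close to a
    multiple of \<open>(1, \<zeta>, \<dots>, \<zeta> ^ N)\<close> is a linear recurrence sequence: every integer polynomial of small
    height and small value at \<open>\<zeta>\<close> annihilates it. Let \<open>G\<close> be its primitive characteristic polynomial.
    As \<open>|G(\<zeta>)|\<close> is at least about \<open>H(G) powr (- w\<^sub>m)\<close>, the box principle yields a polynomial whose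
    coefficients are too small for a multiple of \<open>G\<close>, but which still annihilates the sequence.

  \<^item> \<open>1 / \<lambda>\<^sub>n \<le> v\<^sub>n\<close>. If there are no good simultaneous approximations, the values at \<open>\<zeta>\<close> of polynomials
    of bounded height are dense modulo 1 (a quantitative Kronecker theorem, proved with Fejer
    kernels). So the value of \<open>E T\<close>, with \<open>E\<close> a large integer, is corrected to almost \<open>0\<close>
    by a polynomial of smaller height; the result is steep near \<open>\<zeta>\<close> and has a root there.
\<close>

section \<open>Heights, minimal polynomials and the box principle\<close>

text \<open>The constants come from coupling different indices. The second and third inequality
  together give \<open>m \<le> v\<^sub>N\<close> as soon as \<open>w\<^sub>m + 2 m \<le> N\<close>;
  if \<open>w\<^sub>m\<close> is about \<open>c m\<close>, then \<open>N\<close> about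
  \<open>(c + 2) m\<close> suffices, whence \<open>1 / (c + 2)\<close>. In the first inequality,
  \<open>n\<close> just below \<open>w\<^sub>m / 2\<close> makes \<open>v\<^sub>n / n\<close> at
  most about \<open>4 m / w\<^sub>m\<close>. A large \<open>w\<^sub>m\<close> forces a small
  \<open>v\<^sub>n\<close>, so upper limits of one exponent are paired with lower limits of the
  other. On the logarithmic scale the factors 2 and 4 disappear, and both directions meet in
  \<open>1 / tau_exp \<zeta>\<close>. The third inequality also reads
  \<open>1 / v\<^sub>n \<le> \<lambda>\<^sub>n\<close>, which squeezes
  \<open>sigma_exp \<zeta>\<close> between \<open>- theta_exp \<zeta>\<close> and
  \<open>- (1 / tau_exp \<zeta>)\<close>. A recurring obstacle is that the height is not
  multiplicative. The Mahler measure is, and it agrees with the height up to factors that depend on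
  the degree only. This allows the passage from arbitrary polynomials to irreducible ones and bounds
  the heights of divisors.\<close>

lemma abs_coeff_le_height: "\<bar>coeff P i\<bar> \<le> height P"
proof (cases "i \<le> degree P")
  case True
  then show ?thesis unfolding height_def by (intro Max_ge) auto
next
  case False
  have "\<bar>coeff P 0\<bar> \<le> height P" unfolding height_def by (intro Max_ge) auto
  with False show ?thesis by (simp add: coeff_eq_0)
qed

lemma height_leI: "(\<And>i. \<bar>coeff P i\<bar> \<le> h) \<Longrightarrow> height P \<le> h"
  unfolding height_def by (subst Max_le_iff) auto

lemma height_nonneg: "0 \<le> height P"
  using abs_coeff_le_height[of P 0] by linarith

lemma height_ge_1:
  assumes "P \<noteq> 0"
  shows "1 \<le> height P"
proof -
  have "lead_coeff P \<noteq> 0" using assms by simp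
  then show ?thesis using abs_coeff_le_height[of P "degree P"] by linarith
qed

lemma ipoly_mult: "ipoly (P * Q) x = ipoly P x * ipoly Q x"
  by (simp add: of_int_poly_hom.hom_mult)

lemma ipoly_add: "ipoly (P + Q) x = ipoly P x + ipoly Q x"
  by (simp add: of_int_poly_hom.hom_add)

lemma ipoly_altdef:
  assumes "degree P \<le> n"
  shows "ipoly P x = (\<Sum>i\<le>n. of_int (coeff P i) * x ^ i)"
proof -
  have "ipoly P x = (\<Sum>i\<le>degree P. of_int (coeff P i) * x ^ i)"
    by (simp add: poly_altdef)
  also have "\<dots> = (\<Sum>i\<le>n. of_int (coeff P i) * x ^ i)"
    using assms by (intro sum.mono_neutral_left) (auto simp: coeff_eq_0)
  finally show ?thesis .
qed

lemma abs_ipoly_le: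
  assumes "degree P \<le> n" "\<And>i. \<bar>coeff P i\<bar> \<le> h"
  shows "\<bar>ipoly P x\<bar> \<le> of_int h * (\<Sum>i\<le>n. \<bar>x\<bar> ^ i)"
proof -
  have "\<bar>ipoly P x\<bar> \<le> (\<Sum>i\<le>n. \<bar>of_int (coeff P i) * x ^ i\<bar>)"
    unfolding ipoly_altdef[OF assms(1)] by (rule sum_abs)
  also have "\<dots> \<le> (\<Sum>i\<le>n. of_int h * \<bar>x\<bar> ^ i)"
  proof (rule sum_mono)
    fix i
    have "\<bar>of_int (coeff P i)\<bar> \<le> (of_int h :: real)" using assms(2)[of i] by linarith
    then show "\<bar>of_int (coeff P i) * x ^ i\<bar> \<le> of_int h * \<bar>x\<bar> ^ i"
      unfolding abs_mult power_abs by (intro mult_right_mono) auto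
  qed
  finally show ?thesis by (simp add: sum_distrib_left)
qed

lemma abs_power_diff_le:
  fixes x y r :: real
  assumes "\<bar>x\<bar> \<le> r" "\<bar>y\<bar> \<le> r" "1 \<le> r"
  shows "\<bar>x ^ i - y ^ i\<bar> \<le> real i * r ^ i * \<bar>x - y\<bar>"
proof (induction i)
  case (Suc i)
  have "x ^ Suc i - y ^ Suc i = x * (x ^ i - y ^ i) + y ^ i * (x - y)"
    by (simp add: algebra_simps)
  then have "\<bar>x ^ Suc i - y ^ Suc i\<bar> \<le> \<bar>x\<bar> * \<bar>x ^ i - y ^ i\<bar> + \<bar>y\<bar> ^ i * \<bar>x - y\<bar>"
    using abs_triangle_ineq[of "x * (x ^ i - y ^ i)" "y ^ i * (x - y)"]
    by (simp only: abs_mult power_abs)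
  also have "\<dots> \<le> r * (real i * r ^ i * \<bar>x - y\<bar>) + r ^ Suc i * \<bar>x - y\<bar>"
  proof (intro add_mono mult_mono Suc.IH)
    have "\<bar>y\<bar> ^ i \<le> r ^ i" using assms by (intro power_mono) auto
    also have "\<dots> \<le> r ^ Suc i" using assms by (intro power_increasing) auto
    finally show "\<bar>y\<bar> ^ i \<le> r ^ Suc i" .
  qed (use assms in auto)
  finally show ?case by (simp add: algebra_simps)
qed auto

lemma ipoly_lipschitz:
  obtains C where "C > 0"
    "\<And>(P :: int poly) \<alpha>. degree P \<le> n \<Longrightarrow> \<bar>\<zeta> - \<alpha>\<bar> \<le> 1 \<Longrightarrow>
       \<bar>ipoly P \<zeta> - ipoly P \<alpha>\<bar> \<le> C * of_int (height P) * \<bar>\<zeta> - \<alpha>\<bar>"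
proof -
  define r where "r = \<bar>\<zeta>\<bar> + 1"
  define C where "C = (\<Sum>i\<le>n. real i * r ^ i) + 1"
  have r: "r \<ge> 1" by (simp add: r_def)
  show ?thesis
  proof (rule that[of C])
    show "C > 0" using r by (auto simp: C_def intro!: add_nonneg_pos sum_nonneg)
    fix P :: "int poly" and \<alpha> assume P: "degree P \<le> n" and a: "\<bar>\<zeta> - \<alpha>\<bar> \<le> 1"
    have "ipoly P \<zeta> - ipoly P \<alpha> = (\<Sum>i\<le>n. of_int (coeff P i) * (\<zeta> ^ i - \<alpha> ^ i))"
      by (simp add: ipoly_altdef[OF P] sum_subtractf algebra_simps)
    also have "\<bar>\<dots>\<bar> \<le> (\<Sum>i\<le>n. \<bar>of_int (coeff P i) * (\<zeta> ^ i - \<alpha> ^ i)\<bar>)"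
      by (rule sum_abs)
    also have "\<dots> \<le> (\<Sum>i\<le>n. of_int (height P) * (real i * r ^ i * \<bar>\<zeta> - \<alpha>\<bar>))"
    proof (rule sum_mono)
      fix i
      have "\<bar>of_int (coeff P i)\<bar> \<le> (of_int (height P) :: real)"
        using abs_coeff_le_height[of P i] by linarith
      moreover have "\<bar>\<zeta> ^ i - \<alpha> ^ i\<bar> \<le> real i * r ^ i * \<bar>\<zeta> - \<alpha>\<bar>"
        using a by (intro abs_power_diff_le) (auto simp: r_def)
      ultimately show "\<bar>of_int (coeff P i) * (\<zeta> ^ i - \<alpha> ^ i)\<bar>
          \<le> of_int (height P) * (real i * r ^ i * \<bar>\<zeta> - \<alpha>\<bar>)"
        unfolding abs_mult by (intro mult_mono) (auto simp: height_nonneg)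
    qed
    also have "\<dots> = (C - 1) * of_int (height P) * \<bar>\<zeta> - \<alpha>\<bar>"
      by (simp add: C_def sum_distrib_left sum_distrib_right algebra_simps)
    also have "\<dots> \<le> C * of_int (height P) * \<bar>\<zeta> - \<alpha>\<bar>"
      by (intro mult_right_mono) (auto simp: height_nonneg)
    finally show "\<bar>ipoly P \<zeta> - ipoly P \<alpha>\<bar> \<le> C * of_int (height P) * \<bar>\<zeta> - \<alpha>\<bar>" .
  qed
qed

lemma root_imp_algebraic:
  assumes "P \<noteq> 0" "ipoly P \<alpha> = 0"
  shows "algebraic \<alpha>"
  using assms by (intro algebraicI[of "map_poly of_int P"]) auto

lemma ex_poly_with_coeffs:
  fixes a :: "nat \<Rightarrow> 'a :: comm_monoid_add"
  obtains P where "\<And>i. coeff P i = (if i \<le> d then a i else 0)" "degree P \<le> d"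
proof -
  define P where "P = (\<Sum>j\<le>d. monom (a j) j)"
  have "coeff P i = (if i \<le> d then a i else 0)" for i
    by (simp add: P_def coeff_sum)
  moreover from this have "degree P \<le> d" by (intro degree_le) auto
  ultimately show ?thesis by (rule that)
qed

text \<open>Pigeonhole: the \<open>(h + 1) ^ (d + 1)\<close> polynomials with coefficients in
  \<open>{0..h}\<close> have values in an interval of length \<open>O(h)\<close>, which is cut into
  \<open>h ^ (d + 1)\<close> boxes. Two values in one box give the difference
  \<open>P\<close>.\<close>

lemma dirichlet_polynomial:
  fixes \<zeta> :: real
  obtains c where "c > 0"
    "\<And>h :: nat. h \<ge> 1 \<Longrightarrow> \<exists>P. P \<noteq> 0 \<and> degree P \<le> d \<and> (\<forall>i. \<bar>coeff P i\<bar> \<le> int h) \<and>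
       \<bar>ipoly P \<zeta>\<bar> \<le> c / real h ^ d"
proof -
  define A where "A = (\<Sum>i\<le>d. \<bar>\<zeta>\<bar> ^ i)"
  have "A = 1 + (\<Sum>i\<in>{..d} - {0}. \<bar>\<zeta>\<bar> ^ i)" unfolding A_def by (subst sum.remove[of _ 0]) auto
  then have A: "A \<ge> 1" by (simp add: sum_nonneg)
  show ?thesis
  proof (rule that[of "3 * A"])
    show "3 * A > 0" using A by simp
    fix h :: nat assume h: "h \<ge> 1"
    define F where "F = ({..d} \<rightarrow>\<^sub>E {0..int h})"
    define val where "val f = (\<Sum>i\<le>d. real_of_int (f i) * \<zeta> ^ i)" for f
    \<comment> \<open>One more than the width \<open>2 * A * h\<close> of the range of values, so
      that the right end point also gets a box index strictly below \<open>N\<close>.\<close>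
    define W where "W = 2 * A * h + 1"
    define N where "N = h ^ Suc d"
    have W: "W > 0" using A by (simp add: W_def add_nonneg_pos)
    have N: "N > 0" using h by (simp add: N_def)
    define box where "box f = nat \<lfloor>(val f + A * h) / W * N\<rfloor>" for f
    have val: "\<bar>val f\<bar> \<le> A * h" if "f \<in> F" for f
    proof -
      have "\<bar>val f\<bar> \<le> (\<Sum>i\<le>d. \<bar>real_of_int (f i) * \<zeta> ^ i\<bar>)" unfolding val_def by (rule sum_abs)
      also have "\<dots> \<le> (\<Sum>i\<le>d. real h * \<bar>\<zeta>\<bar> ^ i)"
      proof (rule sum_mono)
        fix i assume "i \<in> {..d}"
        then have "f i \<in> {0..int h}" using that by (auto simp: F_def)
        then have "\<bar>real_of_int (f i)\<bar> \<le> real h" by auto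
        then show "\<bar>real_of_int (f i) * \<zeta> ^ i\<bar> \<le> real h * \<bar>\<zeta>\<bar> ^ i"
          unfolding abs_mult power_abs by (intro mult_right_mono) auto
      qed
      finally show ?thesis by (simp add: A_def sum_distrib_left sum_distrib_right mult.commute)
    qed
    have nn: "0 \<le> (val f + A * h) / W * N" if "f \<in> F" for f
      using val[OF that] W by (intro mult_nonneg_nonneg divide_nonneg_pos) auto
    have "box ` F \<subseteq> {..<N}"
    proof
      fix b assume "b \<in> box ` F"
      then obtain f where f: "f \<in> F" "b = box f" by auto
      have "val f + A * h < W" using val[OF f(1)] by (simp add: W_def)
      then have "(val f + A * h) / W < 1" using W by simp
      then have "(val f + A * h) / W * N < 1 * real N" using N by (intro mult_strict_right_mono) auto
      then have "\<lfloor>(val f + A * h) / W * N\<rfloor> < int N" by (simp add: floor_less_iff)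
      then show "b \<in> {..<N}" using nn[OF f(1)] f(2) N by (simp add: box_def nat_less_iff)
    qed
    then have "card (box ` F) \<le> N" using card_mono[of "{..<N}" "box ` F"] by simp
    also have "N < (h + 1) ^ Suc d" unfolding N_def by (intro power_strict_mono) auto
    also have "\<dots> = card F"
      by (simp add: F_def card_PiE nat_add_distrib flip: One_nat_def)
    finally have "\<not> inj_on box F" by (intro pigeonhole)
    then obtain f g where fg: "f \<in> F" "g \<in> F" "f \<noteq> g" "box f = box g"
      by (auto simp: inj_on_def)
    obtain P where P: "\<And>i. coeff P i = (if i \<le> d then f i - g i else 0)" "degree P \<le> d"
      using ex_poly_with_coeffs[of d "\<lambda>i. f i - g i"] by blast
    have "P \<noteq> 0"
    proof
      assume "P = 0"
      then have "f i = g i" if "i \<le> d" for i using P(1)[of i] that by simp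
      then have "f = g" using fg(1,2) unfolding F_def by (intro PiE_ext[of f _ _ g]) auto
      with fg show False by simp
    qed
    moreover have "\<bar>coeff P i\<bar> \<le> int h" for i
    proof (cases "i \<le> d")
      case True
      then have "f i \<in> {0..int h}" "g i \<in> {0..int h}" using fg by (auto simp: F_def)
      with True show ?thesis by (auto simp: P(1))
    qed (simp add: P(1))
    moreover have "\<bar>ipoly P \<zeta>\<bar> \<le> 3 * A / real h ^ d"
    proof -
      have ip: "ipoly P \<zeta> = val f - val g"
        unfolding ipoly_altdef[OF P(2)] val_def sum_subtractf[symmetric]
        by (intro sum.cong) (auto simp: P(1) algebra_simps)
      have fl: "\<lfloor>(val f + A * h) / W * N\<rfloor> = \<lfloor>(val g + A * h) / W * N\<rfloor>"
        using fg(4) nn[OF fg(1)] nn[OF fg(2)] unfolding box_def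
        by (subst (asm) eq_nat_nat_iff) (simp_all only: zero_le_floor)
      have "\<bar>(val f + A * h) / W * N - (val g + A * h) / W * N\<bar> \<le> 1"
        using fl by linarith
      moreover have "(val f + A * h) / W * N - (val g + A * h) / W * N = ipoly P \<zeta> * N / W"
        using W by (simp add: ip field_simps)
      ultimately have "\<bar>ipoly P \<zeta>\<bar> * N \<le> W" using W N by (simp add: abs_mult field_simps)
      also have "W \<le> 3 * A * h"
      proof -
        have "1 * 1 \<le> A * real h" using A h by (intro mult_mono) auto
        then show ?thesis by (simp add: W_def)
      qed
      finally have "\<bar>ipoly P \<zeta>\<bar> * real h ^ d * h \<le> 3 * A * h" by (simp add: N_def algebra_simps)
      then have "\<bar>ipoly P \<zeta>\<bar> * real h ^ d \<le> 3 * A" using h by simp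
      then show ?thesis using h by (simp add: field_simps)
    qed
    ultimately show "\<exists>P. P \<noteq> 0 \<and> degree P \<le> d \<and> (\<forall>i. \<bar>coeff P i\<bar> \<le> int h) \<and>
       \<bar>ipoly P \<zeta>\<bar> \<le> 3 * A / real h ^ d" using P(2) by blast
  qed
qed

section \<open>Mahler measure, heights of divisors and divisibility by minimal polynomials\<close>

lemma mahler_measure_mult: "mahler_measure (P * Q) = mahler_measure P * mahler_measure Q"
  by (simp add: mahler_measure_def of_int_poly_hom.hom_mult measure_eq_prod)

lemma height_le_mahler_measure:
  assumes "degree P \<le> n"
  shows "of_int (height P) \<le> 2 ^ n * mahler_measure P"
proof -
  have "of_int \<bar>coeff P i\<bar> \<le> 2 ^ n * mahler_measure P" for i
  proof -
    have "(degree P choose i) \<le> 2 ^ degree P" by (rule binomial_le_pow2)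
    also have "\<dots> \<le> (2::nat) ^ n" using assms by (intro power_increasing) auto
    finally have "real (degree P choose i) \<le> real (2 ^ n)" by (simp only: of_nat_le_iff)
    then have "real (degree P choose i) * mahler_measure P \<le> 2 ^ n * mahler_measure P"
      by (intro mult_right_mono) (auto simp: mahler_measure_ge_0)
    with Mignotte_bound[of P i] show ?thesis by linarith
  qed
  then have "\<bar>coeff P i\<bar> \<le> \<lfloor>2 ^ n * mahler_measure P\<rfloor>" for i
    by (simp add: le_floor_iff)
  then have "height P \<le> \<lfloor>2 ^ n * mahler_measure P\<rfloor>" by (rule height_leI)
  then show ?thesis by (simp add: le_floor_iff)
qed

lemma mahler_measure_le_height:
  assumes "degree P \<le> n"
  shows "mahler_measure P \<le> real (n + 1) * of_int (height P)"
proof -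
  have "(\<Sum>a\<leftarrow>coeffs P. a * a) \<le> (\<Sum>a\<leftarrow>coeffs P. height P * height P)"
  proof (rule sum_list_mono)
    fix a assume "a \<in> set (coeffs P)"
    then have "\<bar>a\<bar> \<le> height P" by (auto simp: coeffs_def abs_coeff_le_height split: if_splits)
    then have "\<bar>a\<bar> * \<bar>a\<bar> \<le> height P * height P" by (intro mult_mono) auto
    then show "a * a \<le> height P * height P" by simp
  qed
  also have "\<dots> = int (length (coeffs P)) * (height P * height P)" by (simp add: sum_list_triv)
  also have "\<dots> \<le> int (n + 1) * (height P * height P)"
    using assms by (intro mult_right_mono) (cases "P = 0"; auto simp: length_coeffs_degree)+
  also have "\<dots> \<le> int (n + 1) * int (n + 1) * (height P * height P)"
    by (intro mult_right_mono) (auto simp: height_nonneg)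
  finally have "(\<Sum>a\<leftarrow>coeffs P. a * a) \<le> (int (n + 1) * height P) ^ 2"
    by (simp add: power2_eq_square algebra_simps)
  then have "real_of_int (\<Sum>a\<leftarrow>coeffs P. a * a) \<le> of_int ((int (n + 1) * height P) ^ 2)"
    by (simp only: of_int_le_iff)
  also have "\<dots> = (real (n + 1) * of_int (height P)) ^ 2" by simp
  finally have "real_of_int (\<Sum>a\<leftarrow>coeffs P. a * a) \<le> (real (n + 1) * of_int (height P)) ^ 2" .
  then have "sqrt (real_of_int (\<Sum>a\<leftarrow>coeffs P. a * a)) \<le> real (n + 1) * of_int (height P)"
    by (intro real_le_lsqrt) (auto simp: height_nonneg)
  with Landau_inequality_mahler_measure[of P] show ?thesis by linarith
qed

text \<open>The Mahler measure of an integer divisor is at most that of the multiple; Mignotte's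
  bound on one side and Landau's inequality on the other translate this into heights.\<close>

lemma height_dvd_le:
  assumes "F \<noteq> 0" "G dvd F" "degree F \<le> n"
  shows "of_int (height G) \<le> 2 ^ n * real (n + 1) * of_int (height F)"
proof -
  have "degree G \<le> n" using assms dvd_imp_degree_le[OF assms(2,1)] by linarith
  then have "of_int (height G) \<le> 2 ^ n * mahler_measure G" by (rule height_le_mahler_measure)
  also have "\<dots> \<le> 2 ^ n * mahler_measure F"
    using mahler_measure_dvd[OF assms(1,2)] by simp
  also have "\<dots> \<le> 2 ^ n * (real (n + 1) * of_int (height F))"
    using mahler_measure_le_height[OF assms(3)] by simp
  finally show ?thesis by simp
qed

text \<open>Gauss's lemma: the content is multiplicative, so \<open>c\<close> divides the content of
  the cofactor of \<open>G\<close> and can be cancelled.\<close>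

lemma primitive_dvd_smultD:
  fixes G F :: "int poly"
  assumes "Polynomial.content G = 1" "c \<noteq> 0" "G dvd smult c F"
  shows "G dvd F"
proof -
  from assms(3) obtain Q where Q: "smult c F = G * Q" by (elim dvdE)
  then have "Polynomial.content (smult c F) = Polynomial.content Q" using assms(1) by (simp add: content_mult)
  then have "\<bar>c\<bar> * Polynomial.content F = Polynomial.content Q" by (simp add: content_smult)
  then have "c dvd Polynomial.content Q" by (metis abs_dvd_iff dvd_triv_left)
  then have "[:c:] dvd Q" by (simp add: const_poly_dvd_iff_dvd_content)
  then obtain Q' where "Q = smult c Q'" by (elim dvdE) simp
  with Q have "smult c F = smult c (G * Q')" by simp
  then have "F = G * Q'" using assms(2) smult_cancel by blast
  then show ?thesis by simp
qed

lemma is_int_min_poly_int_min_poly: "algebraic \<alpha> \<Longrightarrow> is_int_min_poly (int_min_poly \<alpha>) \<alpha>"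
  unfolding int_min_poly_def by (rule theI') (rule ex1_int_min_poly)

text \<open>The pseudo-remainder vanishes at \<open>\<alpha>\<close> and has smaller degree, hence
  is 0; primitivity removes the power of the leading coefficient that pseudo-division
  introduces.\<close>

lemma int_min_poly_dvd:
  assumes "P \<noteq> 0" "ipoly P \<alpha> = 0"
  shows "int_min_poly \<alpha> dvd P"
proof -
  define G where "G = int_min_poly \<alpha>"
  have G: "G \<noteq> 0" "ipoly G \<alpha> = 0" "\<And>Q. Q \<noteq> 0 \<Longrightarrow> ipoly Q \<alpha> = 0 \<Longrightarrow> degree G \<le> degree Q" "Polynomial.content G = 1"
    using is_int_min_poly_int_min_poly[OF root_imp_algebraic[OF assms]]
    by (auto simp: is_int_min_poly_def G_def)
  obtain Q R where QR: "pseudo_divmod P G = (Q, R)" by force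
  define c where "c = lead_coeff G ^ (Suc (degree P) - degree G)"
  have c: "c \<noteq> 0" using G(1) by (simp add: c_def)
  have eq: "smult c P = G * Q + R" using pseudo_divmod(1)[OF G(1) QR] by (simp add: c_def)
  have "ipoly (smult c P) \<alpha> = ipoly (G * Q + R) \<alpha>" by (simp only: eq)
  then have "ipoly R \<alpha> = 0" unfolding ipoly_smult ipoly_add ipoly_mult assms(2) G(2) by simp
  with G(3)[of R] pseudo_divmod(2)[OF G(1) QR] have "R = 0" by fastforce
  with eq have "G dvd smult c P" by simp
  from primitive_dvd_smultD[OF G(4) c this] show ?thesis by (simp add: G_def)
qed

lemma alg_degree_le:
  assumes "P \<noteq> 0" "ipoly P \<alpha> = 0" "degree P \<le> n"
  shows "alg_degree \<alpha> \<le> n"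
  using dvd_imp_degree_le[OF int_min_poly_dvd[OF assms(1,2)] assms(1)] assms(3)
  by (simp add: alg_degree_def)

lemma alg_height_le:
  assumes "P \<noteq> 0" "ipoly P \<alpha> = 0" "degree P \<le> n"
  shows "of_int (alg_height \<alpha>) \<le> 2 ^ n * real (n + 1) * of_int (height P)"
  unfolding alg_height_def by (rule height_dvd_le[OF assms(1) int_min_poly_dvd[OF assms(1,2)] assms(3)])

section \<open>Elementary bounds for the exponents\<close>

text \<open>All implied constants of the asymptotic arguments are absorbed by this: a strict gap
  between exponents beats any constant.\<close>

lemma eventually_powr_less:
  fixes a b C :: real
  assumes "a < b"
  shows "\<forall>\<^sub>F X in at_top. C * X powr a < X powr b"
proof -
  have "\<forall>\<^sub>F X :: real in at_top. C < X powr (b - a)"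
    using eventually_gt_at_top[of "(\<bar>C\<bar> + 1) powr (1 / (b - a))"]
  proof eventually_elim
    case (elim X)
    have "C < \<bar>C\<bar> + 1" by linarith
    also have "\<dots> = ((\<bar>C\<bar> + 1) powr (1 / (b - a))) powr (b - a)"
      using assms by (simp add: powr_powr)
    also have "\<dots> < X powr (b - a)" using elim assms by (intro powr_less_mono2) auto
    finally show ?case .
  qed
  with eventually_gt_at_top[of 0] show ?thesis
  proof eventually_elim
    case (elim X)
    then have "C * X powr a < X powr (b - a) * X powr a" by simp
    also have "\<dots> = X powr b" by (simp flip: powr_add)
    finally show ?case .
  qed
qed

lemma le_Sup_ereal:
  assumes "\<And>v. v < w \<Longrightarrow> \<Phi> v"
  shows "ereal w \<le> Sup {ereal v | v. \<Phi> v}"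
proof (rule dense_le)
  fix z assume z: "z < ereal w"
  show "z \<le> Sup {ereal v | v. \<Phi> v}"
  proof (cases z)
    case (real r)
    with z have "\<Phi> r" by (intro assms) auto
    then show ?thesis using real by (intro Sup_upper) auto
  qed (use z in auto)
qed

lemma alg_height_ge_1: "algebraic \<alpha> \<Longrightarrow> 1 \<le> alg_height \<alpha>"
  using is_int_min_poly_int_min_poly[of \<alpha>] height_ge_1
  by (auto simp: alg_height_def is_int_min_poly_def)

context
  fixes \<zeta> :: real
  assumes trans: "\<not> algebraic \<zeta>"
begin

lemma ipoly_nonzero: "P \<noteq> 0 \<Longrightarrow> ipoly P \<zeta> \<noteq> 0"
  using trans root_imp_algebraic by blast

text \<open>By transcendence the values at \<open>\<zeta>\<close> of nonzero polynomials are
  nonzero, so those of a finite set are bounded away from 0.\<close>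

lemma infinite_if_small_values:
  assumes "\<And>\<rho>. \<rho> > 0 \<Longrightarrow> \<exists>P\<in>S. P \<noteq> 0 \<and> \<bar>ipoly P \<zeta>\<bar> < \<rho>"
  shows "infinite S"
proof
  assume S: "finite S"
  define V where "V = insert 1 ((\<lambda>P. \<bar>ipoly P \<zeta>\<bar>) ` (S - {0}))"
  have V: "finite V" "V \<noteq> {}" using S by (auto simp: V_def)
  have "Min V > 0" using V by (subst Min_gr_iff) (auto simp: V_def ipoly_nonzero)
  then obtain P where "P \<in> S" "P \<noteq> 0" "\<bar>ipoly P \<zeta>\<bar> < Min V" using assms by blast
  moreover from this have "Min V \<le> \<bar>ipoly P \<zeta>\<bar>" using V by (intro Min_le) (auto simp: V_def)
  ultimately show False by simp
qed

lemma w_exp_ge: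
  assumes "n \<ge> 1"
  shows "ereal (real n) \<le> w_exp n \<zeta>"
  unfolding w_exp_def
proof (rule le_Sup_ereal)
  fix w :: real assume w: "w < real n"
  \<comment> \<open>With a nonnegative exponent, \<open>real h powr - v\<close> does not exceed the
    same power of the possibly smaller height of \<open>P\<close>.\<close>
  define v where "v = max w 0"
  have v: "v < real n" "w \<le> v" "0 \<le> v" using w assms by (auto simp: v_def)
  obtain c where c: "c > 0"
    "\<And>h :: nat. h \<ge> 1 \<Longrightarrow> \<exists>P. P \<noteq> 0 \<and> degree P \<le> n \<and> (\<forall>i. \<bar>coeff P i\<bar> \<le> int h) \<and>
       \<bar>ipoly P \<zeta>\<bar> \<le> c / real h ^ n"
    by (rule dirichlet_polynomial[of n \<zeta>], rule that)
  show "infinite {P. degree P \<le> n \<and> 0 < \<bar>ipoly P \<zeta>\<bar> \<and>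
    \<bar>ipoly P \<zeta>\<bar> \<le> real_of_int (height P) powr - w}"
  proof (rule infinite_if_small_values)
    fix \<rho> :: real assume \<rho>: "\<rho> > 0"
    have "\<forall>\<^sub>F X :: real in at_top. c / \<rho> * X powr (- real n) < X powr 0"
      using assms by (intro eventually_powr_less) auto
    moreover have "\<forall>\<^sub>F X :: real in at_top. c * X powr (- real n) < X powr (- v)"
      using v by (intro eventually_powr_less) auto
    ultimately have "\<forall>\<^sub>F X :: real in at_top. c / \<rho> * X powr (- real n) < X powr 0 \<and>
      c * X powr (- real n) < X powr (- v) \<and> X \<ge> 1"
      using eventually_ge_at_top[of 1] by eventually_elim blast
    from eventually_compose_filterlim[OF this filterlim_real_sequentially]
    have "\<forall>\<^sub>F h :: nat in sequentially. c / \<rho> * real h powr (- real n) < real h powr 0 \<and>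
      c * real h powr (- real n) < real h powr (- v) \<and> real h \<ge> 1" .
    from eventually_happens'[OF sequentially_bot this]
    obtain h :: nat where h: "c / \<rho> * real h powr (- real n) < real h powr 0"
      "c * real h powr (- real n) < real h powr (- v)" "real h \<ge> 1" by blast
    have h1: "h \<ge> 1" using h(3) by simp
    from c(2)[OF h1] obtain P where P: "P \<noteq> 0" "degree P \<le> n" "\<And>i. \<bar>coeff P i\<bar> \<le> int h"
      "\<bar>ipoly P \<zeta>\<bar> \<le> c / real h ^ n" by blast
    have eq: "c / real h ^ n = c * real h powr (- real n)"
      using h1 by (simp add: powr_minus powr_realpow divide_inverse)
    have H: "1 \<le> real_of_int (height P)" "real_of_int (height P) \<le> real h"
      using height_ge_1[OF P(1)] height_leI[OF P(3)] by linarith+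
    have "real h powr (- v) \<le> real_of_int (height P) powr (- v)"
      using H v by (intro powr_mono2') auto
    also have "\<dots> \<le> real_of_int (height P) powr (- w)" using H v by (intro powr_mono) auto
    finally have "\<bar>ipoly P \<zeta>\<bar> \<le> real_of_int (height P) powr (- w)" using P(4) h(2) eq by linarith
    moreover have "\<bar>ipoly P \<zeta>\<bar> < \<rho>"
    proof -
      have "c * real h powr (- real n) / \<rho> < 1" using h(1,3) by simp
      then have "c * real h powr (- real n) < \<rho>" using \<rho> by (simp only: divide_less_eq_1_pos)
      then show ?thesis using P(4) eq by linarith
    qed
    ultimately show "\<exists>P\<in>{P. degree P \<le> n \<and> 0 < \<bar>ipoly P \<zeta>\<bar> \<and>
       \<bar>ipoly P \<zeta>\<bar> \<le> real_of_int (height P) powr - w}. P \<noteq> 0 \<and> \<bar>ipoly P \<zeta>\<bar> < \<rho>"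
      using P ipoly_nonzero by (intro bexI[of _ P]) auto
  qed
qed

text \<open>Only finitely many polynomials beat the exponent \<open>w\<close>; the constant is the
  least of their values. Inserting 1 covers the case that there are none and keeps the constant at
  most 1, as all other polynomials require.\<close>

lemma ipoly_lower_bound:
  assumes "w_exp n \<zeta> < ereal w" "w \<ge> 0"
  obtains c where "c > 0"
    "\<And>P. P \<noteq> 0 \<Longrightarrow> degree P \<le> n \<Longrightarrow> c * of_int (height P) powr (- w) \<le> \<bar>ipoly P \<zeta>\<bar>"
proof -
  define S where "S = {P. degree P \<le> n \<and> 0 < \<bar>ipoly P \<zeta>\<bar> \<and>
    \<bar>ipoly P \<zeta>\<bar> \<le> real_of_int (height P) powr - w}"
  have S: "finite S"
  proof (rule ccontr)
    assume "infinite S"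
    then have "ereal w \<le> w_exp n \<zeta>" unfolding w_exp_def S_def by (intro Sup_upper) auto
    with assms show False by simp
  qed
  define V where "V = insert 1 ((\<lambda>P. \<bar>ipoly P \<zeta>\<bar>) ` S)"
  have V: "finite V" "V \<noteq> {}" using S by (auto simp: V_def)
  show ?thesis
  proof (rule that[of "Min V"])
    show "Min V > 0" using V by (subst Min_gr_iff) (auto simp: V_def S_def)
    fix P :: "int poly" assume P: "P \<noteq> 0" "degree P \<le> n"
    have "real_of_int (height P) powr (- w) \<le> real_of_int (height P) powr 0"
      using height_ge_1[OF P(1)] assms(2) by (intro powr_mono) auto
    then have H: "real_of_int (height P) powr (- w) \<le> 1" using height_ge_1[OF P(1)] by simp
    have le1: "Min V \<le> 1" using V by (intro Min_le) (auto simp: V_def)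
    have pos: "Min V > 0" by fact
    show "Min V * of_int (height P) powr (- w) \<le> \<bar>ipoly P \<zeta>\<bar>"
    proof (cases "P \<in> S")
      case True
      then have "Min V \<le> \<bar>ipoly P \<zeta>\<bar>" using V by (intro Min_le) (auto simp: V_def)
      moreover have "Min V * of_int (height P) powr (- w) \<le> Min V * 1"
        using H pos by (intro mult_left_mono) auto
      ultimately show ?thesis by simp
    next
      case False
      then have "of_int (height P) powr (- w) \<le> \<bar>ipoly P \<zeta>\<bar>"
        using P ipoly_nonzero by (auto simp: S_def)
      moreover have "Min V * of_int (height P) powr (- w) \<le> 1 * of_int (height P) powr (- w)"
        using le1 by (intro mult_right_mono) auto
      ultimately show ?thesis by linarith
    qed
  qed
qed

text \<open>As the minimal polynomial vanishes at \<open>\<alpha>\<close>, its value at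
  \<open>\<zeta>\<close> is at most a constant times height times distance. The factor
  \<open>inverse (alg_height \<alpha>)\<close> in the definition of the uniform exponent cancels
  this height.\<close>

lemma ipoly_int_min_poly_le:
  obtains C where "C > 0"
    "\<And>\<alpha> X v. algebraic \<alpha> \<Longrightarrow> alg_degree \<alpha> \<le> n \<Longrightarrow> X \<ge> 1 \<Longrightarrow> v \<ge> 0 \<Longrightarrow>
       \<bar>\<zeta> - \<alpha>\<bar> \<le> inverse (real_of_int (alg_height \<alpha>)) * X powr - v \<Longrightarrow>
       \<bar>ipoly (int_min_poly \<alpha>) \<zeta>\<bar> \<le> C * X powr - v"
proof -
  obtain C where C: "C > 0"
    "\<And>P \<alpha>. degree P \<le> n \<Longrightarrow> \<bar>\<zeta> - \<alpha>\<bar> \<le> 1 \<Longrightarrow>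
       \<bar>ipoly P \<zeta> - ipoly P \<alpha>\<bar> \<le> C * of_int (height P) * \<bar>\<zeta> - \<alpha>\<bar>"
    by (rule ipoly_lipschitz[of n \<zeta>], rule that)
  show ?thesis
  proof (rule that[OF C(1)])
    fix \<alpha> X v :: real
    assume a: "algebraic \<alpha>" "alg_degree \<alpha> \<le> n" and X: "X \<ge> 1" "v \<ge> 0"
      and le: "\<bar>\<zeta> - \<alpha>\<bar> \<le> inverse (real_of_int (alg_height \<alpha>)) * X powr - v"
    define H where "H = real_of_int (alg_height \<alpha>)"
    have H: "H \<ge> 1" using alg_height_ge_1[OF a(1)] by (simp add: H_def)
    have "X powr - v \<le> X powr 0" using X by (intro powr_mono) auto
    then have "inverse H * X powr - v \<le> 1 * 1" using H X by (intro mult_mono) (auto simp: inverse_le_1_iff)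
    with le have 1: "\<bar>\<zeta> - \<alpha>\<bar> \<le> 1" by (simp add: H_def)
    have "ipoly (int_min_poly \<alpha>) \<alpha> = 0"
      using is_int_min_poly_int_min_poly[OF a(1)] by (simp add: is_int_min_poly_def)
    then have "\<bar>ipoly (int_min_poly \<alpha>) \<zeta>\<bar> \<le> C * H * \<bar>\<zeta> - \<alpha>\<bar>"
      using C(2)[OF _ 1, of "int_min_poly \<alpha>"] a(2) by (simp add: alg_degree_def H_def alg_height_def)
    also have "\<dots> \<le> C * H * (inverse H * X powr - v)"
      using le C(1) H by (intro mult_left_mono) (auto simp: H_def)
    also have "\<dots> = C * X powr - v" using H by simp
    finally show "\<bar>ipoly (int_min_poly \<alpha>) \<zeta>\<bar> \<le> C * X powr - v" .
  qed
qed

text \<open>Up to \<open>n\<close> the Dirichlet bound for \<open>w_exp\<close> suffices. Beyond it,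
  the minimal polynomials of the approximations serve: their values at \<open>\<zeta>\<close> tend
  to 0 as \<open>X\<close> grows, so infinitely many of them occur.\<close>

lemma w_hat_star_exp_le_w_exp:
  assumes "n \<ge> 1"
  shows "w_hat_star_exp n \<zeta> \<le> w_exp n \<zeta>"
  unfolding w_hat_star_exp_def
proof (rule Sup_least, clarify)
  fix v :: real
  assume ev: "\<forall>\<^sub>F X :: real in at_top. \<exists>\<alpha> :: real.
       algebraic \<alpha> \<and> alg_degree \<alpha> \<le> n \<and> real_of_int (alg_height \<alpha>) \<le> X \<and>
       \<bar>\<zeta> - \<alpha>\<bar> \<le> inverse (real_of_int (alg_height \<alpha>)) * X powr - v"
  show "ereal v \<le> w_exp n \<zeta>"
  proof (cases "v \<le> real n")
    case True
    then show ?thesis by (intro order_trans[OF _ w_exp_ge[OF assms]]) simp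
  next
    case False
    then have v0: "v > 0" using assms by linarith
    obtain C where C: "C > 0"
      "\<And>\<alpha> X v. algebraic \<alpha> \<Longrightarrow> alg_degree \<alpha> \<le> n \<Longrightarrow> X \<ge> 1 \<Longrightarrow> v \<ge> 0 \<Longrightarrow>
         \<bar>\<zeta> - \<alpha>\<bar> \<le> inverse (real_of_int (alg_height \<alpha>)) * X powr - v \<Longrightarrow>
         \<bar>ipoly (int_min_poly \<alpha>) \<zeta>\<bar> \<le> C * X powr - v"
      by (rule ipoly_int_min_poly_le[of n], rule that)
    show ?thesis unfolding w_exp_def
    proof (rule le_Sup_ereal)
      fix w assume w: "w < v"
      define u where "u = max w 0"
      have u: "u < v" "w \<le> u" "0 \<le> u" using w v0 by (auto simp: u_def)
      show "infinite {P. degree P \<le> n \<and> 0 < \<bar>ipoly P \<zeta>\<bar> \<and>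
        \<bar>ipoly P \<zeta>\<bar> \<le> real_of_int (height P) powr - w}"
      proof (rule infinite_if_small_values)
        fix \<rho> :: real assume \<rho>: "\<rho> > 0"
        have "\<forall>\<^sub>F X :: real in at_top. C / \<rho> * X powr (- v) < X powr 0"
          using v0 by (intro eventually_powr_less) auto
        moreover have "\<forall>\<^sub>F X :: real in at_top. C * X powr (- v) < X powr (- u)"
          using u by (intro eventually_powr_less) auto
        moreover note ev
        ultimately have "\<forall>\<^sub>F X :: real in at_top. C / \<rho> * X powr (- v) < X powr 0 \<and>
            C * X powr (- v) < X powr (- u) \<and> X \<ge> 1 \<and>
            (\<exists>\<alpha> :: real. algebraic \<alpha> \<and> alg_degree \<alpha> \<le> n \<and> real_of_int (alg_height \<alpha>) \<le> X \<and>
              \<bar>\<zeta> - \<alpha>\<bar> \<le> inverse (real_of_int (alg_height \<alpha>)) * X powr - v)"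
          using eventually_ge_at_top[of 1] by eventually_elim blast
        from eventually_happens'[OF trivial_limit_at_top_linorder this]
        obtain X :: real and \<alpha> where X: "C / \<rho> * X powr (- v) < X powr 0"
          "C * X powr (- v) < X powr (- u)" "X \<ge> 1"
          and a: "algebraic \<alpha>" "alg_degree \<alpha> \<le> n" "real_of_int (alg_height \<alpha>) \<le> X"
          "\<bar>\<zeta> - \<alpha>\<bar> \<le> inverse (real_of_int (alg_height \<alpha>)) * X powr - v"
          by blast
        define P where "P = int_min_poly \<alpha>"
        have P: "P \<noteq> 0" "degree P \<le> n" "real_of_int (height P) \<le> X"
          using is_int_min_poly_int_min_poly[OF a(1)] a
          by (auto simp: P_def is_int_min_poly_def alg_degree_def alg_height_def)
        have val: "\<bar>ipoly P \<zeta>\<bar> \<le> C * X powr (- v)"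
          using C(2)[OF a(1,2) X(3) _ a(4)] v0 by (simp add: P_def)
        have H: "1 \<le> real_of_int (height P)" using height_ge_1[OF P(1)] by simp
        have "X powr (- u) \<le> real_of_int (height P) powr (- u)"
          using H u P by (intro powr_mono2') auto
        also have "\<dots> \<le> real_of_int (height P) powr (- w)" using H u by (intro powr_mono) auto
        finally have "\<bar>ipoly P \<zeta>\<bar> \<le> real_of_int (height P) powr (- w)"
          using val X(2) by linarith
        moreover have "\<bar>ipoly P \<zeta>\<bar> < \<rho>"
        proof -
          have "C * X powr (- v) / \<rho> < 1" using X(1,3) by simp
          then have "C * X powr (- v) < \<rho>" using \<rho> by (simp only: divide_less_eq_1_pos)
          then show ?thesis using val by linarith
        qed
        ultimately show "\<exists>P\<in>{P. degree P \<le> n \<and> 0 < \<bar>ipoly P \<zeta>\<bar> \<and>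
           \<bar>ipoly P \<zeta>\<bar> \<le> real_of_int (height P) powr - w}. P \<noteq> 0 \<and> \<bar>ipoly P \<zeta>\<bar> < \<rho>"
          using P ipoly_nonzero by (intro bexI[of _ P]) auto
      qed
    qed
  qed
qed

text \<open>Rational numbers already suffice: the root of a linear Dirichlet polynomial is the
  approximation.\<close>

lemma w_hat_star_exp_ge_1:
  assumes "n \<ge> 1"
  shows "1 \<le> w_hat_star_exp n \<zeta>"
proof -
  have "ereal 1 \<le> w_hat_star_exp n \<zeta>"
    unfolding w_hat_star_exp_def
  proof (rule le_Sup_ereal)
    fix v :: real assume v: "v < 1"
    obtain c where c: "c > 0"
      "\<And>h :: nat. h \<ge> 1 \<Longrightarrow> \<exists>P. P \<noteq> 0 \<and> degree P \<le> 1 \<and> (\<forall>i. \<bar>coeff P i\<bar> \<le> int h) \<and>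
         \<bar>ipoly P \<zeta>\<bar> \<le> c / real h ^ 1"
      by (rule dirichlet_polynomial[of 1 \<zeta>], rule that)
    define K where "K = 32 * (\<bar>\<zeta>\<bar> + 1) * c"
    have "\<forall>\<^sub>F X :: real in at_top. K * X powr (- 1) < X powr (- v)"
      using v by (intro eventually_powr_less) auto
    with eventually_ge_at_top[of 8] eventually_gt_at_top[of "8 * c"]
    show "\<forall>\<^sub>F X :: real in at_top. \<exists>\<alpha> :: real.
       algebraic \<alpha> \<and> alg_degree \<alpha> \<le> n \<and> real_of_int (alg_height \<alpha>) \<le> X \<and>
       \<bar>\<zeta> - \<alpha>\<bar> \<le> inverse (real_of_int (alg_height \<alpha>)) * X powr - v"
    proof eventually_elim
      case (elim X)
      \<comment> \<open>The divisor 4 compensates the factor \<open>2 ^ 1 * (1 + 1)\<close> of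
        \<open>alg_height_le\<close> in degree 1. Together with \<open>X / 8 \<le> real h\<close> it
        accounts for the 32 in \<open>K\<close>.\<close>
      define h where "h = nat \<lfloor>X / 4\<rfloor>"
      have h: "real h \<le> X / 4" "real h > X / 4 - 1" using elim unfolding h_def by linarith+
      have h1: "h \<ge> 1" using h elim by linarith
      have h8: "X / 8 \<le> real h" using h elim by linarith
      from c(2)[OF h1] obtain P where P: "P \<noteq> 0" "degree P \<le> 1" "\<And>i. \<bar>coeff P i\<bar> \<le> int h"
        "\<bar>ipoly P \<zeta>\<bar> \<le> c / real h" by auto
      define a b where "a = coeff P 0" and "b = coeff P 1"
      have val: "ipoly P x = of_int a + of_int b * x" for x
        using ipoly_altdef[OF P(2), of x] by (simp add: a_def b_def)
      have small: "c / real h < 1" using h8 elim h1 c(1) by (simp add: field_simps)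
      have b: "b \<noteq> 0"
      proof
        assume b: "b = 0"
        then have "\<bar>real_of_int a\<bar> < 1" using P(4) small by (simp add: val)
        then have "a = 0" by linarith
        with b have "ipoly P \<zeta> = 0" by (simp add: val)
        with ipoly_nonzero[OF P(1)] show False by simp
      qed
      then have b1: "1 \<le> real_of_int \<bar>b\<bar>" by linarith
      define \<alpha> where "\<alpha> = - real_of_int a / of_int b"
      have root: "ipoly P \<alpha> = 0" using b by (simp add: val \<alpha>_def)
      have alg: "algebraic \<alpha>" by (rule root_imp_algebraic[OF P(1) root])
      have "alg_degree \<alpha> \<le> n" using alg_degree_le[OF P(1) root] P(2) assms by simp
      have hP: "height P \<le> int h" using P(3) by (rule height_leI)
      have hh: "real_of_int (alg_height \<alpha>) \<le> 4 * of_int (height P)"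
        using alg_height_le[OF P(1) root P(2)] by simp
      have "4 * real_of_int (height P) \<le> 4 * real h" using hP by linarith
      with hh h(1) have HX: "real_of_int (alg_height \<alpha>) \<le> X" by linarith
      have ab: "\<bar>real_of_int a\<bar> \<le> \<bar>real_of_int b\<bar> * (\<bar>\<zeta>\<bar> + 1)"
      proof -
        have "real_of_int a = ipoly P \<zeta> - of_int b * \<zeta>" by (simp add: val)
        then have "\<bar>real_of_int a\<bar> \<le> \<bar>ipoly P \<zeta>\<bar> + \<bar>real_of_int b\<bar> * \<bar>\<zeta>\<bar>"
          using abs_triangle_ineq4[of "ipoly P \<zeta>" "of_int b * \<zeta>"] by (simp only: abs_mult)
        then show ?thesis using P(4) small b1 by (simp add: algebra_simps)
      qed
      have "real_of_int (height P) \<le> \<bar>real_of_int b\<bar> * (\<bar>\<zeta>\<bar> + 1)"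
      proof -
        have "\<bar>coeff P i\<bar> \<le> \<lfloor>\<bar>real_of_int b\<bar> * (\<bar>\<zeta>\<bar> + 1)\<rfloor>" for i
        proof -
          consider "i = 0" | "i = 1" | "i > 1" by linarith
          then show ?thesis
          proof cases
            case 1
            then show ?thesis using ab by (simp add: le_floor_iff a_def)
          next
            case 2
            have "\<bar>real_of_int b\<bar> * 1 \<le> \<bar>real_of_int b\<bar> * (\<bar>\<zeta>\<bar> + 1)" by (intro mult_left_mono) auto
            then show ?thesis using 2 by (simp add: le_floor_iff b_def)
          next
            case 3
            then show ?thesis using P(2) by (simp add: coeff_eq_0)
          qed
        qed
        then have "height P \<le> \<lfloor>\<bar>real_of_int b\<bar> * (\<bar>\<zeta>\<bar> + 1)\<rfloor>" by (rule height_leI)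
        then show ?thesis by (simp add: le_floor_iff)
      qed
      with hh have Hb: "real_of_int (alg_height \<alpha>) \<le> 4 * (\<bar>real_of_int b\<bar> * (\<bar>\<zeta>\<bar> + 1))" by linarith
      have H1: "real_of_int (alg_height \<alpha>) \<ge> 1" using alg_height_ge_1[OF alg] by simp
      have "\<zeta> - \<alpha> = ipoly P \<zeta> / real_of_int b"
        using b by (simp add: val \<alpha>_def add_divide_distrib)
      then have "\<bar>\<zeta> - \<alpha>\<bar> = \<bar>ipoly P \<zeta>\<bar> / \<bar>real_of_int b\<bar>"
        by (simp only: abs_divide)
      then have "\<bar>\<zeta> - \<alpha>\<bar> * real_of_int (alg_height \<alpha>)
          \<le> \<bar>ipoly P \<zeta>\<bar> / \<bar>real_of_int b\<bar> * (4 * (\<bar>real_of_int b\<bar> * (\<bar>\<zeta>\<bar> + 1)))"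
        using Hb by (simp only:) (intro mult_left_mono, auto)
      also have "\<dots> = \<bar>ipoly P \<zeta>\<bar> * (4 * (\<bar>\<zeta>\<bar> + 1))" using b by simp
      also have "\<dots> \<le> c / real h * (4 * (\<bar>\<zeta>\<bar> + 1))" using P(4) by (intro mult_right_mono) auto
      also have "c / real h \<le> c / (X / 8)" using h8 elim c(1) by (intro divide_left_mono) auto
      then have "c / real h * (4 * (\<bar>\<zeta>\<bar> + 1)) \<le> c / (X / 8) * (4 * (\<bar>\<zeta>\<bar> + 1))"
        by (intro mult_right_mono) auto
      also have "\<dots> = K * X powr (- 1)" using elim(1) by (simp add: K_def powr_minus_divide)
      also have "\<dots> < X powr (- v)" using elim by simp
      finally have "\<bar>\<zeta> - \<alpha>\<bar> \<le> X powr - v / real_of_int (alg_height \<alpha>)"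
        using H1 by (subst pos_le_divide_eq) auto
      then have "\<bar>\<zeta> - \<alpha>\<bar> \<le> inverse (real_of_int (alg_height \<alpha>)) * X powr - v"
        by (simp only: divide_inverse mult.commute)
      with alg \<open>alg_degree \<alpha> \<le> n\<close> HX show ?case by blast
    qed
  qed
  then show ?thesis by (simp add: one_ereal_def)
qed

end

section \<open>Linear recurrences and the upper bound for simultaneous approximation\<close>

text \<open>The variable of the polynomial ring acts on sequences as the shift. By
  \<open>shift_act_mult\<close> this is a module action, so a polynomial that kills \<open>y\<close>
  is the characteristic polynomial of a linear recurrence for \<open>y\<close>.\<close>

definition shift_act :: "'a :: comm_ring_1 poly \<Rightarrow> (nat \<Rightarrow> 'a) \<Rightarrow> nat \<Rightarrow> 'a" where
  "shift_act P y j = (\<Sum>i\<le>degree P. coeff P i * y (i + j))"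

lemma shift_act_altdef:
  assumes "degree P \<le> n"
  shows "shift_act P y j = (\<Sum>i\<le>n. coeff P i * y (i + j))"
  unfolding shift_act_def using assms by (intro sum.mono_neutral_left) (auto simp: coeff_eq_0)

lemma shift_act_pCons: "shift_act (pCons a P) y j = a * y j + shift_act P y (Suc j)"
proof -
  have "shift_act (pCons a P) y j = (\<Sum>i\<le>Suc (degree P). coeff (pCons a P) i * y (i + j))"
    by (rule shift_act_altdef) (rule degree_pCons_le)
  also have "\<dots> = a * y j + (\<Sum>i\<le>degree P. coeff P i * y (i + Suc j))"
    by (subst sum.atMost_Suc_shift) simp
  finally show ?thesis by (simp add: shift_act_def)
qed

lemma shift_act_0: "shift_act 0 y j = 0"
  by (simp add: shift_act_def)

lemma shift_act_add: "shift_act (P + Q) y j = shift_act P y j + shift_act Q y j"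
proof -
  define n where "n = max (degree P) (degree Q)"
  have n: "degree P \<le> n" "degree Q \<le> n" "degree (P + Q) \<le> n"
    by (auto simp: n_def intro: degree_add_le)
  show ?thesis
    by (simp add: shift_act_altdef[OF n(1)] shift_act_altdef[OF n(2)] shift_act_altdef[OF n(3)]
        sum.distrib algebra_simps)
qed

lemma shift_act_smult: "shift_act (smult c P) y j = c * shift_act P y j"
  unfolding shift_act_altdef[OF degree_smult_le] shift_act_def[of P]
  by (simp add: sum_distrib_left mult.assoc)

lemma shift_act_mult: "shift_act (P * Q) y j = shift_act P (shift_act Q y) j"
proof (induction P arbitrary: j)
  case 0
  then show ?case by (simp add: shift_act_0)
next
  case (pCons a P)
  have "shift_act (pCons a P * Q) y j = shift_act (smult a Q) y j + shift_act (pCons 0 (P * Q)) y j"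
    by (simp add: shift_act_add)
  then show ?case using pCons.IH[of "Suc j"] by (simp add: shift_act_pCons shift_act_smult)
qed

text \<open>A recurrence determines its top term from the preceding ones. The leading coefficient
  need not be a unit, because only the conclusion that a term is 0 is drawn.\<close>

lemma recurrence_vanishes:
  fixes G :: "'a :: idom poly"
  assumes "G \<noteq> 0" "\<And>j. j + degree G \<le> M \<Longrightarrow> shift_act G z j = 0" "\<And>j. j < degree G \<Longrightarrow> z j = 0"
    and "j \<le> M"
  shows "z j = 0"
  using \<open>j \<le> M\<close>
proof (induction j rule: less_induct)
  case (less j)
  show ?case
  proof (cases "j < degree G")
    case False
    define d where "d = degree G"
    have "0 = shift_act G z (j - d)" using False less.prems by (subst assms(2)) (auto simp: d_def)
    also have "\<dots> = (\<Sum>i<d. coeff G i * z (i + (j - d))) + lead_coeff G * z j"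
      using False by (simp add: shift_act_def d_def flip: lessThan_Suc_atMost)
    also have "(\<Sum>i<d. coeff G i * z (i + (j - d))) = 0"
    proof (rule sum.neutral, safe)
      fix i assume "i < d"
      then have "z (i + (j - d)) = 0" using False less.prems by (intro less.IH) (auto simp: d_def)
      then show "coeff G i * z (i + (j - d)) = 0" by simp
    qed
    finally show ?thesis using assms(1) by simp
  qed (rule assms(3))
qed

text \<open>Only \<open>y 0, ..., y N\<close> matter, so the number of equations decreases with the
  degree, and degrees above \<open>N\<close> impose none. The annihilators therefore need not form
  an ideal, and divisibility by a minimal one needs the degree condition of
  \<open>minimal_annihilator_dvd\<close>.\<close>

definition annihilates :: "nat \<Rightarrow> (nat \<Rightarrow> int) \<Rightarrow> int poly \<Rightarrow> bool" where
  "annihilates N y P \<longleftrightarrow> P \<noteq> 0 \<and> (\<forall>j. j + degree P \<le> N \<longrightarrow> shift_act P y j = 0)"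

lemma primitive_minimal_annihilator:
  assumes "annihilates N y P"
  obtains G where "annihilates N y G" "Polynomial.content G = 1"
    "\<And>Q. annihilates N y Q \<Longrightarrow> degree G \<le> degree Q"
proof -
  obtain F where F: "annihilates N y F" "\<And>Q. annihilates N y Q \<Longrightarrow> degree F \<le> degree Q"
    using ex_has_least_nat[of "annihilates N y" P degree] assms by blast
  define G where "G = primitive_part F"
  have F0: "F \<noteq> 0" using F(1) by (simp add: annihilates_def)
  have deg: "degree G = degree F" by (simp add: G_def)
  have "Polynomial.content F \<noteq> 0" using F0 by simp
  moreover have "shift_act F y j = Polynomial.content F * shift_act G y j" for j
    by (subst content_times_primitive_part[symmetric]) (simp only: shift_act_smult G_def)
  ultimately have "annihilates N y G"
    using F(1) F0 deg by (auto simp: annihilates_def G_def simp del: degree_primitive_part)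
  moreover have "Polynomial.content G = 1" using F0 by (simp add: G_def)
  ultimately show ?thesis using F(2) deg by (intro that[of G]) auto
qed

text \<open>The pseudo-remainder \<open>R\<close> of \<open>S\<close> modulo \<open>G\<close> yields
  a sequence \<open>shift_act R y\<close> that satisfies the recurrence of \<open>G\<close> and
  starts with enough zeros to vanish throughout. Then \<open>R\<close> would be an annihilator of
  smaller degree.\<close>

lemma minimal_annihilator_dvd:
  assumes G: "annihilates N y G" "Polynomial.content G = 1"
    and min: "\<And>Q. annihilates N y Q \<Longrightarrow> degree G \<le> degree Q"
    and S: "degree S \<le> s" "s + degree G \<le> N + 1" "\<And>j. j + s \<le> N \<Longrightarrow> shift_act S y j = 0"
  shows "G dvd S"
proof -
  have G0: "G \<noteq> 0" and Gy: "\<And>j. j + degree G \<le> N \<Longrightarrow> shift_act G y j = 0"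
    using G(1) by (auto simp: annihilates_def)
  obtain Q R where QR: "pseudo_divmod S G = (Q, R)" by force
  define c where "c = lead_coeff G ^ (Suc (degree S) - degree G)"
  have c: "c \<noteq> 0" using G0 by (simp add: c_def)
  have eq: "smult c S = G * Q + R" using pseudo_divmod(1)[OF G0 QR] by (simp add: c_def)
  have "R = 0"
  proof (rule ccontr)
    assume R: "R \<noteq> 0"
    have degR: "degree R < degree G" using pseudo_divmod(2)[OF G0 QR] R by simp
    have degQ: "degree Q + degree G \<le> s" if "Q \<noteq> 0"
    proof -
      have "degree G + degree Q = degree (smult c S - R)" using that G0 by (simp add: eq degree_mult_eq)
      also have "\<dots> \<le> max (degree S) (degree R)"
        using degree_diff_le_max[of "smult c S" R] c by simp
      finally show ?thesis using degR S(1) by linarith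
    qed
    have z0: "shift_act R y j = 0" if j: "j + s \<le> N" for j
    proof -
      have "c * shift_act S y j = shift_act (Q * G) y j + shift_act R y j"
        by (simp only: shift_act_smult[symmetric] eq shift_act_add mult.commute[of Q])
      moreover have "shift_act (Q * G) y j = 0"
      proof (cases "Q = 0")
        case False
        have "shift_act (Q * G) y j = (\<Sum>i\<le>degree Q. coeff Q i * shift_act G y (i + j))"
          by (simp only: shift_act_mult) (simp only: shift_act_def[of Q])
        also have "\<dots> = 0" using degQ[OF False] j by (intro sum.neutral ballI) (simp add: Gy)
        finally show ?thesis .
      qed (simp add: shift_act_0)
      ultimately show ?thesis using S(3)[OF j] by simp
    qed
    \<comment> \<open>So far zeros are known for \<open>j \<le> N - s\<close> only. The condition
      \<open>s + degree G \<le> N + 1\<close> makes these cover the first \<open>degree G\<close>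
      indices, and the recurrence carries them on to \<open>N - degree R\<close>.\<close>
    have "shift_act R y j = 0" if j: "j + degree R \<le> N" for j
    proof (rule recurrence_vanishes[OF G0, where M = "N - degree R"])
      fix j assume j: "j + degree G \<le> N - degree R"
      have "shift_act G (shift_act R y) j = shift_act R (shift_act G y) j"
        by (simp only: shift_act_mult[symmetric] mult.commute)
      also have "\<dots> = 0" using j degR unfolding shift_act_def[of R] by (intro sum.neutral ballI) (subst Gy, auto)
      finally show "shift_act G (shift_act R y) j = 0" .
    next
      fix j assume "j < degree G"
      then show "shift_act R y j = 0" using S(2) by (intro z0) linarith
    qed (use j in linarith)
    then have "annihilates N y R" using R by (simp add: annihilates_def)
    from min[OF this] degR show False by simp
  qed
  with eq have "G dvd smult c S" by simp
  then show ?thesis by (rule primitive_dvd_smultD[OF G(2) c])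
qed

text \<open>On the exact geometric sequence \<open>x * \<zeta> ^ i\<close> the polynomial acts as
  multiplication by \<open>P(\<zeta>)\<close>; the right-hand side bounds the effect of the
  errors.\<close>

lemma shift_act_approx:
  fixes \<zeta> \<epsilon> :: real and y :: "nat \<Rightarrow> int"
  assumes y: "\<And>i. i \<le> N \<Longrightarrow> \<bar>\<zeta> ^ i * of_int x - of_int (y i)\<bar> \<le> \<epsilon>"
    and P: "degree P + j \<le> N" "\<And>i. \<bar>coeff P i\<bar> \<le> h"
  shows "\<bar>of_int (shift_act P y j) - of_int x * \<zeta> ^ j * ipoly P \<zeta>\<bar> \<le> real (N + 1) * of_int h * \<epsilon>"
proof -
  have h: "h \<ge> 0" using P(2)[of 0] by linarith
  have e: "\<epsilon> \<ge> 0" using y[of 0] by linarith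
  have "of_int (shift_act P y j) - of_int x * \<zeta> ^ j * ipoly P \<zeta> =
      (\<Sum>i\<le>degree P. of_int (coeff P i) * (of_int (y (i + j)) - \<zeta> ^ (i + j) * of_int x))"
    by (simp add: shift_act_def ipoly_altdef[OF order_refl] sum_distrib_left sum_subtractf
        algebra_simps power_add)
  also have "\<bar>\<dots>\<bar> \<le> (\<Sum>i\<le>degree P. \<bar>of_int (coeff P i) * (of_int (y (i + j)) - \<zeta> ^ (i + j) * of_int x)\<bar>)"
    by (rule sum_abs)
  also have "\<dots> \<le> (\<Sum>i\<le>degree P. of_int h * \<epsilon>)"
  proof (rule sum_mono)
    fix i assume "i \<in> {..degree P}"
    then have "\<bar>\<zeta> ^ (i + j) * of_int x - of_int (y (i + j))\<bar> \<le> \<epsilon>" using P(1) by (intro y) auto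
    then have 1: "\<bar>of_int (y (i + j)) - \<zeta> ^ (i + j) * of_int x\<bar> \<le> \<epsilon>"
      by (subst abs_minus_commute)
    have 2: "\<bar>of_int (coeff P i)\<bar> \<le> (of_int h :: real)" using P(2)[of i] by linarith
    show "\<bar>of_int (coeff P i) * (of_int (y (i + j)) - \<zeta> ^ (i + j) * of_int x)\<bar> \<le> of_int h * \<epsilon>"
      unfolding abs_mult using h by (intro mult_mono 1 2) auto
  qed
  also have "\<dots> = real (degree P + 1) * (of_int h * \<epsilon>)" by simp
  also have "\<dots> \<le> real (N + 1) * (of_int h * \<epsilon>)"
    using P(1) h e by (intro mult_right_mono) auto
  finally show ?thesis by (simp only: mult.assoc)
qed

section \<open>Obstruction to simultaneous approximation\<close>

context
  fixes \<zeta> :: real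
  assumes trans: "\<not> algebraic \<zeta>"
begin

lemma eventually_no_simultaneous_approximation:
  fixes m N :: nat and w l :: real
  assumes m: "m \<ge> 1" and w: "w_exp m \<zeta> < ereal w" "w \<ge> 0" and N: "w + real (2 * m) \<le> real N + 1"
    and l: "l > 1 / real m"
  shows "\<forall>\<^sub>F X :: real in at_top. \<not> (\<exists>(x :: int) (y :: nat \<Rightarrow> int).
       1 \<le> \<bar>x\<bar> \<and> real_of_int \<bar>x\<bar> \<le> X \<and>
       (\<forall>i\<in>{1..N}. \<bar>\<zeta> ^ i * real_of_int x - real_of_int (y i)\<bar> \<le> X powr - l))"
proof -
  \<comment> \<open>Annihilators of height about \<open>X powr l'\<close> are sought. With
    \<open>l' > 1 / m\<close> the main term, of size \<open>X powr (1 - m * l')\<close>, is small,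
    and with \<open>l' < l\<close> so is the error term, of size \<open>X powr (l' - l)\<close>. The
    integer \<open>shift_act P y j\<close> is then 0.\<close>
  define l' where "l' = (1 / real m + l) / 2"
  have l': "1 / real m < l'" "l' < l" using l by (auto simp: l'_def field_simps)
  have "1 / real m > 0" using m by simp
  then have l'0: "l' > 0" using l'(1) by linarith
  have ml': "real m * l' > 1" using l'(1) m by (simp add: field_simps)
  \<comment> \<open>The largest degree bound for \<open>S\<close> that
    \<open>minimal_annihilator_dvd\<close> allows when \<open>degree G \<le> m\<close>. As
    \<open>s \<ge> w\<close>, the later bound \<open>H powr (1 + w - s)\<close> is at most
    \<open>H\<close>.\<close>
  define s where "s = N + 1 - m"
  have mN: "2 * m \<le> N + 1" using N w(2) by linarith
  have ms: "w + real m \<le> real s" "s + m = N + 1" using N mN by (auto simp: s_def of_nat_diff)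
  obtain c0 where c0: "c0 > 0"
    "\<And>P. P \<noteq> 0 \<Longrightarrow> degree P \<le> m \<Longrightarrow> c0 * of_int (height P) powr (- w) \<le> \<bar>ipoly P \<zeta>\<bar>"
    by (rule ipoly_lower_bound[OF trans w], rule that)
  obtain c1 where c1: "c1 > 0"
    "\<And>h :: nat. h \<ge> 1 \<Longrightarrow> \<exists>P. P \<noteq> 0 \<and> degree P \<le> m \<and> (\<forall>i. \<bar>coeff P i\<bar> \<le> int h) \<and>
       \<bar>ipoly P \<zeta>\<bar> \<le> c1 / real h ^ m"
    by (rule dirichlet_polynomial[of m \<zeta>], rule that)
  obtain c2 where c2: "c2 > 0"
    "\<And>h :: nat. h \<ge> 1 \<Longrightarrow> \<exists>P. P \<noteq> 0 \<and> degree P \<le> s \<and> (\<forall>i. \<bar>coeff P i\<bar> \<le> int h) \<and>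
       \<bar>ipoly P \<zeta>\<bar> \<le> c2 / real h ^ s"
    by (rule dirichlet_polynomial[of s \<zeta>], rule that)
  define Z where "Z = max 1 \<bar>\<zeta>\<bar> ^ N"
  have Z: "\<bar>\<zeta>\<bar> ^ j \<le> Z" if "j \<le> N" for j
  proof -
    have "\<bar>\<zeta>\<bar> ^ j \<le> max 1 \<bar>\<zeta>\<bar> ^ j" by (intro power_mono) auto
    also have "\<dots> \<le> Z" unfolding Z_def using that by (intro power_increasing) auto
    finally show ?thesis .
  qed
  have Z1: "Z \<ge> 1" using Z[of 0] by simp
  define K1 where "K1 = 2 ^ m * real (m + 1)"
  define K2 where "K2 = 2 ^ s * real (s + 1)"
  define N1 where "N1 = real (N + 1)"
  have K: "K1 > 0" "K2 > 0" "N1 > 0" by (auto simp: K1_def K2_def N1_def add_pos_nonneg)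
  define C where "C = Z * (c2 * (4 * K2) ^ s) * (N1 / c0) + N1"
  have C: "C > 0" using Z1 c2(1) K c0(1) unfolding C_def by (intro add_nonneg_pos mult_nonneg_nonneg) auto
  have "\<forall>\<^sub>F X :: real in at_top. (2 * Z * (c1 * 2 ^ m)) * X powr (1 - real m * l') < X powr 0"
    using ml' by (intro eventually_powr_less) auto
  moreover have "\<forall>\<^sub>F X :: real in at_top. (2 * N1) * X powr (l' - l) < X powr 0"
    using l' by (intro eventually_powr_less) auto
  moreover have "\<forall>\<^sub>F X :: real in at_top. (C * K1) * X powr (l' - l) < X powr 0"
    using l' by (intro eventually_powr_less) auto
  moreover have "\<forall>\<^sub>F X :: real in at_top. ((2 * K2) powr (1 + w) * N1 / c0) * X powr 0 < X powr l"
    using l' l'0 by (intro eventually_powr_less) auto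
  ultimately show ?thesis using eventually_ge_at_top[of 1]
  proof eventually_elim
    case (elim X)
    note X1 = elim(5)
    have X0: "X powr 0 = 1" using X1 by simp
    show ?case
    proof
      assume "\<exists>(x :: int) (y :: nat \<Rightarrow> int). 1 \<le> \<bar>x\<bar> \<and> real_of_int \<bar>x\<bar> \<le> X \<and>
         (\<forall>i\<in>{1..N}. \<bar>\<zeta> ^ i * real_of_int x - real_of_int (y i)\<bar> \<le> X powr - l)"
      then obtain x :: int and y' :: "nat \<Rightarrow> int" where x: "1 \<le> \<bar>x\<bar>" "real_of_int \<bar>x\<bar> \<le> X"
        and y': "\<And>i. i \<in> {1..N} \<Longrightarrow> \<bar>\<zeta> ^ i * real_of_int x - real_of_int (y' i)\<bar> \<le> X powr - l"
        by blast
      \<comment> \<open>The missing entry \<open>y 0\<close> is approximated by \<open>x\<close>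
        without error.\<close>
      define y where "y = y'(0 := x)"
      have y: "\<bar>\<zeta> ^ i * real_of_int x - real_of_int (y i)\<bar> \<le> X powr - l" if "i \<le> N" for i
        using y'[of i] that by (cases "i = 0") (auto simp: y_def)
      have x1: "\<bar>real_of_int x\<bar> \<ge> 1" "\<bar>real_of_int x\<bar> \<le> X" using x by linarith+
      have act_le: "\<bar>real_of_int (shift_act P y j)\<bar> \<le> \<bar>of_int x\<bar> * Z * \<bar>ipoly P \<zeta>\<bar> + N1 * of_int h * X powr - l"
        if "degree P + j \<le> N" "\<And>i. \<bar>coeff P i\<bar> \<le> h" for P j h
      proof -
        have "\<bar>real_of_int (shift_act P y j) - of_int x * \<zeta> ^ j * ipoly P \<zeta>\<bar> \<le> N1 * of_int h * X powr - l"
          unfolding N1_def by (rule shift_act_approx[OF y that])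
        moreover have "\<bar>of_int x * \<zeta> ^ j * ipoly P \<zeta>\<bar> \<le> \<bar>of_int x\<bar> * Z * \<bar>ipoly P \<zeta>\<bar>"
          unfolding abs_mult power_abs using Z[of j] that(1) by (intro mult_right_mono mult_left_mono) auto
        ultimately show ?thesis by linarith
      qed
      define h where "h = nat \<lfloor>X powr l'\<rfloor>"
      have Xl': "X powr l' \<ge> 1" using X1 l'0 by (simp add: ge_one_powr_ge_zero)
      have h: "real h \<le> X powr l'" "real h > X powr l' - 1" using Xl' unfolding h_def by linarith+
      have h1: "h \<ge> 1" using Xl' by (simp add: h_def le_nat_floor)
      have h2: "X powr l' / 2 \<le> real h" using h h1 by linarith
      from c1(2)[OF h1] obtain P where P: "P \<noteq> 0" "degree P \<le> m" "\<And>i. \<bar>coeff P i\<bar> \<le> int h"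
        "\<bar>ipoly P \<zeta>\<bar> \<le> c1 / real h ^ m" by blast
      have valP: "\<bar>ipoly P \<zeta>\<bar> \<le> c1 * 2 ^ m * X powr (- (real m * l'))"
      proof -
        have "c1 / real h ^ m \<le> c1 / (X powr l' / 2) ^ m"
          using h2 Xl' c1(1) h1 by (intro divide_left_mono power_mono mult_pos_pos zero_less_power) auto
        also have "(X powr l' / 2) ^ m = X powr (real m * l') / 2 ^ m"
          using X1 by (simp add: power_divide powr_powr mult.commute flip: powr_realpow)
        also have "c1 / (X powr (real m * l') / 2 ^ m) = c1 * 2 ^ m * X powr (- (real m * l'))"
          by (simp add: powr_minus_divide)
        finally show ?thesis using P(4) by linarith
      qed
      have annP: "annihilates N y P"
        unfolding annihilates_def
      proof (intro conjI allI impI)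
        fix j assume j: "j + degree P \<le> N"
        have "\<bar>real_of_int (shift_act P y j)\<bar> \<le> \<bar>of_int x\<bar> * Z * \<bar>ipoly P \<zeta>\<bar> + N1 * of_int (int h) * X powr - l"
          using j P(3) by (intro act_le) auto
        also have "\<bar>of_int x\<bar> * Z * \<bar>ipoly P \<zeta>\<bar> \<le> X * Z * (c1 * 2 ^ m * X powr (- (real m * l')))"
          using x1 Z1 valP X1 by (intro mult_mono) auto
        also have "\<dots> = (Z * (c1 * 2 ^ m)) * X powr (1 - real m * l')"
          using X1 by (simp add: powr_diff powr_minus_divide)
        also have "\<dots> < 1 / 2" using elim(1) X0 by simp
        also have "N1 * of_int (int h) * X powr - l \<le> N1 * X powr l' * X powr - l"
          using h K by (intro mult_right_mono mult_left_mono) auto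
        also have "\<dots> = N1 * X powr (l' - l)" by (simp add: powr_diff powr_minus_divide)
        also have "\<dots> < 1 / 2" using elim(2) X0 by simp
        finally have "\<bar>real_of_int (shift_act P y j)\<bar> < 1" by simp
        then show "shift_act P y j = 0" by linarith
      qed (rule P(1))
      obtain G where G: "annihilates N y G" "Polynomial.content G = 1"
        "\<And>Q. annihilates N y Q \<Longrightarrow> degree G \<le> degree Q"
        by (rule primitive_minimal_annihilator[OF annP], rule that)
      have G0: "G \<noteq> 0" and Gy: "\<And>j. j + degree G \<le> N \<Longrightarrow> shift_act G y j = 0"
        using G(1) by (auto simp: annihilates_def)
      have degG: "degree G \<le> m" using G(3)[OF annP] P(2) by simp
      have "G dvd P"
      proof (rule minimal_annihilator_dvd[OF G order_refl])
        show "degree P + degree G \<le> N + 1" using degG P(2) mN by linarith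
        show "shift_act P y j = 0" if "j + degree P \<le> N" for j
          using annP that by (simp add: annihilates_def)
      qed
      define H where "H = real_of_int (height G)"
      have H1: "H \<ge> 1" using height_ge_1[OF G0] by (simp add: H_def)
      have "H \<le> K1 * of_int (height P)"
        unfolding H_def K1_def by (rule height_dvd_le[OF P(1) \<open>G dvd P\<close> P(2)])
      also have "real_of_int (height P) \<le> real h" using height_leI[OF P(3)] by linarith
      also note h(1)
      finally have HX: "H \<le> K1 * X powr l'" using K by simp
      \<comment> \<open>Since \<open>G\<close> annihilates \<open>y\<close>, the product of
        \<open>x\<close> and \<open>G(\<zeta>)\<close> consists of error terms only. The lower bound
        for \<open>G(\<zeta>)\<close> turns this into an upper bound for \<open>x\<close> in terms
        of \<open>H\<close>, much better than \<open>X\<close> when \<open>H\<close> is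
        small.\<close>
      have xG: "\<bar>of_int x\<bar> * c0 \<le> N1 * H powr (1 + w) * X powr - l"
      proof -
        have "\<bar>real_of_int (shift_act G y 0) - of_int x * \<zeta> ^ 0 * ipoly G \<zeta>\<bar> \<le> N1 * of_int (height G) * X powr - l"
          unfolding N1_def using degG mN m by (intro shift_act_approx[OF y] abs_coeff_le_height) auto
        moreover have "shift_act G y 0 = 0" using degG mN m by (intro Gy) auto
        ultimately have 1: "\<bar>of_int x\<bar> * \<bar>ipoly G \<zeta>\<bar> \<le> N1 * H * X powr - l"
          by (simp add: H_def abs_mult)
        have "\<bar>of_int x\<bar> * (c0 * H powr (- w)) \<le> \<bar>of_int x\<bar> * \<bar>ipoly G \<zeta>\<bar>"
          unfolding H_def by (intro mult_left_mono c0(2) G0 degG) auto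
        with 1 have "\<bar>of_int x\<bar> * c0 * H powr (- w) * H powr w \<le> N1 * H * X powr - l * H powr w"
          by (intro mult_right_mono) auto
        moreover have "H powr (- w) * H powr w = 1" using H1 by (simp flip: powr_add)
        moreover have "H powr (1 + w) = H * H powr w" using H1 by (simp add: powr_add)
        ultimately show ?thesis by (simp add: mult_ac)
      qed
      \<comment> \<open>For large \<open>X\<close> the bound \<open>xG\<close> cannot hold with
        bounded \<open>H\<close>, because \<open>x\<close> is at least 1 in absolute value. This
        leaves room for a nontrivial box below \<open>H\<close>.\<close>
      have HK: "2 * K2 \<le> H"
      proof (rule ccontr)
        assume "\<not> 2 * K2 \<le> H"
        then have "H powr (1 + w) \<le> (2 * K2) powr (1 + w)" using H1 w(2) by (intro powr_mono2) auto
        then have "N1 * H powr (1 + w) * X powr - l \<le> N1 * (2 * K2) powr (1 + w) * X powr - l"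
          using K by (intro mult_right_mono mult_left_mono) auto
        moreover have "1 * c0 \<le> \<bar>of_int x\<bar> * c0" using x1 c0 by (intro mult_right_mono) auto
        ultimately have "c0 \<le> N1 * (2 * K2) powr (1 + w) * X powr - l" using xG by linarith
        then have "c0 * X powr l \<le> N1 * (2 * K2) powr (1 + w)"
          using X1 by (simp add: powr_minus_divide divide_simps)
        moreover have "(2 * K2) powr (1 + w) * N1 < X powr l * c0"
          using elim(4) c0(1) X0 by (simp add: pos_divide_less_eq)
        ultimately show False by (simp add: mult.commute)
      qed
      \<comment> \<open>If \<open>G\<close> divides a nonzero \<open>S\<close> of height at most
        \<open>g\<close> and degree at most \<open>s\<close>, then
        \<open>H \<le> K2 * g \<le> H / 2\<close>, which is absurd. So it remains to show that a
        Dirichlet polynomial of this height still kills \<open>y\<close>.\<close>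
      define g where "g = nat \<lfloor>H / (2 * K2)\<rfloor>"
      have HK1: "H / (2 * K2) \<ge> 1" using HK K by simp
      have g: "real g \<le> H / (2 * K2)" "real g > H / (2 * K2) - 1" using HK1 unfolding g_def by linarith+
      have g1: "g \<ge> 1" using HK1 by (simp add: g_def le_nat_floor)
      have "H / (2 * K2) \<le> 2 * real g" using g g1 by linarith
      then have g2: "H / (4 * K2) \<le> real g" using K by (simp add: field_simps)
      from c2(2)[OF g1] obtain S where S: "S \<noteq> 0" "degree S \<le> s" "\<And>i. \<bar>coeff S i\<bar> \<le> int g"
        "\<bar>ipoly S \<zeta>\<bar> \<le> c2 / real g ^ s" by blast
      have valS: "\<bar>ipoly S \<zeta>\<bar> \<le> c2 * (4 * K2) ^ s * H powr (- real s)"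
      proof -
        have "c2 / real g ^ s \<le> c2 / (H / (4 * K2)) ^ s"
          using g2 H1 K c2(1) g1 by (intro divide_left_mono power_mono mult_pos_pos zero_less_power) auto
        also have "\<dots> = c2 * (4 * K2) ^ s * H powr (- real s)"
          using H1 K by (simp add: power_divide powr_minus_divide powr_realpow)
        finally show ?thesis using S(4) by linarith
      qed
      have gH: "real g \<le> H"
      proof -
        have "K2 \<ge> 1" unfolding K2_def using mult_mono[of 1 "2 ^ s" 1 "real (s + 1)"] by simp
        then have "H * 1 \<le> H * (2 * K2)" using H1 by (intro mult_left_mono) auto
        then have "H / (2 * K2) \<le> H" using K by (simp add: divide_le_eq)
        with g(1) show ?thesis by linarith
      qed
      have "shift_act S y j = 0" if j: "j + s \<le> N" for j
      proof -
        have "\<bar>real_of_int (shift_act S y j)\<bar> \<le> \<bar>of_int x\<bar> * Z * \<bar>ipoly S \<zeta>\<bar> + N1 * of_int (int g) * X powr - l"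
          using j S by (intro act_le) auto
        also have "\<bar>of_int x\<bar> * Z * \<bar>ipoly S \<zeta>\<bar> \<le>
            (N1 * H powr (1 + w) * X powr - l / c0) * Z * (c2 * (4 * K2) ^ s * H powr (- real s))"
          using xG c0(1) Z1 valS K by (intro mult_mono) (auto simp: pos_le_divide_eq)
        also have "\<dots> = Z * (c2 * (4 * K2) ^ s) * (N1 / c0) * (H powr (1 + w) * H powr (- real s)) * X powr - l"
          by (simp add: divide_simps mult_ac)
        also have "H powr (1 + w) * H powr (- real s) = H powr (1 + w - real s)"
          using H1 by (simp flip: powr_add)
        also have "Z * (c2 * (4 * K2) ^ s) * (N1 / c0) * H powr (1 + w - real s) * X powr - l
            \<le> Z * (c2 * (4 * K2) ^ s) * (N1 / c0) * H * X powr - l"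
        proof -
          have "H powr (1 + w - real s) \<le> H powr 1" using H1 ms by (intro powr_mono) auto
          then have "H powr (1 + w - real s) \<le> H" using H1 by simp
          then show ?thesis using Z1 c2(1) K c0(1)
            by (intro mult_right_mono mult_left_mono mult_nonneg_nonneg) auto
        qed
        also have "N1 * of_int (int g) * X powr - l \<le> N1 * H * X powr - l"
          using gH K by (intro mult_right_mono mult_left_mono) auto
        finally have "\<bar>real_of_int (shift_act S y j)\<bar> \<le> C * H * X powr - l"
          by (simp add: C_def algebra_simps)
        also have "\<dots> \<le> C * (K1 * X powr l') * X powr - l"
          using HX C by (intro mult_right_mono mult_left_mono) auto
        also have "\<dots> = C * K1 * X powr (l' - l)" by (simp add: powr_diff powr_minus_divide)
        also have "\<dots> < 1" using elim(3) X0 by simp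
        finally show ?thesis by linarith
      qed
      then have "G dvd S"
        using degG ms(2) by (intro minimal_annihilator_dvd[OF G S(2)]) auto
      have "H \<le> K2 * of_int (height S)"
        unfolding H_def K2_def by (rule height_dvd_le[OF S(1) \<open>G dvd S\<close> S(2)])
      also have "real_of_int (height S) \<le> real g" using height_leI[OF S(3)] by linarith
      also note g(1)
      finally have "H \<le> K2 * (H / (2 * K2))" using K by simp
      then show False using K H1 by simp
    qed
  qed
qed

lemma lambda_exp_le:
  assumes m: "m \<ge> 1" and N: "w_exp m \<zeta> + ereal (real (2 * m)) \<le> ereal (real N)"
  shows "lambda_exp N \<zeta> \<le> ereal (1 / real m)"
  unfolding lambda_exp_def
proof (rule Sup_least, clarify)
  fix l :: real
  assume l: "\<exists>\<^sub>F X :: real in at_top. \<exists>(x :: int) (y :: nat \<Rightarrow> int). 1 \<le> \<bar>x\<bar> \<and> real_of_int \<bar>x\<bar> \<le> X \<and>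
       (\<forall>i\<in>{1..N}. \<bar>\<zeta> ^ i * real_of_int x - real_of_int (y i)\<bar> \<le> X powr - l)"
  obtain v where v: "w_exp m \<zeta> = ereal v" "v \<ge> 0"
    using N w_exp_ge[OF trans m] by (cases "w_exp m \<zeta>") auto
  show "ereal l \<le> ereal (1 / real m)"
  proof (rule ccontr)
    assume "\<not> ereal l \<le> ereal (1 / real m)"
    then have "l > 1 / real m" by simp
    \<comment> \<open>Raising \<open>v\<close> by 1 supplies the strict bound on
      \<open>w_exp m \<zeta>\<close>; the summand 1 in \<open>real N + 1\<close> pays for
      it.\<close>
    with v N eventually_no_simultaneous_approximation[OF m, of "v + 1" N l] l
    show False by (simp add: frequently_def)
  qed
qed

end

section \<open>The upper bound for the uniform exponent\<close>

lemma poly_eq_if_restrict_coeff_eq: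
  fixes P Q :: "'a :: zero poly"
  assumes "restrict (coeff P) {k..<d} = restrict (coeff Q) {k..<d}"
    and "\<And>i. i < k \<Longrightarrow> coeff P i = coeff Q i" "\<And>i. i \<ge> d \<Longrightarrow> coeff P i = coeff Q i"
  shows "P = Q"
proof (rule poly_eqI)
  fix i
  consider "i < k" | "i \<ge> d" | "i \<in> {k..<d}" by force
  then show "coeff P i = coeff Q i"
  proof cases
    case 3
    then show ?thesis using fun_cong[OF assms(1), of i] by simp
  qed (use assms in auto)
qed

lemma finite_polys_bounded_coeffs:
  "finite {P :: int poly. (\<forall>i\<ge>d. coeff P i = 0) \<and> (\<forall>i. coeff P i \<in> {a..b})}" (is "finite ?A")
proof (rule inj_on_finite[of "\<lambda>P. restrict (coeff P) {0..<d}"])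
  show "inj_on (\<lambda>P. restrict (coeff P) {0..<d}) ?A"
    by (rule inj_onI, rule poly_eq_if_restrict_coeff_eq) auto
  show "(\<lambda>P. restrict (coeff P) {0..<d}) ` ?A \<subseteq> ({0..<d} \<rightarrow>\<^sub>E {a..b})" by auto
qed (auto intro: finite_PiE)

lemma card_polys_bounded_coeffs_ge:
  "(h + 1) ^ d \<le> card {P :: int poly. (\<forall>i\<ge>d. coeff P i = 0) \<and> (\<forall>i. coeff P i \<in> {0..int h})}"
    (is "_ \<le> card ?A")
proof -
  have "({0..<d} \<rightarrow>\<^sub>E {0..int h}) \<subseteq> (\<lambda>P. restrict (coeff P) {0..<d}) ` ?A"
  proof
    fix f assume f: "f \<in> ({0..<d} \<rightarrow>\<^sub>E {0..int h})"
    obtain P where P: "\<And>i. coeff P i = (if i \<le> d then (if i < d then f i else 0) else 0)"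
      using ex_poly_with_coeffs[of d "\<lambda>i. if i < d then f i else 0"] by metis
    have "restrict (coeff P) {0..<d} = f"
      using f by (intro ext) (auto simp: restrict_def P PiE_def extensional_def)
    moreover have "P \<in> ?A" using f by (auto simp: P PiE_def Pi_def)
    ultimately show "f \<in> (\<lambda>P. restrict (coeff P) {0..<d}) ` ?A" by blast
  qed
  then have "card ({0..<d} \<rightarrow>\<^sub>E {0..int h}) \<le> card ?A"
    by (rule surj_card_le[OF finite_polys_bounded_coeffs])
  then show ?thesis by (simp add: card_PiE nat_add_distrib flip: One_nat_def)
qed

text \<open>The \<open>n\<close> nonconstant coefficients are free. Once they are fixed, the
  constant coefficient lies in an interval of length \<open>2 * \<tau>\<close>.\<close>

lemma finite_card_polys_small_value:
  fixes \<zeta> \<tau> :: real and h n :: nat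
  assumes "\<tau> \<ge> 0"
  defines "T \<equiv> {U :: int poly. (\<forall>i>n. coeff U i = 0) \<and> (\<forall>i. \<bar>coeff U i\<bar> \<le> int h) \<and> \<bar>ipoly U \<zeta>\<bar> \<le> \<tau>}"
  shows "finite T" "real (card T) \<le> real (2 * h + 1) ^ n * (2 * \<tau> + 1)"
proof -
  define r where "r U = ipoly U \<zeta> - of_int (coeff U 0)" for U
  \<comment> \<open>The second component is the offset of the constant coefficient from the first
    integer of its admissible interval, whose position depends on the other coefficients through
    \<open>r U\<close>.\<close>
  define F where "F U = (restrict (coeff U) {1..<n+1}, coeff U 0 - \<lceil>- \<tau> - r U\<rceil>)" for U
  define D where "D = ({1..<n+1} \<rightarrow>\<^sub>E {- int h..int h}) \<times> {0..\<lfloor>2 * \<tau>\<rfloor>}"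
  have r: "r U = (\<Sum>i\<in>{1..<n+1}. of_int (coeff U i) * \<zeta> ^ i)" if "U \<in> T" for U
  proof -
    have "degree U \<le> n" using that by (intro degree_le) (auto simp: T_def)
    then have "ipoly U \<zeta> = (\<Sum>i\<le>n. of_int (coeff U i) * \<zeta> ^ i)" by (rule ipoly_altdef)
    also have "{..n} = insert 0 {1..<n+1}" by auto
    finally show ?thesis by (simp add: r_def)
  qed
  have inj: "inj_on F T"
  proof (rule inj_onI)
    fix U V assume UV: "U \<in> T" "V \<in> T" "F U = F V"
    have res: "restrict (coeff U) {1..<n+1} = restrict (coeff V) {1..<n+1}" using UV(3) by (simp add: F_def)
    have "r U = r V" unfolding r[OF UV(1)] r[OF UV(2)]
    proof (rule sum.cong)
      fix i assume "i \<in> {1..<n+1}"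
      then show "of_int (coeff U i) * \<zeta> ^ i = of_int (coeff V i) * \<zeta> ^ i"
        using fun_cong[OF res, of i] by simp
    qed simp
    then have "coeff U 0 = coeff V 0" using UV(3) by (simp add: F_def)
    then show "U = V" using UV(1,2) by (intro poly_eq_if_restrict_coeff_eq[OF res]) (auto simp: T_def)
  qed
  have sub: "F ` T \<subseteq> D"
  proof (rule image_subsetI)
    fix U assume U: "U \<in> T"
    have c: "\<bar>coeff U i\<bar> \<le> int h" for i using U by (simp add: T_def)
    have "restrict (coeff U) {1..<n+1} \<in> ({1..<n+1} \<rightarrow>\<^sub>E {- int h..int h})"
    proof (rule restrict_PiE_iff[THEN iffD2], intro ballI)
      fix i show "coeff U i \<in> {- int h..int h}" using c[of i] by auto
    qed
    moreover have "\<bar>r U + of_int (coeff U 0)\<bar> \<le> \<tau>" using U by (simp add: T_def r_def)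
    then have "coeff U 0 - \<lceil>- \<tau> - r U\<rceil> \<in> {0..\<lfloor>2 * \<tau>\<rfloor>}" by (simp add: le_floor_iff) linarith
    ultimately show "F U \<in> D" by (simp add: F_def D_def)
  qed
  have fin: "finite D" by (auto simp: D_def intro: finite_PiE)
  show "finite T" by (rule inj_on_finite[OF inj sub fin])
  have "card T \<le> card D" by (rule card_inj_on_le[OF inj sub fin])
  also have "card D = (2 * h + 1) ^ n * (nat \<lfloor>2 * \<tau>\<rfloor> + 1)"
  proof -
    have "card {- int h..int h} = 2 * h + 1" unfolding card_atLeastAtMost_int by linarith
    moreover have "card {0..\<lfloor>2 * \<tau>\<rfloor>} = nat \<lfloor>2 * \<tau>\<rfloor> + 1"
      using assms(1) by (simp add: nat_add_distrib)
    moreover have "card ({1..<n+1} \<rightarrow>\<^sub>E S) = card S ^ n" for S :: "int set"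
      by (subst card_PiE) simp_all
    ultimately show ?thesis by (simp only: D_def card_cartesian_product)
  qed
  finally have "real (card T) \<le> real ((2 * h + 1) ^ n * (nat \<lfloor>2 * \<tau>\<rfloor> + 1))"
    by (simp only: of_nat_le_iff)
  also have "\<dots> = real (2 * h + 1) ^ n * (real (nat \<lfloor>2 * \<tau>\<rfloor>) + 1)"
    by (simp add: algebra_simps)
  also have "\<dots> \<le> real (2 * h + 1) ^ n * (2 * \<tau> + 1)"
    using assms(1) by (intro mult_left_mono) (auto simp: of_nat_floor)
  finally show "real (card T) \<le> real (2 * h + 1) ^ n * (2 * \<tau> + 1)" .
qed

text \<open>The prime \<open>Q\<close> divides \<open>(A - A') * P\<close> but not \<open>P\<close>,
  hence divides \<open>A - A'\<close>, whose degree is too small unless it is 0.\<close>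

lemma prime_combination_injective:
  fixes P Q A B A' B' :: "int poly"
  assumes "prime_elem Q" "\<not> Q dvd P" "P \<noteq> 0" "Q \<noteq> 0"
    and A: "\<And>i. i \<ge> degree Q \<Longrightarrow> coeff A i = 0" "\<And>i. i \<ge> degree Q \<Longrightarrow> coeff A' i = 0"
    and eq: "A * P + B * Q = A' * P + B' * Q"
  shows "A = A' \<and> B = B'"
proof -
  have eq': "(A - A') * P = (B' - B) * Q" using eq by (simp add: algebra_simps)
  then have "Q dvd (A - A') * P" by simp
  then have dvd: "Q dvd A - A'" using assms(1,2) by (auto simp: prime_elem_dvd_mult_iff)
  have "A - A' = 0"
  proof (rule ccontr)
    assume nz: "A - A' \<noteq> 0"
    then have "degree Q \<le> degree (A - A')" using dvd by (intro dvd_imp_degree_le)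
    then have "lead_coeff (A - A') = 0" using A by simp
    with nz show False by (simp only: leading_coeff_0_iff)
  qed
  with eq' assms(4) show ?thesis by simp
qed

text \<open>
  This is the classical estimate of the resultant. It is obtained by counting: the polynomials
  \<open>A P + B Q\<close> with \<open>deg A < q\<close> and \<open>deg B < p\<close> are distinct, and if both values at \<open>\<zeta>\<close> were too small,
  there would be more of them than integer polynomials with the corresponding height and value.
\<close>

lemma prime_values_not_both_small:
  fixes P Q :: "int poly" and \<zeta> :: real
  assumes cop: "prime_elem Q" "\<not> Q dvd P" and deg: "degree P = p" "degree Q = q" "p \<ge> 1" "q \<ge> 1"
  defines "E \<equiv> (\<Sum>i\<le>p + q. \<bar>\<zeta>\<bar> ^ i)" and "a \<equiv> real_of_int (height P)" and "b \<equiv> real_of_int (height Q)"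
  shows "1 \<le> 2 * (3 * real (p + q)) ^ (p + q - 1) * E *
     (a ^ (q - 1) * b ^ p * \<bar>ipoly P \<zeta>\<bar> + a ^ q * b ^ (p - 1) * \<bar>ipoly Q \<zeta>\<bar>)"
proof -
  have nz: "P \<noteq> 0" "Q \<noteq> 0" using deg by auto
  define a' b' where "a' = nat (height P)" and "b' = nat (height Q)"
  have ab: "a = real a'" "b = real b'" "a' \<ge> 1" "b' \<ge> 1" "height P = int a'" "height Q = int b'"
    using height_ge_1[OF nz(1)] height_ge_1[OF nz(2)] by (auto simp: a'_def b'_def a_def b_def)
  define v where "v = E * (b * \<bar>ipoly P \<zeta>\<bar> + a * \<bar>ipoly Q \<zeta>\<bar>)"
  have E0: "E \<ge> 0" by (simp add: E_def sum_nonneg)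
  have v0: "v \<ge> 0" using E0 ab by (simp add: v_def)
  define n where "n = p + q - 1"
  have n: "p + q = Suc n" using deg by (simp add: n_def)
  define L where "L = b ^ q * a ^ p"
  define R where "R = (3 * real (p + q)) ^ n * (a * b) ^ n"
  \<comment> \<open>The free integer \<open>t\<close> scales both coefficient boxes. There are at
    least \<open>t ^ (n + 1) * L\<close> pairs \<open>(A, B)\<close>, and at most
    \<open>t ^ n * R * (2 * t * v + 1)\<close> polynomials that \<open>A * P + B * Q\<close> can be;
    \<open>t ^ n\<close> cancels.\<close>
  have key: "real t * L \<le> R * (2 * (real t * v) + 1)" if t: "t \<ge> 1" for t :: nat
  proof -
    define \<A> where "\<A> = {A :: int poly. (\<forall>i\<ge>q. coeff A i = 0) \<and> (\<forall>i. coeff A i \<in> {0..int (t * b')})}"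
    define \<B> where "\<B> = {B :: int poly. (\<forall>i\<ge>p. coeff B i = 0) \<and> (\<forall>i. coeff B i \<in> {0..int (t * a')})}"
    define h where "h = (p + q) * (t * a' * b')"
    define T where "T = {U :: int poly. (\<forall>i>n. coeff U i = 0) \<and> (\<forall>i. \<bar>coeff U i\<bar> \<le> int h) \<and>
      \<bar>ipoly U \<zeta>\<bar> \<le> real t * v}"
    have tv: "real t * v \<ge> 0" using v0 by simp
    note T = finite_card_polys_small_value[OF tv, of n h \<zeta>, folded T_def]
    have coeff_mult_le: "\<bar>coeff (A * F) k\<bar> \<le> int d * (int u * height F)"
      if A: "\<forall>i\<ge>d. coeff A i = 0" "\<forall>i. coeff A i \<in> {0..int u}" for A F :: "int poly" and d u k
    proof -
      have "coeff (A * F) k = (\<Sum>i\<le>k. coeff A i * coeff F (k - i))" by (rule coeff_mult)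
      also have "\<dots> = (\<Sum>i\<in>{..k} \<inter> {..<d}. coeff A i * coeff F (k - i))"
        using A(1) by (intro sum.mono_neutral_right) (auto, metis not_less)
      also have "\<bar>\<dots>\<bar> \<le> (\<Sum>i\<in>{..k} \<inter> {..<d}. \<bar>coeff A i * coeff F (k - i)\<bar>)" by (rule sum_abs)
      also have "\<dots> \<le> (\<Sum>i\<in>{..k} \<inter> {..<d}. int u * height F)"
      proof (rule sum_mono)
        fix i
        have "\<bar>coeff A i\<bar> \<le> int u" using A(2) by auto
        then show "\<bar>coeff A i * coeff F (k - i)\<bar> \<le> int u * height F"
          unfolding abs_mult by (intro mult_mono abs_coeff_le_height) auto
      qed
      also have "\<dots> = int (card ({..k} \<inter> {..<d})) * (int u * height F)" by simp
      also have "\<dots> \<le> int d * (int u * height F)"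
        using card_mono[of "{..<d}" "{..k} \<inter> {..<d}"] by (intro mult_right_mono) (auto simp: height_nonneg)
      finally show ?thesis .
    qed
    have val_le: "\<bar>ipoly A \<zeta>\<bar> \<le> real u * E"
      if A: "\<forall>i\<ge>d. coeff A i = 0" "\<forall>i. coeff A i \<in> {0..int u}" and d: "d \<le> p + q" for A :: "int poly" and d u
    proof -
      have "degree A \<le> p + q" using A(1) d by (intro degree_le) auto
      moreover have "\<bar>coeff A i\<bar> \<le> int u" for i using A(2) by auto
      ultimately show ?thesis using abs_ipoly_le[of A "p + q" "int u" \<zeta>] by (simp add: E_def)
    qed
    have "(\<lambda>(A, B). A * P + B * Q) ` (\<A> \<times> \<B>) \<subseteq> T"
    proof (clarify)
      fix A B assume A: "A \<in> \<A>" and B: "B \<in> \<B>"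
      have "coeff (A * P + B * Q) i = 0" if i: "i > n" for i
      proof -
        have "degree (A * P) \<le> n" if "A \<noteq> 0"
        proof -
          have "degree A < q"
          proof (rule ccontr)
            assume "\<not> degree A < q"
            then have "lead_coeff A = 0" using A by (simp add: \<A>_def)
            with that show False by simp
          qed
          then show ?thesis using degree_mult_le[of A P] deg n by linarith
        qed
        moreover have "degree (B * Q) \<le> n" if "B \<noteq> 0"
        proof -
          have "degree B < p"
          proof (rule ccontr)
            assume "\<not> degree B < p"
            then have "lead_coeff B = 0" using B by (simp add: \<B>_def)
            with that show False by simp
          qed
          then show ?thesis using degree_mult_le[of B Q] deg n by linarith
        qed
        ultimately have "degree (A * P + B * Q) \<le> n" by (intro degree_add_le) (cases "A = 0"; cases "B = 0"; simp)+
        with i show ?thesis by (intro coeff_eq_0) linarith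
      qed
      moreover have "\<bar>coeff (A * P + B * Q) k\<bar> \<le> int h" for k
      proof -
        have "\<bar>coeff (A * P) k\<bar> \<le> int q * (int (t * b') * height P)"
          using A by (intro coeff_mult_le) (auto simp: \<A>_def)
        moreover have "\<bar>coeff (B * Q) k\<bar> \<le> int p * (int (t * a') * height Q)"
          using B by (intro coeff_mult_le) (auto simp: \<B>_def)
        ultimately show ?thesis by (simp add: ab h_def algebra_simps)
      qed
      moreover have "\<bar>ipoly (A * P + B * Q) \<zeta>\<bar> \<le> real t * v"
      proof -
        have "\<bar>ipoly A \<zeta>\<bar> * \<bar>ipoly P \<zeta>\<bar> \<le> real (t * b') * E * \<bar>ipoly P \<zeta>\<bar>"
          using A by (intro mult_right_mono val_le[of q]) (auto simp: \<A>_def)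
        moreover have "\<bar>ipoly B \<zeta>\<bar> * \<bar>ipoly Q \<zeta>\<bar> \<le> real (t * a') * E * \<bar>ipoly Q \<zeta>\<bar>"
          using B by (intro mult_right_mono val_le[of p]) (auto simp: \<B>_def)
        moreover have "\<bar>ipoly (A * P + B * Q) \<zeta>\<bar> \<le> \<bar>ipoly A \<zeta>\<bar> * \<bar>ipoly P \<zeta>\<bar> + \<bar>ipoly B \<zeta>\<bar> * \<bar>ipoly Q \<zeta>\<bar>"
          unfolding ipoly_add ipoly_mult abs_mult[symmetric] by (rule abs_triangle_ineq)
        moreover have "real (t * b') * E * \<bar>ipoly P \<zeta>\<bar> + real (t * a') * E * \<bar>ipoly Q \<zeta>\<bar> = real t * v"
          by (simp add: v_def ab algebra_simps)
        ultimately show ?thesis by linarith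
      qed
      ultimately show "A * P + B * Q \<in> T" by (auto simp: T_def)
    qed
    moreover have "inj_on (\<lambda>(A, B). A * P + B * Q) (\<A> \<times> \<B>)"
    proof (rule inj_onI, clarify)
      fix A B A' B' assume "A \<in> \<A>" "A' \<in> \<A>" and eq: "A * P + B * Q = A' * P + B' * Q"
      then show "A = A' \<and> B = B'"
        using deg by (intro prime_combination_injective[OF cop nz _ _ eq]) (auto simp: \<A>_def)
    qed
    ultimately have "card (\<A> \<times> \<B>) \<le> card T" using T(1) by (intro card_inj_on_le)
    moreover have "(t * b' + 1) ^ q * (t * a' + 1) ^ p \<le> card (\<A> \<times> \<B>)"
      unfolding card_cartesian_product \<A>_def \<B>_def by (intro mult_mono card_polys_bounded_coeffs_ge) auto
    moreover have "(t * b') ^ q * (t * a') ^ p \<le> (t * b' + 1) ^ q * (t * a' + 1) ^ p"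
      by (intro mult_mono power_mono) auto
    ultimately have "(t * b') ^ q * (t * a') ^ p \<le> card T" by linarith
    then have "real ((t * b') ^ q * (t * a') ^ p) \<le> real (card T)" by (simp only: of_nat_le_iff)
    also have "real ((t * b') ^ q * (t * a') ^ p) = real t ^ n * (real t * L)"
    proof -
      have "real ((t * b') ^ q * (t * a') ^ p) = real t ^ (p + q) * L"
        by (simp add: L_def ab power_mult_distrib power_add)
      then show ?thesis by (simp add: n)
    qed
    also note T(2)
    also have "real (2 * h + 1) ^ n * (2 * (real t * v) + 1) \<le> (3 * real h) ^ n * (2 * (real t * v) + 1)"
    proof -
      have "h \<ge> 1" using t ab deg by (auto simp: h_def)
      then show ?thesis using tv by (intro mult_right_mono power_mono) auto
    qed
    also have "(3 * real h) ^ n = real t ^ n * R"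
      by (simp add: h_def R_def ab power_mult_distrib mult_ac)
    finally have "real t ^ n * (real t * L) \<le> real t ^ n * (R * (2 * (real t * v) + 1))"
      by (simp add: mult_ac)
    then show ?thesis using t by (simp add: mult_le_cancel_left_pos)
  qed
  have R0: "R \<ge> 0" using ab by (simp add: R_def)
  \<comment> \<open>Dividing \<open>key\<close> by \<open>t\<close> and letting \<open>t\<close>
    grow removes the summand 1, a rounding term from the count of constant coefficients.\<close>
  have LR: "L \<le> R * (2 * v)"
  proof (rule ccontr)
    assume "\<not> L \<le> R * (2 * v)"
    then have pos: "L - R * (2 * v) > 0" by simp
    then obtain t0 :: nat where "R < real t0 * (L - R * (2 * v))" using reals_Archimedean3 by blast
    moreover have "real t0 * (L - R * (2 * v)) \<le> real (Suc t0) * (L - R * (2 * v))"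
      using pos by (intro mult_right_mono) auto
    ultimately have "R < real (Suc t0) * (L - R * (2 * v))" by linarith
    with key[of "Suc t0"] show False by (simp add: algebra_simps)
  qed
  have apos: "a > 0" "b > 0" using ab by auto
  have "L = (a ^ p * b ^ q) * 1" by (simp add: L_def)
  moreover have "R * (2 * v) = (a ^ p * b ^ q) * (2 * (3 * real (p + q)) ^ (p + q - 1) * E *
     (a ^ (q - 1) * b ^ p * \<bar>ipoly P \<zeta>\<bar> + a ^ q * b ^ (p - 1) * \<bar>ipoly Q \<zeta>\<bar>))"
  proof -
    have "a ^ n = a ^ p * a ^ (q - 1)" "b ^ n = b ^ q * b ^ (p - 1)"
      using deg by (simp_all add: n_def add.commute flip: power_add)
    moreover have "a ^ q = a * a ^ (q - 1)" "b ^ p = b * b ^ (p - 1)"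
      using deg by (simp_all flip: power_Suc)
    ultimately show ?thesis unfolding R_def v_def n_def[symmetric] power_mult_distrib[of a]
      by (simp only: algebra_simps)
  qed
  ultimately show ?thesis using LR mult_pos_pos[OF zero_less_power zero_less_power, OF apos, of p q]
    by (simp only: mult_le_cancel_left_pos)
qed

section \<open>Reduction to prime polynomials and the upper bound itself\<close>

lemma mahler_measure_powr_le_1: "P \<noteq> 0 \<Longrightarrow> w \<ge> 0 \<Longrightarrow> mahler_measure P powr (- w) \<le> 1"
  using mahler_measure_poly_ge_1[of P] powr_mono[of "- w" 0 "mahler_measure P"] by simp

lemma abs_ipoly_const_ge_1:
  assumes "degree P = 0" "P \<noteq> (0 :: int poly)"
  shows "\<bar>ipoly P x\<bar> \<ge> 1"
proof -
  obtain c where c: "P = [:c:]" using assms(1) by (rule degree_eq_zeroE)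
  with assms(2) have "\<bar>real_of_int c\<bar> \<ge> 1" by simp
  then show ?thesis by (simp add: c)
qed

context
  fixes \<zeta> :: real
  assumes trans: "\<not> algebraic \<zeta>"
begin

text \<open>Value, Mahler measure and \<open>\<kappa> ^ degree\<close> are all multiplicative, so
  the bound passes from prime factors to products without loss. Constant factors have value at least
  1 and cost no \<open>\<kappa>\<close>.\<close>

lemma ipoly_lower_bound_from_primes:
  fixes \<kappa> w :: real
  assumes \<kappa>: "0 < \<kappa>" "\<kappa> \<le> 1" and w: "w \<ge> 0"
    and primes: "\<And>Q :: int poly. prime_elem Q \<Longrightarrow> degree Q \<le> m \<Longrightarrow> degree Q \<ge> 1 \<Longrightarrow>
       \<kappa> * mahler_measure Q powr (- w) \<le> \<bar>ipoly Q \<zeta>\<bar>"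
  shows "P \<noteq> 0 \<Longrightarrow> degree P \<le> m \<Longrightarrow> \<kappa> ^ degree P * mahler_measure P powr (- w) \<le> \<bar>ipoly P \<zeta>\<bar>"
proof (induction P rule: prime_divisors_induct)
  case (unit P)
  then have "degree P = 0" by (auto simp: is_unit_poly_iff)
  then show ?case using abs_ipoly_const_ge_1[of P \<zeta>] mahler_measure_powr_le_1[of P w] unit w by auto
next
  case (factor Q P)
  then have nz: "Q \<noteq> 0" "P \<noteq> 0" by auto
  have deg: "degree (Q * P) = degree Q + degree P" using nz by (rule degree_mult_eq)
  have IH: "\<kappa> ^ degree P * mahler_measure P powr (- w) \<le> \<bar>ipoly P \<zeta>\<bar>"
    using factor nz deg by auto
  have Q: "\<kappa> ^ degree Q * mahler_measure Q powr (- w) \<le> \<bar>ipoly Q \<zeta>\<bar>"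
  proof (cases "degree Q = 0")
    case True
    then show ?thesis using abs_ipoly_const_ge_1[of Q \<zeta>] mahler_measure_powr_le_1[of Q w] nz w by auto
  next
    case False
    have "\<kappa> ^ degree Q \<le> \<kappa> ^ 1" using False \<kappa> by (intro power_decreasing) auto
    then have "\<kappa> ^ degree Q * mahler_measure Q powr (- w) \<le> \<kappa> * mahler_measure Q powr (- w)"
      by (intro mult_right_mono) auto
    also have "\<dots> \<le> \<bar>ipoly Q \<zeta>\<bar>" using factor deg False by (intro primes) auto
    finally show ?thesis .
  qed
  have "\<kappa> ^ degree (Q * P) * mahler_measure (Q * P) powr (- w) =
      (\<kappa> ^ degree Q * mahler_measure Q powr (- w)) * (\<kappa> ^ degree P * mahler_measure P powr (- w))"
    unfolding deg by (simp add: mahler_measure_mult powr_mult mahler_measure_ge_0 power_add)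
  also have "\<dots> \<le> \<bar>ipoly Q \<zeta>\<bar> * \<bar>ipoly P \<zeta>\<bar>" using \<kappa> by (intro mult_mono IH Q) auto
  finally show ?case by (simp only: ipoly_mult abs_mult)
qed simp

text \<open>Otherwise all primes would satisfy a lower bound with exponent \<open>w\<close>, hence
  so would all polynomials. This leaves only finitely many with an exponent
  \<open>w1 > w\<close>.\<close>

lemma small_value_at_prime:
  assumes w: "w \<ge> 0" "ereal w < w_exp m \<zeta>" and \<rho>: "\<rho> > 0"
  obtains Q where "prime_elem Q" "degree Q \<ge> 1" "degree Q \<le> m"
    "\<bar>ipoly Q \<zeta>\<bar> \<le> real_of_int (height Q) powr (- w)" "\<bar>ipoly Q \<zeta>\<bar> < \<rho>"
proof (rule ccontr)
  assume contr: "\<not> thesis"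
  note found = that
  have no: "\<rho> \<le> \<bar>ipoly Q \<zeta>\<bar>" if Q: "prime_elem Q" "degree Q \<ge> 1" "degree Q \<le> m"
    "\<bar>ipoly Q \<zeta>\<bar> \<le> real_of_int (height Q) powr (- w)" for Q
  proof (rule ccontr)
    assume "\<not> \<rho> \<le> \<bar>ipoly Q \<zeta>\<bar>"
    then have "\<bar>ipoly Q \<zeta>\<bar> < \<rho>" by simp
    with found[OF Q] contr show False by blast
  qed
  from w(2) obtain w1 where w1: "w < w1" and inf: "infinite {P. degree P \<le> m \<and> 0 < \<bar>ipoly P \<zeta>\<bar> \<and>
      \<bar>ipoly P \<zeta>\<bar> \<le> real_of_int (height P) powr - w1}"
    unfolding w_exp_def less_Sup_iff by auto
  \<comment> \<open>The bound by 1 serves the induction over factors, \<open>\<rho>\<close> handles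
    the primes whose value beats the exponent \<open>w\<close>, and \<open>(2 ^ m) powr - w\<close>
    changes heights into Mahler measures for the others.\<close>
  define \<kappa> where "\<kappa> = min 1 (min \<rho> ((2 ^ m) powr (- w)))"
  have \<kappa>: "0 < \<kappa>" "\<kappa> \<le> 1" "\<kappa> \<le> \<rho>" "\<kappa> \<le> (2 ^ m) powr (- w)" using \<rho> by (auto simp: \<kappa>_def)
  have primes: "\<kappa> * mahler_measure Q powr (- w) \<le> \<bar>ipoly Q \<zeta>\<bar>"
    if Q: "prime_elem Q" "degree Q \<le> m" "degree Q \<ge> 1" for Q
  proof (cases "\<bar>ipoly Q \<zeta>\<bar> \<le> real_of_int (height Q) powr (- w)")
    case True
    have "\<kappa> * mahler_measure Q powr (- w) \<le> \<rho> * 1"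
      using \<kappa> Q w mahler_measure_powr_le_1[of Q w] by (intro mult_mono) auto
    also have "\<rho> * 1 \<le> \<bar>ipoly Q \<zeta>\<bar>" using no[OF Q(1,3,2) True] by simp
    finally show ?thesis .
  next
    case False
    have Q0: "Q \<noteq> 0" using Q by auto
    have "\<kappa> * mahler_measure Q powr (- w) \<le> (2 ^ m) powr (- w) * mahler_measure Q powr (- w)"
      using \<kappa> by (intro mult_right_mono) auto
    also have "\<dots> = (2 ^ m * mahler_measure Q) powr (- w)"
      by (simp add: powr_mult mahler_measure_ge_0)
    also have "\<dots> \<le> real_of_int (height Q) powr (- w)"
      using height_le_mahler_measure[OF Q(2)] height_ge_1[OF Q0] w by (intro powr_mono2') auto
    finally show ?thesis using False by simp
  qed
  \<comment> \<open>The largest \<open>H\<close> that satisfies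
    \<open>\<kappa> ^ m * (m + 1) powr - w \<le> H powr (w - w1)\<close>.\<close>
  define B where "B = (\<kappa> ^ m * real (m + 1) powr (- w)) powr (- 1 / (w1 - w))"
  have "{P. degree P \<le> m \<and> 0 < \<bar>ipoly P \<zeta>\<bar> \<and> \<bar>ipoly P \<zeta>\<bar> \<le> real_of_int (height P) powr - w1}
      \<subseteq> {P. (\<forall>i\<ge>Suc m. coeff P i = 0) \<and> (\<forall>i. coeff P i \<in> {- \<lfloor>B\<rfloor>..\<lfloor>B\<rfloor>})}"
  proof (clarify, intro conjI allI impI)
    fix P i assume P: "degree P \<le> m" "0 < \<bar>ipoly P \<zeta>\<bar>" "\<bar>ipoly P \<zeta>\<bar> \<le> real_of_int (height P) powr - w1"
    show "coeff P i = 0" if "Suc m \<le> i" using that P(1) by (intro coeff_eq_0) linarith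
    have P0: "P \<noteq> 0" using P(2) by auto
    define H where "H = real_of_int (height P)"
    have H: "H \<ge> 1" using height_ge_1[OF P0] by (simp add: H_def)
    have "\<kappa> ^ m * (real (m + 1) * H) powr (- w) \<le> \<kappa> ^ degree P * mahler_measure P powr (- w)"
      using \<kappa> P(1) mahler_measure_le_height[OF P(1)] mahler_measure_poly_ge_1[OF P0] w
      by (intro mult_mono power_decreasing powr_mono2') (auto simp: H_def)
    also have "\<dots> \<le> \<bar>ipoly P \<zeta>\<bar>" by (rule ipoly_lower_bound_from_primes[OF \<kappa>(1,2) w(1) primes P0 P(1)])
    also have "\<dots> \<le> H powr (- w1)" using P(3) by (simp add: H_def)
    finally have "\<kappa> ^ m * real (m + 1) powr (- w) * H powr (- w) \<le> H powr (- w1)"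
      using H by (simp add: powr_mult mult.assoc)
    then have "\<kappa> ^ m * real (m + 1) powr (- w) * (H powr (- w) * H powr w) \<le> H powr (- w1) * H powr w"
      by (simp only: mult.assoc[symmetric]) (intro mult_right_mono, auto)
    then have le: "\<kappa> ^ m * real (m + 1) powr (- w) \<le> H powr (w - w1)"
      using H by (simp flip: powr_add)
    have pos: "0 < \<kappa> ^ m * real (m + 1) powr (- w)" using \<kappa> by simp
    have "(H powr (w - w1)) powr (- 1 / (w1 - w)) \<le> B"
      unfolding B_def using le pos w1 by (intro powr_mono2') auto
    moreover have "(w - w1) * (- 1 / (w1 - w)) = 1" using w1 by (simp add: field_simps)
    ultimately have "H \<le> B" using H by (simp only: powr_powr) simp
    then have "height P \<le> \<lfloor>B\<rfloor>" by (simp add: H_def le_floor_iff)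
    then show "coeff P i \<in> {- \<lfloor>B\<rfloor>..\<lfloor>B\<rfloor>}" using abs_coeff_le_height[of P i] by auto
  qed
  with inf finite_polys_bounded_coeffs show False using finite_subset by blast
qed

lemma w_hat_star_exp_le:
  assumes n: "n \<ge> 1" and w: "ereal (real (2 * n)) < w_exp m \<zeta>"
  shows "w_hat_star_exp n \<zeta> \<le> ereal (real (2 * m))"
  unfolding w_hat_star_exp_def
proof (rule Sup_least, clarify)
  fix v :: real
  assume ev: "\<forall>\<^sub>F X :: real in at_top. \<exists>\<alpha> :: real.
       algebraic \<alpha> \<and> alg_degree \<alpha> \<le> n \<and> real_of_int (alg_height \<alpha>) \<le> X \<and>
       \<bar>\<zeta> - \<alpha>\<bar> \<le> inverse (real_of_int (alg_height \<alpha>)) * X powr - v"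
  show "ereal v \<le> ereal (real (2 * m))"
  proof (rule ccontr)
    assume "\<not> ereal v \<le> ereal (real (2 * m))"
    then have v: "v > 2 * real m" by simp
    from w obtain u where u: "2 * real n < u" "ereal u < w_exp m \<zeta>"
      using ereal_dense2[OF w] by auto
    have u0: "0 \<le> u" using u by simp
    have m: "m \<ge> 1"
    proof (rule ccontr)
      assume "\<not> m \<ge> 1"
      then have "m = 0" by simp
      obtain Q where "prime_elem Q" "degree Q \<ge> 1" "degree Q \<le> m"
        "\<bar>ipoly Q \<zeta>\<bar> \<le> real_of_int (height Q) powr (- u)" "\<bar>ipoly Q \<zeta>\<bar> < 1"
        by (rule small_value_at_prime[OF u0 u(2), of 1], simp, rule that)
      with \<open>m = 0\<close> show False by simp
    qed
    obtain C1 where C1: "C1 > 0"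
      "\<And>\<alpha> X v. algebraic \<alpha> \<Longrightarrow> alg_degree \<alpha> \<le> n \<Longrightarrow> X \<ge> 1 \<Longrightarrow> v \<ge> 0 \<Longrightarrow>
       \<bar>\<zeta> - \<alpha>\<bar> \<le> inverse (real_of_int (alg_height \<alpha>)) * X powr - v \<Longrightarrow>
       \<bar>ipoly (int_min_poly \<alpha>) \<zeta>\<bar> \<le> C1 * X powr - v"
      by (rule ipoly_int_min_poly_le[OF trans, of n], rule that)
    define E where "E = (\<Sum>i\<le>n + m. \<bar>\<zeta>\<bar> ^ i)"
    define C2 where "C2 = 2 * (3 * real (n + m)) ^ (n + m) * E"
    have E0: "E \<ge> 0" by (simp add: E_def sum_nonneg)
    have C20: "C2 \<ge> 0" using E0 by (simp add: C2_def)
    \<comment> \<open>With \<open>\<bar>Q(\<zeta>)\<bar> = X powr (- 2 m)\<close> the height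
      \<open>b\<close> of \<open>Q\<close> is at most \<open>X powr (2 m / u)\<close>, so
      \<open>b ^ n \<le> X powr (m - e)\<close>, and \<open>u > 2 n\<close> makes \<open>e\<close>
      positive. The heights in the resultant estimate thus contribute at most
      \<open>X powr (2 m - e)\<close>, while both values are of order at most
      \<open>X powr (- 2 m)\<close>.\<close>
    define e where "e = real m - 2 * real m * real n / u"
    have e: "e > 0" using u m n by (simp add: e_def field_simps)
    have "\<forall>\<^sub>F X :: real in at_top. (C2 * (C1 + 1)) * X powr (- e) < X powr 0"
      using e by (intro eventually_powr_less) auto
    moreover have "\<forall>\<^sub>F X :: real in at_top. C1 * X powr (- v) < X powr (- (2 * real m))"
      using v by (intro eventually_powr_less) auto
    moreover note ev
    ultimately have "\<forall>\<^sub>F X :: real in at_top. (C2 * (C1 + 1)) * X powr (- e) < X powr 0 \<and>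
       C1 * X powr (- v) < X powr (- (2 * real m)) \<and> X \<ge> 1 \<and> (\<exists>\<alpha> :: real.
       algebraic \<alpha> \<and> alg_degree \<alpha> \<le> n \<and> real_of_int (alg_height \<alpha>) \<le> X \<and>
       \<bar>\<zeta> - \<alpha>\<bar> \<le> inverse (real_of_int (alg_height \<alpha>)) * X powr - v)"
      using eventually_ge_at_top[of 1] by eventually_elim blast
    then obtain X0 where X0: "\<And>X. X \<ge> X0 \<Longrightarrow> (C2 * (C1 + 1)) * X powr (- e) < X powr 0 \<and>
       C1 * X powr (- v) < X powr (- (2 * real m)) \<and> X \<ge> 1 \<and> (\<exists>\<alpha> :: real.
       algebraic \<alpha> \<and> alg_degree \<alpha> \<le> n \<and> real_of_int (alg_height \<alpha>) \<le> X \<and>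
       \<bar>\<zeta> - \<alpha>\<bar> \<le> inverse (real_of_int (alg_height \<alpha>)) * X powr - v)"
      unfolding eventually_at_top_linorder by blast
    \<comment> \<open>\<open>Q\<close> is chosen with a value so small that the height bound
      \<open>X\<close> derived from it exceeds the threshold \<open>X0\<close>.\<close>
    define X1 where "X1 = max X0 2"
    have X1: "0 < X1 powr (- (2 * real m))" by (simp add: X1_def)
    obtain Q where Q: "prime_elem Q" "degree Q \<ge> 1" "degree Q \<le> m"
      "\<bar>ipoly Q \<zeta>\<bar> \<le> real_of_int (height Q) powr (- u)" "\<bar>ipoly Q \<zeta>\<bar> < X1 powr (- (2 * real m))"
      by (rule small_value_at_prime[OF u0 u(2) X1], rule that)
    have Q0: "Q \<noteq> 0" using Q by auto
    define \<eta> where "\<eta> = \<bar>ipoly Q \<zeta>\<bar>"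
    have \<eta>: "\<eta> > 0" using ipoly_nonzero[OF trans Q0] by (simp add: \<eta>_def)
    define X where "X = \<eta> powr (- 1 / (2 * real m))"
    have \<eta>X: "\<eta> = X powr (- (2 * real m))" using \<eta> m by (simp add: X_def powr_powr)
    have "X1 \<le> X"
    proof (rule ccontr)
      assume "\<not> X1 \<le> X"
      then have "X1 powr (- (2 * real m)) \<le> X powr (- (2 * real m))"
        using \<eta> by (intro powr_mono2') (auto simp: X_def)
      with Q(5) \<eta>X show False by (simp add: \<eta>_def)
    qed
    then have "X \<ge> X0" by (simp add: X1_def)
    from X0[OF this] obtain \<alpha> where X: "(C2 * (C1 + 1)) * X powr (- e) < X powr 0"
       "C1 * X powr (- v) < X powr (- (2 * real m))" "X \<ge> 1"
       and \<alpha>: "algebraic \<alpha>" "alg_degree \<alpha> \<le> n" "real_of_int (alg_height \<alpha>) \<le> X"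
       "\<bar>\<zeta> - \<alpha>\<bar> \<le> inverse (real_of_int (alg_height \<alpha>)) * X powr - v" by blast
    define P where "P = int_min_poly \<alpha>"
    have P: "P \<noteq> 0" "ipoly P \<alpha> = 0" "\<And>F. F \<noteq> 0 \<Longrightarrow> ipoly F \<alpha> = 0 \<Longrightarrow> degree P \<le> degree F"
      "Polynomial.content P = 1"
      using is_int_min_poly_int_min_poly[OF \<alpha>(1)] by (auto simp: P_def is_int_min_poly_def)
    have degP: "degree P \<le> n" and HP: "real_of_int (height P) \<le> X"
      using \<alpha> by (simp_all add: P_def alg_degree_def alg_height_def)
    have degP1: "degree P \<ge> 1"
      using P(1,2) abs_ipoly_const_ge_1[of P \<alpha>] by (cases "degree P = 0") auto
    have valP: "\<bar>ipoly P \<zeta>\<bar> \<le> C1 * X powr (- v)"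
      unfolding P_def using v by (intro C1(2) \<alpha> X(3)) auto
    show False
    proof (cases "Q dvd P")
      \<comment> \<open>Minimality of the degree makes the cofactor constant, and primitivity of
        \<open>P\<close> makes it 1 or -1. Then \<open>P\<close> has at \<open>\<zeta>\<close> the
        absolute value \<open>\<eta> = X powr (- 2 m)\<close>, too large because
        \<open>v > 2 m\<close>.\<close>
      case True
      then obtain K where K: "P = Q * K" by (elim dvdE)
      with P(1) have K0: "K \<noteq> 0" by auto
      have degPK: "degree P = degree Q + degree K" unfolding K using Q0 K0 by (rule degree_mult_eq)
      have "ipoly K \<alpha> \<noteq> 0" using P(3)[OF K0] degPK Q(2) by auto
      then have "ipoly Q \<alpha> = 0" using P(2) unfolding K ipoly_mult by simp
      from P(3)[OF Q0 this] degPK have "degree K = 0" by simp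
      then obtain k where k: "K = [:k:]" by (rule degree_eq_zeroE)
      have "P = smult k Q" by (simp add: K k)
      then have "\<bar>k\<bar> * Polynomial.content Q = 1" using P(4) by (simp add: content_smult)
      then have "\<bar>k\<bar> dvd 1" by (metis dvd_triv_left)
      then have "\<bar>k\<bar> = 1" by simp
      then have "\<bar>real_of_int k\<bar> = 1" by linarith
      then have "\<bar>ipoly P \<zeta>\<bar> = \<eta>" unfolding \<open>P = smult k Q\<close> ipoly_smult abs_mult by (simp add: \<eta>_def)
      with valP X(2) \<eta>X show False by simp
    next
      case False
      define p q where "p = degree P" and "q = degree Q"
      define a b where "a = real_of_int (height P)" and "b = real_of_int (height Q)"
      have ab: "a \<ge> 1" "b \<ge> 1" "a \<le> X" using height_ge_1[OF P(1)] height_ge_1[OF Q0] HP by (auto simp: a_def b_def)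
      have pq: "p \<le> n" "q \<le> m" "p \<ge> 1" "q \<ge> 1" using degP degP1 Q by (auto simp: p_def q_def)
      have bX: "b \<le> X powr (2 * real m / u)"
      proof -
        have u0: "u > 0" using u n by linarith
        have "(b powr (- u)) powr (- 1 / u) \<le> \<eta> powr (- 1 / u)"
          using Q(4) \<eta> u0 by (intro powr_mono2') (auto simp: b_def \<eta>_def)
        then show ?thesis using ab u0 by (simp add: powr_powr \<eta>X)
      qed
      have bn: "b ^ k \<le> X powr (real m - e)" if "k \<le> n" for k
      proof -
        have "b ^ k \<le> b ^ n" using ab that by (intro power_increasing) auto
        also have "\<dots> \<le> (X powr (2 * real m / u)) ^ n" using ab bX by (intro power_mono) auto
        also have "\<dots> = X powr (2 * real m / u * real n)" using X by (simp add: powr_powr flip: powr_realpow)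
        also have "2 * real m / u * real n = real m - e" by (simp add: e_def)
        finally show ?thesis .
      qed
      have aX: "a ^ k \<le> X powr real k'" if "k \<le> k'" for k k'
      proof -
        have "a ^ k \<le> X ^ k" using ab by (intro power_mono) auto
        also have "\<dots> \<le> X ^ k'" using that X by (intro power_increasing) auto
        finally show ?thesis using X by (simp add: powr_realpow)
      qed
      have t1: "a ^ (q - 1) * b ^ p * \<bar>ipoly P \<zeta>\<bar> \<le> C1 * X powr (- e)"
      proof -
        have "a ^ (q - 1) * b ^ p * \<bar>ipoly P \<zeta>\<bar> \<le> X powr real m * X powr (real m - e) * (C1 * X powr (- v))"
          using pq ab C1(1) by (intro mult_mono aX bn valP) auto
        also have "\<dots> = C1 * X powr (2 * real m - v - e)" using X by (simp add: algebra_simps flip: powr_add)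
        also have "\<dots> \<le> C1 * X powr (- e)" using v X C1(1) by (intro mult_left_mono powr_mono) auto
        finally show ?thesis .
      qed
      have t2: "a ^ q * b ^ (p - 1) * \<bar>ipoly Q \<zeta>\<bar> \<le> X powr (- e)"
      proof -
        have "a ^ q * b ^ (p - 1) * \<bar>ipoly Q \<zeta>\<bar> \<le> X powr real m * X powr (real m - e) * X powr (- (2 * real m))"
          using pq ab \<eta>X by (intro mult_mono aX bn) (auto simp: \<eta>_def)
        also have "\<dots> = X powr (- e)" using X by (simp flip: powr_add)
        finally show ?thesis .
      qed
      have "1 \<le> 2 * (3 * real (p + q)) ^ (p + q - 1) * (\<Sum>i\<le>p + q. \<bar>\<zeta>\<bar> ^ i) *
         (a ^ (q - 1) * b ^ p * \<bar>ipoly P \<zeta>\<bar> + a ^ q * b ^ (p - 1) * \<bar>ipoly Q \<zeta>\<bar>)"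
        unfolding a_def b_def using pq
        by (intro prime_values_not_both_small[OF Q(1) False]) (auto simp: p_def q_def)
      also have "\<dots> \<le> C2 * (C1 * X powr (- e) + X powr (- e))"
      proof (rule mult_mono[OF _ add_mono[OF t1 t2]])
        have "(3 * real (p + q)) ^ (p + q - 1) \<le> (3 * real (n + m)) ^ (p + q - 1)"
          using pq by (intro power_mono) auto
        also have "\<dots> \<le> (3 * real (n + m)) ^ (n + m)" using pq by (intro power_increasing) auto
        finally have "2 * (3 * real (p + q)) ^ (p + q - 1) \<le> 2 * (3 * real (n + m)) ^ (n + m)" by simp
        moreover have "(\<Sum>i\<le>p + q. \<bar>\<zeta>\<bar> ^ i) \<le> E" unfolding E_def using pq by (intro sum_mono2) auto
        ultimately show "2 * (3 * real (p + q)) ^ (p + q - 1) * (\<Sum>i\<le>p + q. \<bar>\<zeta>\<bar> ^ i) \<le> C2"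
          unfolding C2_def by (intro mult_mono) (auto intro: sum_nonneg)
      qed (use C20 ab in auto)
      also have "\<dots> = C2 * (C1 + 1) * X powr (- e)" by (simp add: algebra_simps)
      also have "\<dots> < 1" using X(1,3) by simp
      finally show False by simp
    qed
  qed
qed

end

section \<open>Inhomogeneous approximation and the lower bound for the uniform exponent\<close>

text \<open>A weak Jordan inequality from the double angle formula: on \<open>[0, pi / 4]\<close>
  the sine and the cosine each cost a factor \<open>sqrt 2 / 2\<close>.\<close>

lemma half_le_sin:
  assumes "0 \<le> x" "x \<le> pi / 2"
  shows "x / 2 \<le> sin x"
proof -
  have c: "sqrt 2 / 2 \<le> cos y" if "0 \<le> y" "y \<le> pi / 4" for y
    using cos_monotone_0_pi_le[of y "pi / 4"] that by (simp add: cos_45)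
  have s: "x / 2 * (sqrt 2 / 2) \<le> sin (x / 2)"
  proof (cases "x = 0")
    case False
    then obtain y where y: "0 < y" "y < x / 2" "sin (x / 2) - sin 0 = (x / 2 - 0) * cos y"
      using MVT2[of 0 "x / 2" sin cos] assms by auto
    have "x / 2 * (sqrt 2 / 2) \<le> x / 2 * cos y" using c[of y] y assms by (intro mult_left_mono) auto
    with y(3) show ?thesis by simp
  qed simp
  have "x / 2 = 2 * (x / 2 * (sqrt 2 / 2)) * (sqrt 2 / 2)" by simp
  also have "\<dots> \<le> 2 * sin (x / 2) * cos (x / 2)"
    using s c[of "x / 2"] assms sin_ge_zero[of "x / 2"] by (intro mult_mono) auto
  also have "\<dots> = sin x" using sin_double[of "x / 2"] by simp
  finally show ?thesis .
qed

lemma norm_1_minus_cis: "norm (1 - cis (2 * x)) = 2 * \<bar>sin x\<bar>"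
proof -
  have "(norm (1 - cis (2 * x)))\<^sup>2 = (1 - cos (2 * x))\<^sup>2 + (sin (2 * x))\<^sup>2"
    by (simp add: cmod_power2)
  also have "\<dots> = 2 - 2 * cos (2 * x)"
    using sin_cos_squared_add[of "2 * x"] by (simp add: power2_eq_square algebra_simps)
  also have "\<dots> = (2 * \<bar>sin x\<bar>)\<^sup>2" by (simp add: cos_double_sin power_mult_distrib)
  finally show ?thesis by (rule power2_eq_imp_eq) auto
qed

text \<open>The chord from 1 to \<open>cis (2 * pi * t)\<close> has length
  \<open>2 * \<bar>sin (pi * u)\<bar>\<close>, where \<open>u\<close> is the signed distance of
  \<open>t\<close> to its nearest integer, and \<open>half_le_sin\<close> with
  \<open>pi \<ge> 2\<close> bounds it below by \<open>2 * \<bar>u\<bar>\<close>.\<close>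

lemma ex_int_near_cis:
  fixes t :: real
  obtains k :: int where "\<bar>t - of_int k\<bar> \<le> norm (1 - cis (2 * pi * t)) / 2"
proof -
  define u where "u = t - of_int (round t)"
  have u: "\<bar>u\<bar> \<le> 1 / 2" using of_int_round_abs_le[of t] by (simp add: u_def abs_minus_commute)
  have "\<bar>sin (pi * u)\<bar> = sin (pi * \<bar>u\<bar>)"
  proof (cases "u \<ge> 0")
    case True
    then show ?thesis using u pi_gt_zero by (simp add: sin_ge_zero mult_le_cancel_left1 field_simps)
  next
    case False
    have "sin (pi * u) = - sin (pi * \<bar>u\<bar>)" using False by simp
    moreover have "sin (pi * \<bar>u\<bar>) \<ge> 0" using u pi_gt_zero by (intro sin_ge_zero) (auto simp: field_simps)
    ultimately show ?thesis by simp
  qed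
  moreover have "pi * \<bar>u\<bar> / 2 \<le> sin (pi * \<bar>u\<bar>)"
    using u pi_gt_zero by (intro half_le_sin) (auto simp: field_simps)
  moreover have "2 * \<bar>u\<bar> \<le> pi * \<bar>u\<bar>" using pi_ge_two by (intro mult_right_mono) auto
  ultimately have "\<bar>u\<bar> \<le> \<bar>sin (pi * u)\<bar>" by linarith
  moreover have "cis (2 * pi * t) = cis (2 * (pi * u))"
  proof -
    have "2 * pi * t = 2 * (pi * u) + 2 * pi * of_int (round t)" by (simp add: u_def algebra_simps)
    then show ?thesis by (simp add: cis_mult[symmetric] cis_multiple_2pi)
  qed
  ultimately have "\<bar>u\<bar> \<le> norm (1 - cis (2 * pi * t)) / 2" by (simp add: norm_1_minus_cis)
  then show ?thesis using that[of "round t"] by (simp add: u_def)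
qed

text \<open>The normalised, one-sided Dirichlet kernel. Its even absolute powers are kernels of
  Fejer type: nonnegative, 1 at \<open>z = 1\<close>, and decaying away from 1 by
  \<open>norm_dirichlet_mean_le\<close>.\<close>

definition dirichlet_mean :: "nat \<Rightarrow> complex \<Rightarrow> complex" where
  "dirichlet_mean K z = (\<Sum>a<K. z ^ a) / of_nat K"

lemma dirichlet_mean_1: "K \<ge> 1 \<Longrightarrow> dirichlet_mean K 1 = 1"
  by (simp add: dirichlet_mean_def)

lemma norm_dirichlet_mean_le_1:
  assumes "norm z = 1"
  shows "norm (dirichlet_mean K z) \<le> 1"
proof -
  have "norm (\<Sum>a<K. z ^ a) \<le> (\<Sum>a<K. norm (z ^ a))" by (rule norm_sum)
  also have "\<dots> = real K" by (simp add: norm_power assms)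
  finally show ?thesis by (simp add: dirichlet_mean_def norm_divide divide_le_eq)
qed

lemma norm_dirichlet_mean_le:
  assumes "norm z = 1" "K \<ge> 1"
  shows "norm (dirichlet_mean K z) * (real K * norm (1 - z)) \<le> 2"
proof -
  have "(1 - z) * (\<Sum>a<K. z ^ a) = 1 - z ^ K" by (simp add: one_diff_power_eq)
  then have "dirichlet_mean K z * (of_nat K * (1 - z)) = 1 - z ^ K"
    using assms(2) by (simp add: dirichlet_mean_def mult.commute)
  then have "norm (dirichlet_mean K z) * (real K * norm (1 - z)) = norm (1 - z ^ K)"
    by (metis norm_mult norm_of_nat)
  also have "\<dots> \<le> norm (1 :: complex) + norm (z ^ K)" by (rule norm_triangle_ineq4)
  also have "\<dots> = 2" by (simp add: norm_power assms)
  finally show ?thesis .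
qed

text \<open>The \<open>c k\<close> are the distribution of a sum of \<open>A\<close> independent
  uniform variables on \<open>{0..<K}\<close>; the induction step is a convolution.\<close>

lemma dirichlet_mean_power_weights:
  assumes "K \<ge> 1"
  obtains c :: "nat \<Rightarrow> real" where "\<And>k. c k \<ge> 0" "(\<Sum>k\<le>A * K. c k) = 1"
    "\<And>z. dirichlet_mean K z ^ A = (\<Sum>k\<le>A * K. of_real (c k) * z ^ k)"
proof -
  have "\<exists>c :: nat \<Rightarrow> real. (\<forall>k. c k \<ge> 0) \<and> (\<forall>z. dirichlet_mean K z ^ A = (\<Sum>k\<le>A * K. of_real (c k) * z ^ k))"
  proof (induction A)
    case 0
    show ?case by (rule exI[of _ "\<lambda>k. if k = 0 then 1 else 0"]) auto
  next
    case (Suc A)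
    then obtain c where c: "\<And>k. c k \<ge> 0" "\<And>z. dirichlet_mean K z ^ A = (\<Sum>k\<le>A * K. of_real (c k) * z ^ k)"
      by blast
    define D where "D k = {x \<in> {..A * K} \<times> {..<K}. fst x + snd x = k}" for k
    define d where "d k = (\<Sum>x\<in>D k. c (fst x) / real K)" for k
    have "d k \<ge> 0" for k unfolding d_def using c(1) by (intro sum_nonneg) auto
    moreover have "dirichlet_mean K z ^ Suc A = (\<Sum>k\<le>Suc A * K. of_real (d k) * z ^ k)" for z
    proof -
      have "dirichlet_mean K z ^ Suc A = (\<Sum>k\<le>A * K. of_real (c k) * z ^ k) * dirichlet_mean K z"
        by (simp add: c(2))
      also have "\<dots> = (\<Sum>x\<in>{..A * K} \<times> {..<K}. of_real (c (fst x) / real K) * z ^ (fst x + snd x))"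
        unfolding dirichlet_mean_def sum_divide_distrib sum_product sum.cartesian_product
        by (intro sum.cong) (auto simp: power_add)
      also have "\<dots> = (\<Sum>k\<le>Suc A * K. \<Sum>x\<in>D k. of_real (c (fst x) / real K) * z ^ (fst x + snd x))"
        unfolding D_def by (rule sum.group[symmetric]) auto
      also have "\<dots> = (\<Sum>k\<le>Suc A * K. of_real (d k) * z ^ k)"
        unfolding d_def of_real_sum sum_distrib_right
        by (intro sum.cong) (auto simp: D_def)
      finally show ?thesis .
    qed
    ultimately show ?case by blast
  qed
  then obtain c where c: "\<And>k. c k \<ge> 0" "\<And>z. dirichlet_mean K z ^ A = (\<Sum>k\<le>A * K. of_real (c k) * z ^ k)"
    by blast
  have "complex_of_real (\<Sum>k\<le>A * K. c k) = 1"
    using c(2)[of 1] assms by (simp add: dirichlet_mean_1)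
  then have "(\<Sum>k\<le>A * K. c k) = 1" by (simp only: of_real_eq_1_iff)
  with c show ?thesis by (intro that[of c])
qed

lemma sum_squares_weights_ge:
  fixes g :: "nat \<Rightarrow> real"
  assumes "(\<Sum>k\<le>L. g k) = 1"
  shows "1 / real (L + 1) \<le> (\<Sum>k\<le>L. (g k)\<^sup>2)"
proof -
  have "(\<Sum>k\<le>L. g k)\<^sup>2 \<le> (\<Sum>k\<le>L. (g k)\<^sup>2) * real (L + 1)"
    using Cauchy_Schwarz_ineq_sum[of g "\<lambda>_. 1" "{..L}"] by simp
  then show ?thesis using assms by (simp add: divide_le_eq)
qed

text \<open>
  Average \<open>norm (dirichlet_mean K z) ^ (2 * A)\<close> over the points \<open>z\<close>, with \<open>p\<close> weighted by the coefficients
  of \<open>dirichlet_mean M ^ B\<close>. The diagonal terms of the double sum contribute at least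
  \<open>1 / (A K + 1)\<close>, and \<open>sep\<close> makes every other term at most \<open>1 / R ^ B\<close>.
\<close>

lemma fejer_kronecker:
  fixes \<omega> :: "nat \<Rightarrow> complex" and u :: complex and K M A B :: nat and R :: real
  assumes I: "finite I" and unit: "\<And>i. i \<in> I \<Longrightarrow> norm (\<omega> i) = 1" "norm u = 1"
    and KM: "K \<ge> 1" "M \<ge> 1" and R: "R \<ge> 1"
    and sep: "\<And>k k'. k \<le> A * K \<Longrightarrow> k' \<le> A * K \<Longrightarrow> k \<noteq> k' \<Longrightarrow>
       \<exists>i\<in>I. 2 * R \<le> real M * norm (1 - \<omega> i ^ k * cnj (\<omega> i) ^ k')"
  obtains p where "p \<in> I \<rightarrow>\<^sub>E {..B * M}"
    "1 / real (A * K + 1) - 1 / R ^ B \<le> norm (dirichlet_mean K (u * (\<Prod>i\<in>I. \<omega> i ^ p i))) ^ (2 * A)"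
proof (rule ccontr)
  assume contr: "\<not> thesis"
  note found = that
  define L where "L = A * K"
  define z where "z p = u * (\<Prod>i\<in>I. \<omega> i ^ p i)" for p
  define y where "y = 1 / real (L + 1) - 1 / R ^ B"
  have lt: "norm (dirichlet_mean K (z p)) ^ (2 * A) < y" if "p \<in> I \<rightarrow>\<^sub>E {..B * M}" for p
    using found[OF that] contr by (force simp: z_def y_def L_def not_le)
  obtain g where g: "\<And>k. g k \<ge> 0" "(\<Sum>k\<le>L. g k) = 1"
    "\<And>z. dirichlet_mean K z ^ A = (\<Sum>k\<le>L. of_real (g k) * z ^ k)"
    by (rule dirichlet_mean_power_weights[OF KM(1), of A, folded L_def], rule that)
  obtain c where c: "\<And>k. c k \<ge> 0" "(\<Sum>k\<le>B * M. c k) = 1"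
    "\<And>z. dirichlet_mean M z ^ B = (\<Sum>k\<le>B * M. of_real (c k) * z ^ k)"
    by (rule dirichlet_mean_power_weights[OF KM(2), of B], rule that)
  define F where "F = (I \<rightarrow>\<^sub>E {..B * M})"
  \<comment> \<open>Product weights let the sum over all \<open>p\<close> factor into one kernel
    \<open>dirichlet_mean M ^ B\<close> for each \<open>i\<close>.\<close>
  define W where "W p = (\<Prod>i\<in>I. c (p i))" for p
  define \<xi> where "\<xi> k k' i = \<omega> i ^ k * cnj (\<omega> i) ^ k'" for k k' i
  define T where "T k k' = u ^ k * cnj u ^ k' * (\<Prod>i\<in>I. dirichlet_mean M (\<xi> k k' i) ^ B)" for k k'
  have W0: "W p \<ge> 0" for p unfolding W_def by (intro prod_nonneg) (auto simp: c)
  have W1: "(\<Sum>p\<in>F. W p) = 1"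
    unfolding F_def W_def using I by (subst prod_sum_PiE[symmetric]) (auto simp: c(2))
  have norm_sq: "complex_of_real (norm (dirichlet_mean K x) ^ (2 * A)) =
      (\<Sum>k\<le>L. \<Sum>k'\<le>L. of_real (g k * g k') * (x ^ k * cnj x ^ k'))" for x
  proof -
    have "complex_of_real (norm (dirichlet_mean K x) ^ (2 * A)) = of_real ((norm (dirichlet_mean K x ^ A))\<^sup>2)"
      by (simp add: norm_power power_mult[symmetric] mult.commute)
    also have "\<dots> = dirichlet_mean K x ^ A * cnj (dirichlet_mean K x ^ A)" by (rule complex_norm_square)
    also have "\<dots> = (\<Sum>k\<le>L. of_real (g k) * x ^ k) * (\<Sum>k'\<le>L. of_real (g k') * cnj x ^ k')"
      by (simp only: g(3) cnj_sum complex_cnj_mult complex_cnj_power complex_cnj_complex_of_real)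
    finally show ?thesis unfolding sum_product by (simp add: mult_ac)
  qed
  have "complex_of_real (\<Sum>p\<in>F. W p * norm (dirichlet_mean K (z p)) ^ (2 * A)) =
      (\<Sum>p\<in>F. \<Sum>k\<le>L. \<Sum>k'\<le>L. of_real (g k * g k') * (of_real (W p) * (z p ^ k * cnj (z p) ^ k')))"
    unfolding of_real_sum of_real_mult norm_sq sum_distrib_left by (simp add: mult_ac)
  also have "\<dots> = (\<Sum>k\<le>L. \<Sum>k'\<le>L. \<Sum>p\<in>F. of_real (g k * g k') * (of_real (W p) * (z p ^ k * cnj (z p) ^ k')))"
    by (subst sum.swap, rule sum.cong[OF refl], rule sum.swap)
  also have "\<dots> = (\<Sum>k\<le>L. \<Sum>k'\<le>L. of_real (g k * g k') * T k k')"
  proof (intro sum.cong refl)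
    fix k k'
    have "of_real (W p) * (z p ^ k * cnj (z p) ^ k') =
        u ^ k * cnj u ^ k' * (\<Prod>i\<in>I. of_real (c (p i)) * \<xi> k k' i ^ p i)" for p
    proof -
      have "(\<Prod>i\<in>I. \<omega> i ^ p i) ^ k * (\<Prod>i\<in>I. cnj (\<omega> i) ^ p i) ^ k' = (\<Prod>i\<in>I. \<xi> k k' i ^ p i)"
        unfolding \<xi>_def prod_power_distrib prod.distrib[symmetric]
        by (intro prod.cong refl) (simp add: power_mult_distrib power_mult[symmetric] mult.commute)
      then show ?thesis
        by (simp add: W_def z_def power_mult_distrib prod.distrib mult_ac cnj_prod)
    qed
    then have "(\<Sum>p\<in>F. of_real (g k * g k') * (of_real (W p) * (z p ^ k * cnj (z p) ^ k'))) =
        of_real (g k * g k') * (u ^ k * cnj u ^ k' * (\<Sum>p\<in>F. \<Prod>i\<in>I. of_real (c (p i)) * \<xi> k k' i ^ p i))"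
      by (simp only: sum_distrib_left)
    also have "(\<Sum>p\<in>F. \<Prod>i\<in>I. of_real (c (p i)) * \<xi> k k' i ^ p i) = (\<Prod>i\<in>I. dirichlet_mean M (\<xi> k k' i) ^ B)"
      unfolding F_def c(3) using I by (subst prod_sum_PiE) auto
    finally show "(\<Sum>p\<in>F. of_real (g k * g k') * (of_real (W p) * (z p ^ k * cnj (z p) ^ k'))) =
        of_real (g k * g k') * T k k'" by (simp only: T_def)
  qed
  finally have S: "complex_of_real (\<Sum>p\<in>F. W p * norm (dirichlet_mean K (z p)) ^ (2 * A)) =
      (\<Sum>k\<le>L. \<Sum>k'\<le>L. of_real (g k * g k') * T k k')" .
  have \<xi>1: "norm (\<xi> k k' i) = 1" if "i \<in> I" for k k' i
    using unit(1)[OF that] by (simp add: \<xi>_def norm_mult norm_power)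
  have T_diag: "T k k = 1" for k
  proof -
    have "x ^ k * cnj x ^ k = 1" if "norm x = 1" for x
      using that by (simp add: power_mult_distrib[symmetric] complex_norm_square[symmetric])
    then have "\<xi> k k i = 1" if "i \<in> I" for i using unit(1)[OF that] by (simp add: \<xi>_def)
    then have "(\<Prod>i\<in>I. dirichlet_mean M (\<xi> k k i) ^ B) = 1"
      using KM by (intro prod.neutral) (auto simp: dirichlet_mean_1)
    moreover have "u ^ k * cnj u ^ k = 1" using unit(2) by fact+
    ultimately show ?thesis by (simp add: T_def)
  qed
  \<comment> \<open>The kernel of a single coordinate \<open>i\<close> from \<open>sep\<close>
    supplies the decay, and the other kernels are at most 1 in norm. The powers of \<open>u\<close>
    have norm 1, so the estimate is uniform in the target.\<close>
  have T_off: "- (1 / R ^ B) \<le> Re (T k k')" if k: "k \<le> L" "k' \<le> L" "k \<noteq> k'" for k k'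
  proof -
    obtain i where i: "i \<in> I" "2 * R \<le> real M * norm (1 - \<xi> k k' i)"
      using sep[of k k'] k by (auto simp: L_def \<xi>_def)
    have "norm (dirichlet_mean M (\<xi> k k' i)) * (2 * R) \<le> norm (dirichlet_mean M (\<xi> k k' i)) * (real M * norm (1 - \<xi> k k' i))"
      using i by (intro mult_left_mono) auto
    also have "\<dots> \<le> 2" by (rule norm_dirichlet_mean_le[OF \<xi>1[OF i(1)] KM(2)])
    finally have "norm (dirichlet_mean M (\<xi> k k' i)) \<le> 1 / R" using R by (simp add: field_simps)
    then have D: "norm (dirichlet_mean M (\<xi> k k' i)) ^ B \<le> (1 / R) ^ B" by (intro power_mono) auto
    have "norm (T k k') = (\<Prod>j\<in>I. norm (dirichlet_mean M (\<xi> k k' j)) ^ B)"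
      using unit(2) by (simp add: T_def norm_mult norm_power prod_norm[symmetric])
    also have "\<dots> = norm (dirichlet_mean M (\<xi> k k' i)) ^ B * (\<Prod>j\<in>I - {i}. norm (dirichlet_mean M (\<xi> k k' j)) ^ B)"
      by (rule prod.remove[OF I i(1)])
    also have "\<dots> \<le> (1 / R) ^ B * 1"
      using D R by (intro mult_mono prod_le_1) (auto intro!: prod_nonneg power_le_one norm_dirichlet_mean_le_1 \<xi>1)
    finally have "norm (T k k') \<le> 1 / R ^ B" by (simp add: power_divide)
    then show ?thesis using abs_Re_le_cmod[of "T k k'"] by linarith
  qed
  have "(\<Sum>p\<in>F. W p * norm (dirichlet_mean K (z p)) ^ (2 * A)) =
      (\<Sum>k\<le>L. \<Sum>k'\<le>L. g k * g k' * Re (T k k'))"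
    using arg_cong[OF S, of Re] by simp
  also have "\<dots> \<ge> (\<Sum>k\<le>L. \<Sum>k'\<le>L. (if k' = k then (g k)\<^sup>2 else 0) - g k * g k' * (1 / R ^ B))"
  proof (intro sum_mono)
    fix k k' assume k: "k \<in> {..L}" "k' \<in> {..L}"
    show "(if k' = k then (g k)\<^sup>2 else 0) - g k * g k' * (1 / R ^ B) \<le> g k * g k' * Re (T k k')"
    proof (cases "k' = k")
      case True
      have "0 \<le> g k * g k * (1 / R ^ B)" using g(1) R by simp
      then show ?thesis using True by (simp add: T_diag power2_eq_square)
    next
      case False
      have "g k * g k' * (- (1 / R ^ B)) \<le> g k * g k' * Re (T k k')"
        using k False g(1) by (intro mult_left_mono T_off) auto
      then show ?thesis using False by simp
    qed
  qed
  also have "(\<Sum>k\<le>L. \<Sum>k'\<le>L. (if k' = k then (g k)\<^sup>2 else 0) - g k * g k' * (1 / R ^ B)) =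
      (\<Sum>k\<le>L. (g k)\<^sup>2) - 1 / R ^ B"
  proof -
    have "(\<Sum>k\<le>L. \<Sum>k'\<le>L. g k * g k' * (1 / R ^ B)) = (\<Sum>k\<le>L. g k) * (\<Sum>k'\<le>L. g k') * (1 / R ^ B)"
      by (subst sum_product) (simp only: sum_distrib_right)
    moreover have "(\<Sum>k\<le>L. \<Sum>k'\<le>L. if k' = k then (g k)\<^sup>2 else 0) = (\<Sum>k\<le>L. (g k)\<^sup>2)"
      by (rule sum.cong[OF refl]) simp
    ultimately show ?thesis by (simp only: sum_subtractf g(2) mult_1)
  qed
  also have "\<dots> \<ge> y" using sum_squares_weights_ge[OF g(2)] by (simp add: y_def)
  finally have "y \<le> (\<Sum>p\<in>F. W p * norm (dirichlet_mean K (z p)) ^ (2 * A))" .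
  moreover have "(\<Sum>p\<in>F. W p * norm (dirichlet_mean K (z p)) ^ (2 * A)) < (\<Sum>p\<in>F. W p * y)"
  proof -
    have "\<exists>p\<in>F. W p > 0"
    proof (rule ccontr)
      assume "\<not> (\<exists>p\<in>F. W p > 0)"
      then have "(\<Sum>p\<in>F. W p) \<le> 0" by (intro sum_nonpos) (auto simp: not_less)
      with W1 show False by simp
    qed
    then obtain p where p: "p \<in> F" "W p > 0" by blast
    show ?thesis
    proof (rule sum_strict_mono_ex1)
      show "finite F" using I by (auto simp: F_def intro: finite_PiE)
      show "\<forall>p\<in>F. W p * norm (dirichlet_mean K (z p)) ^ (2 * A) \<le> W p * y"
        using W0 by (intro ballI mult_left_mono less_imp_le[OF lt]) (auto simp: F_def)
      show "\<exists>p\<in>F. W p * norm (dirichlet_mean K (z p)) ^ (2 * A) < W p * y"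
        using lt p by (intro bexI[of _ p]) (auto simp: F_def)
    qed
  qed
  ultimately show False by (simp add: W1 flip: sum_distrib_right)
qed

text \<open>By its slope of at least \<open>E / 2\<close>, \<open>P\<close> changes sign within
  distance \<open>2 * \<bar>P(\<zeta>)\<bar> / E\<close> of \<open>\<zeta>\<close>; the intermediate
  value theorem gives the root.\<close>

lemma ex_algebraic_near_steep_root:
  fixes \<zeta> E :: real and P :: "int poly"
  assumes deg: "degree P \<le> n" and E: "E > 0"
    and steep: "\<And>x y. \<bar>\<zeta> - x\<bar> \<le> 1 \<Longrightarrow> \<bar>\<zeta> - y\<bar> \<le> 1 \<Longrightarrow> y \<le> x \<Longrightarrow> E / 2 * (x - y) \<le> ipoly P x - ipoly P y"
    and small: "2 * \<bar>ipoly P \<zeta>\<bar> \<le> E"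
  obtains \<alpha> where "algebraic \<alpha>" "alg_degree \<alpha> \<le> n"
    "real_of_int (alg_height \<alpha>) \<le> 2 ^ n * real (n + 1) * real_of_int (height P)"
    "\<bar>\<zeta> - \<alpha>\<bar> \<le> 2 * \<bar>ipoly P \<zeta>\<bar> / E"
proof -
  define \<tau> where "\<tau> = 2 * \<bar>ipoly P \<zeta>\<bar> / E"
  have \<tau>: "0 \<le> \<tau>" "\<tau> \<le> 1" using E small by (auto simp: \<tau>_def)
  have eq: "E / 2 * \<tau> = \<bar>ipoly P \<zeta>\<bar>" using E by (simp add: \<tau>_def)
  have "ipoly P (\<zeta> - \<tau>) \<le> 0" using steep[of \<zeta> "\<zeta> - \<tau>"] \<tau> eq by simp
  moreover have "0 \<le> ipoly P (\<zeta> + \<tau>)" using steep[of "\<zeta> + \<tau>" \<zeta>] \<tau> eq by simp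
  moreover have "continuous_on {\<zeta> - \<tau>..\<zeta> + \<tau>} (ipoly P)" by (intro continuous_intros)
  ultimately obtain \<alpha> where \<alpha>: "\<zeta> - \<tau> \<le> \<alpha>" "\<alpha> \<le> \<zeta> + \<tau>" "ipoly P \<alpha> = 0"
    using IVT'[of "ipoly P" "\<zeta> - \<tau>" 0 "\<zeta> + \<tau>"] \<tau> by auto
  have P0: "P \<noteq> 0" using steep[of "\<zeta> + 1" \<zeta>] E by auto
  show ?thesis
  proof (rule that)
    show "algebraic \<alpha>" by (rule root_imp_algebraic[OF P0 \<alpha>(3)])
    show "alg_degree \<alpha> \<le> n" by (rule alg_degree_le[OF P0 \<alpha>(3) deg])
    show "real_of_int (alg_height \<alpha>) \<le> 2 ^ n * real (n + 1) * real_of_int (height P)"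
      by (rule alg_height_le[OF P0 \<alpha>(3) deg])
    show "\<bar>\<zeta> - \<alpha>\<bar> \<le> 2 * \<bar>ipoly P \<zeta>\<bar> / E" using \<alpha> by (simp add: \<tau>_def)
  qed
qed

text \<open>Transference: as no nonzero \<open>x\<close> up to \<open>Y\<close> makes all
  \<open>\<zeta> ^ i * x\<close> integral up to \<open>Y powr - l\<close>, the points are separated
  as \<open>fejer_kronecker\<close> demands, and every target \<open>\<beta>\<close> is met modulo 1
  with precision nearly \<open>1 / Y\<close>.\<close>

lemma eventually_inhomogeneous_approximation:
  fixes \<zeta> l \<delta> :: real
  assumes l: "l > 0" and \<delta>: "\<delta> > 0" and lam: "lambda_exp n \<zeta> < ereal l"
  shows "\<forall>\<^sub>F Y :: real in at_top. \<forall>\<beta>. \<exists>p :: nat \<Rightarrow> int.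
    (\<forall>i\<in>{1..n}. 0 \<le> p i \<and> real_of_int (p i) \<le> Y powr (l + 2 * \<delta>)) \<and>
    \<bar>(\<Sum>i\<in>{1..n}. of_int (p i) * \<zeta> ^ i) + \<beta> - of_int (p 0)\<bar> \<le> Y powr (\<delta> - 1)"
proof -
  have "\<not> (\<exists>\<^sub>F Y :: real in at_top. \<exists>(x :: int) (y :: nat \<Rightarrow> int). 1 \<le> \<bar>x\<bar> \<and> real_of_int \<bar>x\<bar> \<le> Y \<and>
       (\<forall>i\<in>{1..n}. \<bar>\<zeta> ^ i * real_of_int x - real_of_int (y i)\<bar> \<le> Y powr - l))"
  proof
    assume "\<exists>\<^sub>F Y :: real in at_top. \<exists>(x :: int) (y :: nat \<Rightarrow> int). 1 \<le> \<bar>x\<bar> \<and> real_of_int \<bar>x\<bar> \<le> Y \<and>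
       (\<forall>i\<in>{1..n}. \<bar>\<zeta> ^ i * real_of_int x - real_of_int (y i)\<bar> \<le> Y powr - l)"
    then have "ereal l \<le> lambda_exp n \<zeta>" unfolding lambda_exp_def by (intro Sup_upper) blast
    with lam show False by simp
  qed
  then have ev: "\<forall>\<^sub>F Y :: real in at_top. \<not> (\<exists>(x :: int) (y :: nat \<Rightarrow> int). 1 \<le> \<bar>x\<bar> \<and> real_of_int \<bar>x\<bar> \<le> Y \<and>
       (\<forall>i\<in>{1..n}. \<bar>\<zeta> ^ i * real_of_int x - real_of_int (y i)\<bar> \<le> Y powr - l))"
    by (simp add: not_frequently)
  \<comment> \<open>\<open>A > 1 / \<delta>\<close> makes the loss \<open>Y powr a\<close> from a
    \<open>2 * A\<close>-th root negligible against \<open>Y powr \<delta>\<close>;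
    \<open>B \<ge> 2 / \<delta>\<close> makes \<open>(Y powr \<delta>) ^ B\<close> at least
    \<open>Y ^ 2\<close>.\<close>
  define A where "A = nat \<lceil>1 / \<delta>\<rceil> + 1"
  define B where "B = nat \<lceil>2 / \<delta>\<rceil>"
  have A: "real A > 1 / \<delta>" "A \<ge> 1" using \<delta> unfolding A_def by linarith+
  have B: "real B \<ge> 2 / \<delta>" unfolding B_def by linarith
  define a where "a = 1 / (2 * real A)"
  have a: "a > 0" "a < \<delta>"
  proof -
    show "a > 0" using A by (simp add: a_def)
    have "1 < \<delta> * real A" using A(1) \<delta> by (simp add: field_simps)
    also have "\<dots> \<le> \<delta> * (2 * real A)" using \<delta> by simp
    finally show "a < \<delta>" using A by (simp add: a_def field_simps)
  qed
  have "\<forall>\<^sub>F Y :: real in at_top. (2 * real A * 4 powr a) * Y powr (a - 1) < Y powr (\<delta> - 1)"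
    using a by (intro eventually_powr_less) auto
  moreover have "\<forall>\<^sub>F Y :: real in at_top. (2 * real B) * Y powr (l + \<delta>) < Y powr (l + 2 * \<delta>)"
    using \<delta> by (intro eventually_powr_less) auto
  moreover note ev eventually_ge_at_top[of "max 4 (2 * real A)"]
  ultimately show ?thesis
  proof eventually_elim
    case (elim Y)
    have Y: "Y \<ge> 4" "Y \<ge> 2 * real A" using elim(4) by auto
    \<comment> \<open>With \<open>A * K \<le> Y\<close>, a difference of two exponents
      \<open>k\<close>, \<open>k'\<close> is an admissible \<open>x\<close>, to which the hypothesis
      on simultaneous approximation applies.\<close>
    define K where "K = nat \<lfloor>Y / real A\<rfloor>"
    have YA: "Y / real A \<ge> 2" using Y A by (simp add: field_simps)
    have K: "real K \<le> Y / real A" "real K > Y / real A - 1" using YA unfolding K_def by linarith+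
    have K1: "K \<ge> 1" using YA unfolding K_def by linarith
    have K2: "Y / (2 * real A) \<le> real K" using K YA by simp
    have AK: "real (A * K) \<le> Y" using K A by (simp add: field_simps)
    \<comment> \<open>Multiplied by the separation \<open>Y powr - l\<close>, this yields at least
      \<open>Y powr \<delta> = R\<close>.\<close>
    define M where "M = nat \<lceil>Y powr (l + \<delta>)\<rceil>"
    have Yp: "Y powr (l + \<delta>) \<ge> 1" using Y l \<delta> by (intro ge_one_powr_ge_zero) auto
    have M: "Y powr (l + \<delta>) \<le> real M" "real M \<le> 2 * Y powr (l + \<delta>)" using Yp unfolding M_def by linarith+
    have M1: "M \<ge> 1" using M Yp by linarith
    define R where "R = Y powr \<delta>"
    have R: "R \<ge> 1" unfolding R_def using Y \<delta> by (intro ge_one_powr_ge_zero) auto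
    have RB: "2 * (Y + 1) \<le> R ^ B"
    proof -
      have "2 * (Y + 1) \<le> 4 * Y" using Y by simp
      also have "\<dots> \<le> Y * Y" using Y by (intro mult_right_mono) auto
      also have "\<dots> = Y powr 2" using Y by (simp add: power2_eq_square)
      also have "\<dots> \<le> Y powr (\<delta> * real B)" using Y B \<delta> by (intro powr_mono) (auto simp: field_simps)
      also have "\<dots> = R ^ B" using Y by (simp add: R_def powr_powr flip: powr_realpow)
      finally show ?thesis .
    qed
    show ?case
    proof
      fix \<beta>
      define e where "e t = cis (2 * pi * t)" for t :: real
      have e_pow: "e t ^ k = e (of_nat k * t)" for t k unfolding e_def Complex.DeMoivre by (simp add: mult_ac)
      have e_prod: "(\<Prod>i\<in>J. e (f i)) = e (\<Sum>i\<in>J. f i)" if "finite J" for J :: "nat set" and f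
        using that by (induction J) (simp_all add: e_def cis_mult distrib_left)
      have sep: "\<exists>i\<in>{1..n}. 2 * R \<le> real M * norm (1 - e (\<zeta> ^ i) ^ k * cnj (e (\<zeta> ^ i)) ^ k')"
        if k: "k \<le> A * K" "k' \<le> A * K" "k \<noteq> k'" for k k'
      proof -
        define x where "x = int k - int k'"
        have x: "1 \<le> \<bar>x\<bar>" using k(3) by (auto simp: x_def)
        have "\<bar>x\<bar> \<le> int (A * K)" using k unfolding x_def by linarith
        then have "real_of_int \<bar>x\<bar> \<le> real (A * K)" by linarith
        with AK have xY: "real_of_int \<bar>x\<bar> \<le> Y" by linarith
        have "\<exists>i\<in>{1..n}. \<forall>y :: int. Y powr - l < \<bar>\<zeta> ^ i * real_of_int x - real_of_int y\<bar>"
        proof (rule ccontr)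
          assume "\<not> (\<exists>i\<in>{1..n}. \<forall>y :: int. Y powr - l < \<bar>\<zeta> ^ i * real_of_int x - real_of_int y\<bar>)"
          then have "\<forall>i\<in>{1..n}. \<exists>y :: int. \<bar>\<zeta> ^ i * real_of_int x - real_of_int y\<bar> \<le> Y powr - l"
            by (simp add: not_less)
          then obtain y :: "nat \<Rightarrow> int" where "\<forall>i\<in>{1..n}. \<bar>\<zeta> ^ i * real_of_int x - real_of_int (y i)\<bar> \<le> Y powr - l"
            by (metis (no_types, lifting))
          with elim(3) x xY show False by blast
        qed
        then obtain i where i: "i \<in> {1..n}" "\<And>y :: int. Y powr - l < \<bar>\<zeta> ^ i * real_of_int x - real_of_int y\<bar>"
          by blast
        obtain y :: int where y: "\<bar>\<zeta> ^ i * real_of_int x - of_int y\<bar> \<le> norm (1 - cis (2 * pi * (\<zeta> ^ i * real_of_int x))) / 2"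
          by (rule ex_int_near_cis)
        have "e (\<zeta> ^ i) ^ k * cnj (e (\<zeta> ^ i)) ^ k' = cis (2 * pi * (\<zeta> ^ i * real_of_int x))"
          unfolding e_def cis_cnj Complex.DeMoivre cis_mult
          by (rule arg_cong[of _ _ cis]) (simp add: x_def algebra_simps)
        then have "2 * Y powr - l \<le> norm (1 - e (\<zeta> ^ i) ^ k * cnj (e (\<zeta> ^ i)) ^ k')"
          using y i(2)[of y] by simp
        then have "Y powr (l + \<delta>) * (2 * Y powr - l) \<le> real M * norm (1 - e (\<zeta> ^ i) ^ k * cnj (e (\<zeta> ^ i)) ^ k')"
          using M by (intro mult_mono) auto
        moreover have "Y powr (l + \<delta>) * (2 * Y powr - l) = 2 * R"
          using Y by (simp add: R_def mult.left_commute flip: powr_add)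
        ultimately show ?thesis using i(1) by auto
      qed
      obtain p where p: "p \<in> {1..n} \<rightarrow>\<^sub>E {..B * M}"
        "1 / real (A * K + 1) - 1 / R ^ B \<le>
          norm (dirichlet_mean K (e \<beta> * (\<Prod>i\<in>{1..n}. e (\<zeta> ^ i) ^ p i))) ^ (2 * A)"
        by (rule fejer_kronecker[of "{1..n}" "\<lambda>i. e (\<zeta> ^ i)" "e \<beta>" K M R A B])
          (use K1 M1 R sep in \<open>auto simp: e_def\<close>)
      define t where "t = (\<Sum>i\<in>{1..n}. real (p i) * \<zeta> ^ i) + \<beta>"
      have z: "e \<beta> * (\<Prod>i\<in>{1..n}. e (\<zeta> ^ i) ^ p i) = e t"
        by (simp add: e_pow e_prod t_def) (simp add: e_def cis_mult distrib_left add.commute)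
      define N where "N = norm (dirichlet_mean K (e t))"
      \<comment> \<open>The diagonal contribution is at least \<open>1 / (Y + 1)\<close>, of which
        the off-diagonal terms take away at most half.\<close>
      have "1 / (4 * Y) \<le> 1 / (2 * (Y + 1))" using Y by (intro divide_left_mono) auto
      also have "\<dots> = 1 / (Y + 1) - 1 / (2 * (Y + 1))" using Y by (simp add: field_simps)
      also have "\<dots> \<le> 1 / real (A * K + 1) - 1 / R ^ B"
        using AK Y RB R by (intro diff_mono divide_left_mono) (auto intro!: mult_pos_pos add_pos_nonneg)
      also have "\<dots> \<le> N ^ (2 * A)" using p(2) unfolding z N_def .
      finally have N: "1 / (4 * Y) \<le> N ^ (2 * A)" .
      have N0: "N > 0"
      proof (rule ccontr)
        assume "\<not> N > 0"
        then have "N = 0" by (simp add: N_def)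
        with N A Y show False by (simp add: power_0_left)
      qed
      \<comment> \<open>The \<open>2 * A\<close>-th root shows that the mean itself is hardly small;
        by its decay \<open>N * (K * \<Delta>) \<le> 2\<close> the point \<open>e t\<close> must
        then be close to 1.\<close>
      have "(1 / (4 * Y)) powr a \<le> (N ^ (2 * A)) powr a" using N Y a by (intro powr_mono2) auto
      also have "\<dots> = N" using N0 A by (simp add: a_def powr_powr flip: powr_realpow)
      finally have Na: "1 / (4 * Y) powr a \<le> N" using Y by (simp add: powr_divide)
      define \<Delta> where "\<Delta> = norm (1 - e t)"
      have "N * (real K * \<Delta>) \<le> 2"
        unfolding N_def \<Delta>_def by (rule norm_dirichlet_mean_le) (use K1 in \<open>auto simp: e_def\<close>)
      moreover have "1 / (4 * Y) powr a * (Y / (2 * real A) * \<Delta>) \<le> N * (real K * \<Delta>)"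
        using Na K2 Y N0 A by (intro mult_mono mult_right_mono) (auto simp: \<Delta>_def)
      ultimately have "1 / (4 * Y) powr a * (Y / (2 * real A) * \<Delta>) \<le> 2" by linarith
      then have "\<Delta> \<le> 2 * ((4 * Y) powr a * (2 * real A) / Y)"
        using Y A by (simp add: field_simps)
      also have "\<dots> = 2 * ((2 * real A * 4 powr a) * Y powr (a - 1))"
        using Y by (simp add: powr_mult powr_diff)
      also have "\<dots> \<le> 2 * Y powr (\<delta> - 1)" using elim(1) by linarith
      finally have \<Delta>: "\<Delta> \<le> 2 * Y powr (\<delta> - 1)" .
      obtain k :: int where k: "\<bar>t - of_int k\<bar> \<le> norm (1 - cis (2 * pi * t)) / 2"
        by (rule ex_int_near_cis)
      define p' where "p' i = (if i = 0 then k else int (p i))" for i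
      have "real_of_int (p' i) \<le> Y powr (l + 2 * \<delta>)" "0 \<le> p' i" if i: "i \<in> {1..n}" for i
      proof -
        have "p i \<le> B * M" using p(1) i by auto
        then have "real (p i) \<le> real (B * M)" by (simp only: of_nat_le_iff)
        also have "\<dots> \<le> real B * (2 * Y powr (l + \<delta>))" using M by (simp only: of_nat_mult) (intro mult_left_mono, auto)
        also have "\<dots> \<le> Y powr (l + 2 * \<delta>)" using elim(2) by simp
        finally show "real_of_int (p' i) \<le> Y powr (l + 2 * \<delta>)" "0 \<le> p' i" using i by (auto simp: p'_def)
      qed
      moreover have "(\<Sum>i\<in>{1..n}. real_of_int (p' i) * \<zeta> ^ i) = (\<Sum>i\<in>{1..n}. real (p i) * \<zeta> ^ i)"
        by (intro sum.cong) (auto simp: p'_def)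
      then have "\<bar>(\<Sum>i\<in>{1..n}. of_int (p' i) * \<zeta> ^ i) + \<beta> - of_int (p' 0)\<bar> \<le> Y powr (\<delta> - 1)"
        using k \<Delta> by (simp add: p'_def t_def \<Delta>_def e_def)
      ultimately show "\<exists>p :: nat \<Rightarrow> int.
        (\<forall>i\<in>{1..n}. 0 \<le> p i \<and> real_of_int (p i) \<le> Y powr (l + 2 * \<delta>)) \<and>
        \<bar>(\<Sum>i\<in>{1..n}. of_int (p i) * \<zeta> ^ i) + \<beta> - of_int (p 0)\<bar> \<le> Y powr (\<delta> - 1)" by blast
    qed
  qed
qed

lemma w_hat_star_exp_ge_inverse:
  assumes trans: "\<not> algebraic \<zeta>" and n: "n \<ge> 1" and l: "l > 0" and lam: "lambda_exp n \<zeta> < ereal l"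
  shows "ereal (1 / l) \<le> w_hat_star_exp n \<zeta>"
  unfolding w_hat_star_exp_def
proof (rule le_Sup_ereal)
  fix v :: real assume "v < 1 / l"
  then have vl: "v * l < 1" using l by (simp add: field_simps)
  \<comment> \<open>Chosen so that \<open>v * \<kappa> + \<delta> < 1\<close> for
    \<open>\<kappa> = l + 3 * \<delta>\<close>. The heights will be of order
    \<open>Y powr (l + 2 * \<delta>)\<close>, the further \<open>\<delta>\<close> in
    \<open>\<kappa>\<close> absorbs constants, and the height bound is
    \<open>X = Y powr \<kappa>\<close>.\<close>
  define \<delta> where "\<delta> = (1 - v * l) / (2 * (3 * \<bar>v\<bar> + 1))"
  have \<delta>: "\<delta> > 0" using vl by (simp add: \<delta>_def add_nonneg_pos)
  define \<kappa> where "\<kappa> = l + 3 * \<delta>"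
  have \<kappa>: "\<kappa> > 0" using l \<delta> by (simp add: \<kappa>_def)
  have v\<kappa>: "\<delta> - 1 < - (v * \<kappa>)"
  proof -
    have "v * \<kappa> + \<delta> = v * l + \<delta> * (3 * v + 1)" by (simp add: \<kappa>_def algebra_simps)
    also have "\<delta> * (3 * v + 1) \<le> \<delta> * (3 * \<bar>v\<bar> + 1)" using \<delta> by (intro mult_left_mono) auto
    also have "\<dots> = (1 - v * l) / 2" by (simp add: \<delta>_def divide_simps add_nonneg_pos)
    finally show ?thesis using vl by (simp add: field_simps)
  qed
  define r where "r = \<bar>\<zeta>\<bar> + 1"
  define G where "G = (\<Sum>i\<in>{1..n}. real i * r ^ i)"
  have G1: "G \<ge> 1"
  proof -
    have "real 1 * r ^ 1 \<le> G" unfolding G_def using n by (intro member_le_sum) (auto simp: r_def)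
    then show ?thesis by (simp add: r_def)
  qed
  define \<Sigma> where "\<Sigma> = (\<Sum>i\<in>{1..n}. \<bar>\<zeta>\<bar> ^ i)"
  have \<Sigma>: "\<Sigma> \<ge> 0" by (simp add: \<Sigma>_def sum_nonneg)
  define \<Gamma> where "\<Gamma> = 2 ^ n * real (n + 1) * (3 + 2 * \<Sigma>)"
  have \<Gamma>: "\<Gamma> > 0" using \<Sigma> by (simp add: \<Gamma>_def add_pos_nonneg)
  have "\<forall>\<^sub>F Y :: real in at_top. (\<Gamma> * 3 * G) * Y powr (l + 2 * \<delta>) < Y powr \<kappa>"
    using \<delta> by (intro eventually_powr_less) (auto simp: \<kappa>_def)
  moreover have "\<forall>\<^sub>F Y :: real in at_top. (2 * \<Gamma>) * Y powr (\<delta> - 1) < Y powr (- (v * \<kappa>))"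
    using v\<kappa> by (intro eventually_powr_less)
  moreover have "\<forall>\<^sub>F Y :: real in at_top. 2 * Y powr (\<delta> - 1) < Y powr (l + 2 * \<delta>)"
    using l \<delta> by (intro eventually_powr_less) auto
  moreover note eventually_inhomogeneous_approximation[OF l \<delta> lam] eventually_ge_at_top[of 1]
  ultimately have "\<forall>\<^sub>F Y :: real in at_top. \<exists>\<alpha>. algebraic \<alpha> \<and> alg_degree \<alpha> \<le> n \<and>
     real_of_int (alg_height \<alpha>) \<le> Y powr \<kappa> \<and>
     \<bar>\<zeta> - \<alpha>\<bar> \<le> inverse (real_of_int (alg_height \<alpha>)) * (Y powr \<kappa>) powr - v"
  proof eventually_elim
    case (elim Y)
    define m where "m = Y powr (l + 2 * \<delta>)"
    have m1: "m \<ge> 1" unfolding m_def using elim(5) l \<delta> by (intro ge_one_powr_ge_zero) auto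
    \<comment> \<open>On the unit interval around \<open>\<zeta>\<close> the correcting terms of
      degree at least 1 have slope at most \<open>G * m\<close>, so the linear term
      \<open>E * T\<close> keeps at least half its slope. The target below is
      \<open>\<beta> = E * \<zeta>\<close>.\<close>
    define E where "E = nat \<lceil>2 * G * m\<rceil>"
    have Gm: "2 * G * m \<ge> 2" using mult_mono[OF G1 m1] G1 by simp
    have E: "2 * G * m \<le> real E" "real E \<le> 3 * G * m" using Gm unfolding E_def by linarith+
    have Em: "2 * m \<le> real E"
    proof -
      have "2 * m * 1 \<le> 2 * m * G" using G1 m1 by (intro mult_left_mono) auto
      then show ?thesis using E(1) by (simp add: mult_ac)
    qed
    obtain p :: "nat \<Rightarrow> int" where p: "\<And>i. i \<in> {1..n} \<Longrightarrow> 0 \<le> p i \<and> real_of_int (p i) \<le> m"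
      "\<bar>(\<Sum>i\<in>{1..n}. of_int (p i) * \<zeta> ^ i) + real E * \<zeta> - of_int (p 0)\<bar> \<le> Y powr (\<delta> - 1)"
      using elim(4) unfolding m_def by metis
    obtain P where P: "\<And>i. coeff P i = (if i \<le> n then (if i = 0 then - p 0 else p i + (if i = 1 then int E else 0)) else 0)"
      "degree P \<le> n"
      by (rule ex_poly_with_coeffs[of n "\<lambda>i. if i = 0 then - p 0 else p i + (if i = 1 then int E else 0)"], rule that)
    have val: "ipoly P x = (\<Sum>i\<in>{1..n}. of_int (p i) * x ^ i) + real E * x - of_int (p 0)" for x
    proof -
      have "ipoly P x = (\<Sum>i\<in>insert 0 {1..n}. of_int (coeff P i) * x ^ i)"
        unfolding ipoly_altdef[OF P(2)] by (intro sum.cong) auto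
      also have "\<dots> = (\<Sum>i\<in>{1..n}. of_int (coeff P i) * x ^ i) - of_int (p 0)"
        by (simp add: P(1))
      also have "(\<Sum>i\<in>{1..n}. of_int (coeff P i) * x ^ i) =
          (\<Sum>i\<in>{1..n}. of_int (p i) * x ^ i + (if i = 1 then real E * x else 0))"
        by (intro sum.cong) (auto simp: P(1) algebra_simps)
      also have "\<dots> = (\<Sum>i\<in>{1..n}. of_int (p i) * x ^ i) + real E * x"
        using n by (simp add: sum.distrib)
      finally show ?thesis .
    qed
    have small: "\<bar>ipoly P \<zeta>\<bar> \<le> Y powr (\<delta> - 1)" using p(2) by (simp add: val)
    have "2 * \<bar>ipoly P \<zeta>\<bar> \<le> m" using small elim(3) by (simp add: m_def)
    then have small2: "2 * \<bar>ipoly P \<zeta>\<bar> \<le> real E" using Em m1 by linarith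
    have E0: "real E > 0" using Em m1 by linarith
    have steep: "real E / 2 * (x - y) \<le> ipoly P x - ipoly P y"
      if xy: "\<bar>\<zeta> - x\<bar> \<le> 1" "\<bar>\<zeta> - y\<bar> \<le> 1" "y \<le> x" for x y
    proof -
      have "\<bar>\<Sum>i\<in>{1..n}. of_int (p i) * (x ^ i - y ^ i)\<bar> \<le> (\<Sum>i\<in>{1..n}. m * (real i * r ^ i * \<bar>x - y\<bar>))"
      proof (rule order_trans[OF sum_abs sum_mono])
        fix i assume i: "i \<in> {1..n}"
        have "\<bar>x ^ i - y ^ i\<bar> \<le> real i * r ^ i * \<bar>x - y\<bar>"
          using xy by (intro abs_power_diff_le) (auto simp: r_def)
        then show "\<bar>of_int (p i) * (x ^ i - y ^ i)\<bar> \<le> m * (real i * r ^ i * \<bar>x - y\<bar>)"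
          unfolding abs_mult using p(1)[OF i] m1 by (intro mult_mono) auto
      qed
      also have "\<dots> = G * m * (x - y)" using xy(3) by (simp add: G_def sum_distrib_left sum_distrib_right mult_ac)
      also have "\<dots> \<le> real E / 2 * (x - y)" using E(1) xy(3) by (intro mult_right_mono) auto
      finally have "- (real E / 2 * (x - y)) \<le> (\<Sum>i\<in>{1..n}. of_int (p i) * (x ^ i - y ^ i))" by linarith
      moreover have "ipoly P x - ipoly P y = (\<Sum>i\<in>{1..n}. of_int (p i) * (x ^ i - y ^ i)) + real E * (x - y)"
        by (simp add: val sum_subtractf algebra_simps)
      moreover have "real E * (x - y) = 2 * (real E / 2 * (x - y))" by simp
      ultimately show ?thesis by linarith
    qed
    obtain \<alpha> where \<alpha>: "algebraic \<alpha>" "alg_degree \<alpha> \<le> n"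
      "real_of_int (alg_height \<alpha>) \<le> 2 ^ n * real (n + 1) * real_of_int (height P)"
      "\<bar>\<zeta> - \<alpha>\<bar> \<le> 2 * \<bar>ipoly P \<zeta>\<bar> / real E"
      by (rule ex_algebraic_near_steep_root[OF P(2) E0 steep small2])
    \<comment> \<open>The approximation gives no bound on \<open>p 0\<close>; it is recovered from
      the other coefficients because \<open>P(\<zeta>)\<close> is small.\<close>
    have coeffs: "\<bar>real_of_int (coeff P i)\<bar> \<le> (3 + 2 * \<Sigma>) * real E" for i
    proof -
      have big: "\<bar>real_of_int (coeff P i)\<bar> \<le> 2 * real E" if "i \<in> {1..n}" for i
        using p(1)[OF that] that Em m1 by (auto simp: P(1))
      consider "i = 0" | "i \<in> {1..n}" | "i > n" by force
      then show ?thesis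
      proof cases
        case 1
        have "ipoly P \<zeta> = (\<Sum>i\<in>{1..n}. of_int (coeff P i) * \<zeta> ^ i) + of_int (coeff P 0)"
        proof -
          have "{..n} = insert 0 {1..n}" by auto
          then show ?thesis unfolding ipoly_altdef[OF P(2)] by simp
        qed
        then have "\<bar>real_of_int (coeff P 0)\<bar> \<le> \<bar>ipoly P \<zeta>\<bar> + \<bar>\<Sum>i\<in>{1..n}. of_int (coeff P i) * \<zeta> ^ i\<bar>" by linarith
        also have "\<bar>\<Sum>i\<in>{1..n}. of_int (coeff P i) * \<zeta> ^ i\<bar> \<le> (\<Sum>i\<in>{1..n}. 2 * real E * \<bar>\<zeta>\<bar> ^ i)"
        proof (rule order_trans[OF sum_abs sum_mono])
          fix i assume "i \<in> {1..n}"
          then show "\<bar>of_int (coeff P i) * \<zeta> ^ i\<bar> \<le> 2 * real E * \<bar>\<zeta>\<bar> ^ i"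
            unfolding abs_mult power_abs using big by (intro mult_right_mono) auto
        qed
        also have "\<dots> = 2 * \<Sigma> * real E" by (simp add: \<Sigma>_def sum_distrib_left sum_distrib_right mult_ac)
        finally show ?thesis using 1 small2 E0 by (simp add: algebra_simps)
      next
        case 2
        have "2 * real E \<le> (3 + 2 * \<Sigma>) * real E" using \<Sigma> E0 by (intro mult_right_mono) auto
        then show ?thesis using big[OF 2] by linarith
      next
        case 3
        then show ?thesis using \<Sigma> E0 by (simp add: P(1))
      qed
    qed
    then have "height P \<le> \<lfloor>(3 + 2 * \<Sigma>) * real E\<rfloor>" by (intro height_leI) (simp add: le_floor_iff)
    then have "real_of_int (height P) \<le> (3 + 2 * \<Sigma>) * real E" by (simp add: le_floor_iff)
    then have "2 ^ n * real (n + 1) * real_of_int (height P) \<le> 2 ^ n * real (n + 1) * ((3 + 2 * \<Sigma>) * real E)"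
      by (intro mult_left_mono) auto
    moreover have "2 ^ n * real (n + 1) * ((3 + 2 * \<Sigma>) * real E) = \<Gamma> * real E"
      by (simp add: \<Gamma>_def)
    ultimately have H: "real_of_int (alg_height \<alpha>) \<le> \<Gamma> * real E" using \<alpha>(3) by linarith
    note H
    also have "\<dots> \<le> \<Gamma> * (3 * G * m)" using E \<Gamma> by (intro mult_left_mono) auto
    also have "\<dots> \<le> Y powr \<kappa>" using elim(1) by (simp add: m_def mult_ac)
    finally have HY: "real_of_int (alg_height \<alpha>) \<le> Y powr \<kappa>" .
    have H0: "real_of_int (alg_height \<alpha>) > 0" using alg_height_ge_1[OF \<alpha>(1)] by simp
    \<comment> \<open>The height is \<open>O(E)\<close> and the distance is
      \<open>O(\<bar>P(\<zeta>)\<bar> / E)\<close>, so \<open>E\<close> cancels exactly as the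
      weight \<open>inverse (alg_height \<alpha>)\<close> requires.\<close>
    have "\<bar>\<zeta> - \<alpha>\<bar> * real_of_int (alg_height \<alpha>) \<le> 2 * \<bar>ipoly P \<zeta>\<bar> / real E * (\<Gamma> * real E)"
      using \<alpha>(4) H H0 E0 by (intro mult_mono) auto
    also have "\<dots> = 2 * \<Gamma> * \<bar>ipoly P \<zeta>\<bar>" using E0 by simp
    also have "\<dots> \<le> 2 * \<Gamma> * Y powr (\<delta> - 1)" using small \<Gamma> by (intro mult_left_mono) auto
    also have "\<dots> \<le> (Y powr \<kappa>) powr - v" using elim(2) by (simp add: powr_powr mult.commute)
    finally have "\<bar>\<zeta> - \<alpha>\<bar> \<le> (Y powr \<kappa>) powr - v / real_of_int (alg_height \<alpha>)"
      using H0 by (subst pos_le_divide_eq)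
    then have "\<bar>\<zeta> - \<alpha>\<bar> \<le> inverse (real_of_int (alg_height \<alpha>)) * (Y powr \<kappa>) powr - v"
      by (simp only: divide_inverse mult.commute)
    with \<alpha>(1,2) HY show ?case by blast
  qed
  then obtain Y0 where Y0: "\<And>Y. Y \<ge> Y0 \<Longrightarrow> \<exists>\<alpha>. algebraic \<alpha> \<and> alg_degree \<alpha> \<le> n \<and>
     real_of_int (alg_height \<alpha>) \<le> Y powr \<kappa> \<and>
     \<bar>\<zeta> - \<alpha>\<bar> \<le> inverse (real_of_int (alg_height \<alpha>)) * (Y powr \<kappa>) powr - v"
    unfolding eventually_at_top_linorder by blast
  show "\<forall>\<^sub>F X :: real in at_top. \<exists>\<alpha> :: real. algebraic \<alpha> \<and> alg_degree \<alpha> \<le> n \<and>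
     real_of_int (alg_height \<alpha>) \<le> X \<and>
     \<bar>\<zeta> - \<alpha>\<bar> \<le> inverse (real_of_int (alg_height \<alpha>)) * X powr - v"
    using eventually_ge_at_top[of "max Y0 1 powr \<kappa>"]
  proof eventually_elim
    case (elim X)
    have X: "X > 0" using elim by (rule less_le_trans[rotated]) simp
    have "(max Y0 1 powr \<kappa>) powr (1 / \<kappa>) \<le> X powr (1 / \<kappa>)" using elim \<kappa> by (intro powr_mono2) auto
    then have "Y0 \<le> X powr (1 / \<kappa>)" using \<kappa> by (simp add: powr_powr)
    from Y0[OF this] show ?case using \<kappa> X by (simp add: powr_powr)
  qed
qed

section \<open>Passage to the limit\<close>

lemma ereal_ln_gt_iff: "ereal a < ereal_ln x \<longleftrightarrow> ereal (exp a) < x"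
proof (cases x)
  case (real r)
  show ?thesis
  proof (cases "r > 0")
    case True
    then have "a < ln r \<longleftrightarrow> exp a < r" using exp_less_cancel_iff[of a "ln r"] by simp
    with real True show ?thesis by (simp add: ereal_ln_def zero_ereal_def)
  next
    case False
    then have "\<not> exp a < r" using exp_gt_zero[of a] by linarith
    with real False show ?thesis by (simp add: ereal_ln_def zero_ereal_def)
  qed
qed (auto simp: ereal_ln_def)

lemma ereal_ln_less_iff: "ereal_ln x < ereal a \<longleftrightarrow> x < ereal (exp a)"
proof (cases x)
  case (real r)
  show ?thesis
  proof (cases "r > 0")
    case True
    then have "ln r < a \<longleftrightarrow> r < exp a" using exp_less_cancel_iff[of "ln r" a] by simp
    with real True show ?thesis by (simp add: ereal_ln_def zero_ereal_def)
  next
    case False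
    then have "r < exp a" using exp_gt_zero[of a] by linarith
    with real False show ?thesis by (simp add: ereal_ln_def zero_ereal_def)
  qed
qed (auto simp: ereal_ln_def)

lemma log_ratio_gt_iff:
  assumes "n \<ge> 2"
  shows "ereal y < ereal_ln x / ereal (ln (real n)) \<longleftrightarrow> ereal (real n powr y) < x"
proof -
  have "ln (real n) > 0" using assms by simp
  then have "ereal y < ereal_ln x / ereal (ln (real n)) \<longleftrightarrow> ereal (ln (real n) * y) < ereal_ln x"
    by (simp add: ereal_less_divide_pos)
  also have "\<dots> \<longleftrightarrow> ereal (real n powr y) < x"
    using assms by (simp add: ereal_ln_gt_iff powr_def mult.commute)
  finally show ?thesis .
qed

lemma log_ratio_less_iff:
  assumes "n \<ge> 2"
  shows "ereal_ln x / ereal (ln (real n)) < ereal y \<longleftrightarrow> x < ereal (real n powr y)"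
proof -
  have "ln (real n) > 0" using assms by simp
  then have "ereal_ln x / ereal (ln (real n)) < ereal y \<longleftrightarrow> ereal_ln x < ereal (ln (real n) * y)"
    by (simp add: ereal_divide_less_pos)
  also have "\<dots> \<longleftrightarrow> x < ereal (real n powr y)"
    using assms by (simp add: ereal_ln_less_iff powr_def mult.commute)
  finally show ?thesis .
qed

lemma ratio_gt_iff: "n \<ge> 1 \<Longrightarrow> ereal y < x / ereal (real n) \<longleftrightarrow> ereal (y * real n) < x"
  by (simp add: ereal_less_divide_pos mult.commute)

lemma ratio_less_iff: "n \<ge> 1 \<Longrightarrow> x / ereal (real n) < ereal y \<longleftrightarrow> x < ereal (y * real n)"
  by (simp add: ereal_divide_less_pos mult.commute)

lemma le_ereal_if_reals_below:
  assumes "\<And>r. r < c \<Longrightarrow> ereal r \<le> x"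
  shows "ereal c \<le> x"
proof (rule dense_le)
  fix z assume z: "z < ereal c"
  then show "z \<le> x" using assms by (cases z) auto
qed

lemma eventually_real_gt: "\<forall>\<^sub>F n in sequentially. c < real n"
  by (rule filterlim_at_top_dense[THEN iffD1, rule_format, OF filterlim_real_sequentially])

lemma frequently_gt_Limsup:
  fixes f :: "nat \<Rightarrow> ereal"
  assumes "y < limsup f"
  shows "\<exists>\<^sub>F n in sequentially. y < f n"
proof (rule ccontr)
  assume "\<not> (\<exists>\<^sub>F n in sequentially. y < f n)"
  then have "\<forall>\<^sub>F n in sequentially. f n \<le> y" by (simp add: not_frequently not_less)
  then have "limsup f \<le> y" by (rule Limsup_bounded)
  with assms show False by simp
qed

lemma frequently_less_Liminf:
  fixes f :: "nat \<Rightarrow> ereal"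
  assumes "liminf f < y"
  shows "\<exists>\<^sub>F n in sequentially. f n < y"
proof (rule ccontr)
  assume "\<not> (\<exists>\<^sub>F n in sequentially. f n < y)"
  then have "\<forall>\<^sub>F n in sequentially. y \<le> f n" by (simp add: not_frequently not_less)
  then have "y \<le> liminf f" by (rule Liminf_bounded)
  with assms show False by simp
qed

text \<open>Makes a finite \<open>lambda_exp 1 \<zeta>\<close> a uniform bound for all later
  exponents.\<close>

lemma lambda_exp_antimono: "n \<ge> 1 \<Longrightarrow> lambda_exp n \<zeta> \<le> lambda_exp 1 \<zeta>"
  unfolding lambda_exp_def
proof (rule Sup_subset_mono, clarify)
  fix l :: real
  assume n: "n \<ge> 1" and f: "\<exists>\<^sub>F X :: real in at_top. \<exists>(x :: int) (y :: nat \<Rightarrow> int). 1 \<le> \<bar>x\<bar> \<and> real_of_int \<bar>x\<bar> \<le> X \<and>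
       (\<forall>i\<in>{1..n}. \<bar>\<zeta> ^ i * real_of_int x - real_of_int (y i)\<bar> \<le> X powr - l)"
  have "\<exists>\<^sub>F X :: real in at_top. \<exists>(x :: int) (y :: nat \<Rightarrow> int). 1 \<le> \<bar>x\<bar> \<and> real_of_int \<bar>x\<bar> \<le> X \<and>
       (\<forall>i\<in>{1..1}. \<bar>\<zeta> ^ i * real_of_int x - real_of_int (y i)\<bar> \<le> X powr - l)"
    by (rule frequently_elim1[OF f]) (elim exE, rule exI, rule exI, use n in auto)
  then show "\<exists>la. ereal l = ereal la \<and> (\<exists>\<^sub>F X :: real in at_top. \<exists>(x :: int) (y :: nat \<Rightarrow> int). 1 \<le> \<bar>x\<bar> \<and> real_of_int \<bar>x\<bar> \<le> X \<and>
       (\<forall>i\<in>{1..1}. \<bar>\<zeta> ^ i * real_of_int x - real_of_int (y i)\<bar> \<le> X powr - la))" by blast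
qed

lemma four_div_less_real:
  assumes "1 \<le> x" "4 / x < ereal y"
  shows "y > 0" "ereal (4 / y) < x"
proof -
  have "y > 0 \<and> ereal (4 / y) < x"
  proof (cases x)
    case (real r)
    have r: "r \<ge> 1" using assms(1) real by simp
    have less: "4 / r < y" using assms(2) real r by simp
    moreover have "4 / r > 0" using r by simp
    ultimately have "y > 0" by linarith
    with less r real show ?thesis by (simp add: field_simps)
  next
    case PInf
    then show ?thesis using assms(2) by (simp add: zero_ereal_def)
  next
    case MInf
    then show ?thesis using assms(1) by simp
  qed
  then show "y > 0" "ereal (4 / y) < x" by auto
qed

context
  fixes \<zeta> :: real
  assumes trans: "\<not> algebraic \<zeta>"
begin

text \<open>Joins the upper bound for simultaneous approximation with its transference to the
  uniform exponent. The latter needs a strict bound on \<open>lambda_exp\<close>, so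
  \<open>m\<close> is reached only as a limit from below.\<close>

lemma lower_bounds_from_w_exp:
  assumes m: "m \<ge> 1" and w: "w_exp m \<zeta> \<le> ereal c" and n: "c + 2 * real m \<le> real n"
  shows "ereal (real m) \<le> w_hat_star_exp n \<zeta>" "lambda_exp n \<zeta> \<le> ereal (1 / real m)"
proof -
  have "w_exp m \<zeta> + ereal (real (2 * m)) \<le> ereal c + ereal (real (2 * m))"
    using w by (rule add_right_mono)
  also have "\<dots> \<le> ereal (real n)" using n by simp
  finally show lam: "lambda_exp n \<zeta> \<le> ereal (1 / real m)" by (rule lambda_exp_le[OF trans m])
  have "ereal (real m) \<le> ereal c" using w_exp_ge[OF trans m] w by (rule order_trans)
  then have n1: "n \<ge> 1" using n m by simp
  show "ereal (real m) \<le> w_hat_star_exp n \<zeta>"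
  proof (rule le_ereal_if_reals_below)
    fix r assume r: "r < real m"
    \<comment> \<open>The bound \<open>1 / 2\<close> keeps the reciprocal \<open>1 / s\<close>
      positive when \<open>r\<close> is not.\<close>
    define s where "s = max r (1 / 2)"
    have s: "s > 0" "s < real m" "r \<le> s" using r m by (auto simp: s_def)
    have "1 / real m < 1 / s" using s by (simp add: field_simps)
    then have "lambda_exp n \<zeta> < ereal (1 / s)" by (intro le_less_trans[OF lam]) simp
    then have "ereal (1 / (1 / s)) \<le> w_hat_star_exp n \<zeta>"
      using s by (intro w_hat_star_exp_ge_inverse[OF trans n1]) auto
    moreover have "ereal r \<le> ereal (1 / (1 / s))" using s by simp
    ultimately show "ereal r \<le> w_hat_star_exp n \<zeta>" by (rule order_trans[rotated])
  qed
qed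

text \<open>Since \<open>w_exp (2 * n + 1) \<zeta>\<close> is always above \<open>2 * n\<close>, the
  uniform exponent is at most \<open>4 * n + 2\<close>, even if values of \<open>w_exp\<close> are
  infinite.\<close>

lemma w_hat_star_exp_finite:
  assumes "n \<ge> 1"
  obtains h where "w_hat_star_exp n \<zeta> = ereal h" "h \<ge> 1"
proof -
  have "ereal (real (2 * n)) < ereal (real (2 * n + 1))" by simp
  also have "\<dots> \<le> w_exp (2 * n + 1) \<zeta>" by (rule w_exp_ge[OF trans]) simp
  finally have "w_hat_star_exp n \<zeta> \<le> ereal (real (2 * (2 * n + 1)))" by (rule w_hat_star_exp_le[OF trans assms])
  with w_hat_star_exp_ge_1[OF trans assms] show ?thesis
    by (cases "w_hat_star_exp n \<zeta>") (auto intro: that)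
qed

lemma inverse_w_hat_star_exp_le_lambda_exp:
  assumes n: "n \<ge> 1" and h: "w_hat_star_exp n \<zeta> = ereal h" "h \<ge> 1"
  shows "ereal (1 / h) \<le> lambda_exp n \<zeta>"
proof (rule ccontr)
  assume "\<not> ereal (1 / h) \<le> lambda_exp n \<zeta>"
  then have "lambda_exp n \<zeta> < ereal (1 / h)" by simp
  then have "max (lambda_exp n \<zeta>) 0 < ereal (1 / h)" using h(2) by (simp add: zero_ereal_def)
  then obtain l where l: "max (lambda_exp n \<zeta>) 0 < ereal l" "ereal l < ereal (1 / h)"
    using ereal_dense2 by blast
  then have l': "l > 0" "lambda_exp n \<zeta> < ereal l" "l < 1 / h" by (auto simp: zero_ereal_def)
  have "ereal (1 / l) \<le> ereal h" using w_hat_star_exp_ge_inverse[OF trans n l'(1,2)] h by simp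
  with l' h show False by (simp add: field_simps)
qed

lemma one_le_w_lower: "1 \<le> w_lower \<zeta>"
  unfolding w_lower_def
proof (rule Liminf_bounded)
  show "\<forall>\<^sub>F n in sequentially. 1 \<le> w_exp n \<zeta> / ereal (real n)"
    using eventually_ge_at_top[of 1]
  proof eventually_elim
    case (elim n)
    then show ?case using w_exp_ge[OF trans elim] by (simp add: ereal_le_divide_pos)
  qed
qed

lemma one_le_w_upper: "1 \<le> w_upper \<zeta>"
proof -
  have "w_lower \<zeta> \<le> w_upper \<zeta>" unfolding w_lower_def w_upper_def by (intro Liminf_le_Limsup) simp
  with one_le_w_lower show ?thesis by (rule order_trans)
qed

lemma one_le_tau_exp: "1 \<le> tau_exp \<zeta>"
proof -
  have "1 \<le> liminf (\<lambda>n. ereal_ln (w_exp n \<zeta>) / ereal (ln (real n)))"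
  proof (rule Liminf_bounded)
    show "\<forall>\<^sub>F n in sequentially. 1 \<le> ereal_ln (w_exp n \<zeta>) / ereal (ln (real n))"
      using eventually_ge_at_top[of 2]
    proof eventually_elim
      case (elim n)
      have "\<not> ereal_ln (w_exp n \<zeta>) / ereal (ln (real n)) < ereal 1"
        using w_exp_ge[OF trans, of n] elim by (subst log_ratio_less_iff) (auto simp: not_less)
      then show ?case by (simp add: one_ereal_def not_less)
    qed
  qed
  also have "\<dots> \<le> tau_exp \<zeta>" unfolding tau_exp_def by (intro Liminf_le_Limsup) simp
  finally show ?thesis .
qed

section \<open>The bounds on the linear scale\<close>

lemma w_hat_star_nonneg_eventually:
  "\<forall>\<^sub>F n in sequentially. 0 \<le> w_hat_star_exp n \<zeta> / ereal (real n)"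
  using eventually_ge_at_top[of 1]
proof eventually_elim
  case (elim n)
  have "0 \<le> w_hat_star_exp n \<zeta>" by (rule order_trans[OF _ w_hat_star_exp_ge_1[OF trans elim]]) simp
  then show ?case using elim by (simp add: ereal_le_divide_pos)
qed

lemma w_hat_star_lower_ge: "1 / (w_upper \<zeta> + 2) \<le> w_hat_star_lower \<zeta>"
proof (cases "w_upper \<zeta>")
  case (real c)
  have c: "c \<ge> 1" using one_le_w_upper real by simp
  have "ereal (1 / (c + 2)) \<le> w_hat_star_lower \<zeta>"
    unfolding w_hat_star_lower_def le_Liminf_iff
  proof (intro allI impI)
    fix y' assume "y' < ereal (1 / (c + 2))"
    then have "max y' 0 < ereal (1 / (c + 2))" using c by (simp add: zero_ereal_def)
    then obtain y where y: "max y' 0 < ereal y" "ereal y < ereal (1 / (c + 2))" using ereal_dense2 by blast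
    then have y0: "y' < ereal y" "0 < y" "y < 1 / (c + 2)" by (auto simp: zero_ereal_def)
    \<comment> \<open>The gap below \<open>1 / (c + 2)\<close> gives
      \<open>w_exp m \<zeta> + 2 * m \<le> m / z \<le> n\<close> for
      \<open>m = \<lfloor>z * n\<rfloor>\<close>; the gap above \<open>y\<close> absorbs the
      rounding, so that \<open>m > y * n\<close>.\<close>
    define z where "z = (y + 1 / (c + 2)) / 2"
    have z: "y < z" "z < 1 / (c + 2)" "z > 0" using y0 by (auto simp: z_def field_simps)
    have "c < 1 / z - 2" using z c by (simp add: field_simps)
    then have "w_upper \<zeta> < ereal (1 / z - 2)" using real by simp
    then have "\<forall>\<^sub>F m in sequentially. w_exp m \<zeta> / ereal (real m) < ereal (1 / z - 2)"
      unfolding w_upper_def by (rule Limsup_lessD)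
    then obtain m0 where m0: "\<And>m. m \<ge> m0 \<Longrightarrow> w_exp m \<zeta> / ereal (real m) < ereal (1 / z - 2)"
      unfolding eventually_sequentially by blast
    have "\<forall>\<^sub>F n in sequentially. real n > max ((real m0 + 2) / z) (1 / (z - y))"
      by (rule eventually_real_gt)
    then show "\<forall>\<^sub>F n in sequentially. y' < w_hat_star_exp n \<zeta> / ereal (real n)"
      using eventually_ge_at_top[of 1]
    proof eventually_elim
      case (elim n)
      define m where "m = nat \<lfloor>z * real n\<rfloor>"
      have zn: "z * real n > real m0 + 2" "(z - y) * real n > 1" using elim z by (simp_all add: field_simps)
      have m: "real m \<le> z * real n" "real m > z * real n - 1" using zn unfolding m_def by linarith+
      have m1: "m \<ge> 1" "m \<ge> m0" using m zn by linarith+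
      have w: "w_exp m \<zeta> \<le> ereal ((1 / z - 2) * real m)"
        using m0[OF m1(2)] by (subst (asm) ratio_less_iff[OF m1(1)]) simp
      have "ereal (real m) \<le> w_hat_star_exp n \<zeta>"
        using m z by (intro lower_bounds_from_w_exp(1)[OF m1(1) w]) (simp add: field_simps)
      moreover have "ereal (y * real n) < ereal (real m)" using m zn by (simp add: algebra_simps)
      ultimately have "ereal (y * real n) < w_hat_star_exp n \<zeta>" by (rule less_le_trans[rotated])
      then have "ereal y < w_hat_star_exp n \<zeta> / ereal (real n)"
        using elim(2) by (simp add: ratio_gt_iff)
      with y0(1) show ?case by (rule less_trans)
    qed
  qed
  then show ?thesis using real c by (simp add: one_ereal_def)
next
  case PInf
  have "0 \<le> w_hat_star_lower \<zeta>" unfolding w_hat_star_lower_def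
    by (rule Liminf_bounded[OF w_hat_star_nonneg_eventually])
  with PInf show ?thesis by simp
qed (use one_le_w_upper in auto)

lemma w_hat_star_upper_ge: "1 / (w_lower \<zeta> + 2) \<le> w_hat_star_upper \<zeta>"
proof (cases "w_lower \<zeta>")
  case (real c)
  have c: "c \<ge> 1" using one_le_w_lower real by simp
  have "\<not> w_hat_star_upper \<zeta> < ereal (1 / (c + 2))"
  proof
    assume "w_hat_star_upper \<zeta> < ereal (1 / (c + 2))"
    then have "max (w_hat_star_upper \<zeta>) 0 < ereal (1 / (c + 2))" using c by (simp add: zero_ereal_def)
    then obtain y where y: "max (w_hat_star_upper \<zeta>) 0 < ereal y" "ereal y < ereal (1 / (c + 2))" using ereal_dense2 by blast
    then have y0: "w_hat_star_upper \<zeta> < ereal y" "0 < y" "y < 1 / (c + 2)" by (auto simp: zero_ereal_def)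
    define z where "z = (y + 1 / (c + 2)) / 2"
    have z: "y < z" "z < 1 / (c + 2)" "z > 0" using y0 by (auto simp: z_def field_simps)
    have "c < 1 / z - 2" using z c by (simp add: field_simps)
    then have "w_lower \<zeta> < ereal (1 / z - 2)" using real by simp
    then have fr: "\<exists>\<^sub>F m in sequentially. w_exp m \<zeta> / ereal (real m) < ereal (1 / z - 2)"
      unfolding w_lower_def by (rule frequently_less_Liminf)
    from y0(1) have "\<forall>\<^sub>F n in sequentially. w_hat_star_exp n \<zeta> / ereal (real n) < ereal y"
      unfolding w_hat_star_upper_def by (rule Limsup_lessD)
    then obtain n0 where n0: "\<And>n. n \<ge> n0 \<Longrightarrow> w_hat_star_exp n \<zeta> / ereal (real n) < ereal y"
      unfolding eventually_sequentially by blast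
    have "\<forall>\<^sub>F m in sequentially. real m > max (z * real n0 + z) (y * z / (z - y))"
      by (rule eventually_real_gt)
    with fr have "\<exists>\<^sub>F m in sequentially. w_exp m \<zeta> / ereal (real m) < ereal (1 / z - 2) \<and>
      real m > max (z * real n0 + z) (y * z / (z - y))" by (rule frequently_eventually_frequently)
    then obtain m where m: "w_exp m \<zeta> / ereal (real m) < ereal (1 / z - 2)"
      "real m > z * real n0 + z" "real m > y * z / (z - y)"
      by (auto dest: frequently_ex)
    have "z * real n0 + z > 0" using z by (simp add: add_nonneg_pos)
    then have m1: "m \<ge> 1" using m(2) by linarith
    \<comment> \<open>Good \<open>m\<close> are only known to occur infinitely often, so
      \<open>m\<close> comes first and \<open>n\<close> is the least index with
      \<open>m / z \<le> n\<close>. The condition \<open>m > y * z / (z - y)\<close> pays for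
      rounding up.\<close>
    define n where "n = nat \<lceil>real m / z\<rceil>"
    have mz: "real m / z \<ge> 0" using z by simp
    have n: "real m / z \<le> real n" "real n < real m / z + 1" using mz unfolding n_def by linarith+
    have "real n0 + 1 < real m / z" using m(2) z by (simp add: field_simps)
    with n have n1: "n \<ge> n0" "n \<ge> 1" by linarith+
    have w: "w_exp m \<zeta> \<le> ereal ((1 / z - 2) * real m)"
      using m(1) by (subst (asm) ratio_less_iff[OF m1]) simp
    have "ereal (real m) \<le> w_hat_star_exp n \<zeta>"
      using n by (intro lower_bounds_from_w_exp(1)[OF m1 w]) (simp add: field_simps)
    also have "w_hat_star_exp n \<zeta> < ereal (y * real n)" using n0[OF n1(1)] n1(2) by (simp add: ratio_less_iff)
    finally have "real m < y * real n" by simp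
    also have "\<dots> \<le> y * (real m / z + 1)" using n y0 by (intro mult_left_mono) auto
    finally have "real m * z < y * (real m / z + 1) * z" using z(3) by (rule mult_strict_right_mono)
    also have "\<dots> = y * real m + y * z" using z(3) by (simp add: distrib_left distrib_right)
    finally have "real m * (z - y) < y * z" by (simp add: right_diff_distrib mult.commute)
    moreover have "y * z < real m * (z - y)" using m(3) z(1) by (simp add: pos_divide_less_eq)
    ultimately show False by simp
  qed
  then show ?thesis using real c by (simp add: one_ereal_def not_less)
next
  case PInf
  have "0 \<le> liminf (\<lambda>n. w_hat_star_exp n \<zeta> / ereal (real n))"
    by (rule Liminf_bounded[OF w_hat_star_nonneg_eventually])
  also have "\<dots> \<le> w_hat_star_upper \<zeta>" unfolding w_hat_star_upper_def by (intro Liminf_le_Limsup) simp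
  finally show ?thesis using PInf by simp
qed (use one_le_w_lower in auto)

lemma w_hat_star_ratio_le_eventually:
  "\<forall>\<^sub>F n in sequentially. w_hat_star_exp n \<zeta> / ereal (real n) \<le> w_exp n \<zeta> / ereal (real n)"
  using eventually_ge_at_top[of 1]
  by eventually_elim (auto intro!: ereal_divide_right_mono w_hat_star_exp_le_w_exp[OF trans])

text \<open>Infinitely many \<open>m\<close> have \<open>w_exp m \<zeta> > z * m\<close>. Each gives
  one \<open>n = \<lfloor>z * m / 2\<rfloor>\<close> with uniform exponent at most
  \<open>2 * m\<close>, about \<open>4 * n / z\<close>, which refutes an eventual lower bound
  \<open>y * n\<close> with \<open>z * y > 4\<close>.\<close>

lemma w_hat_star_lower_le: "w_hat_star_lower \<zeta> \<le> 4 / w_upper \<zeta>"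
proof (rule ccontr)
  assume "\<not> w_hat_star_lower \<zeta> \<le> 4 / w_upper \<zeta>"
  then have "4 / w_upper \<zeta> < w_hat_star_lower \<zeta>" by simp
  then obtain y where y: "4 / w_upper \<zeta> < ereal y" "ereal y < w_hat_star_lower \<zeta>"
    using ereal_dense2 by blast
  note y' = four_div_less_real[OF one_le_w_upper y(1)]
  obtain z where z: "ereal (4 / y) < ereal z" "ereal z < w_upper \<zeta>" using ereal_dense2[OF y'(2)] by blast
  have zy: "4 / y < z" "4 < z * y" "z > 0"
  proof -
    show less: "4 / y < z" using z(1) by simp
    then show "4 < z * y" using y'(1) by (simp add: field_simps)
    have "4 / y > 0" using y'(1) by simp
    with less show "z > 0" by linarith
  qed
  have fr: "\<exists>\<^sub>F m in sequentially. ereal z < w_exp m \<zeta> / ereal (real m)"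
    using z(2) unfolding w_upper_def by (rule frequently_gt_Limsup)
  from y(2) have "\<forall>\<^sub>F n in sequentially. ereal y < w_hat_star_exp n \<zeta> / ereal (real n)"
    unfolding w_hat_star_lower_def by (rule less_LiminfD)
  then obtain n0 where n0: "\<And>n. n \<ge> n0 \<Longrightarrow> ereal y < w_hat_star_exp n \<zeta> / ereal (real n)"
    unfolding eventually_sequentially by blast
  have "\<forall>\<^sub>F m in sequentially. real m > max ((2 * real n0 + 4) / z) (2 * y / (z * y - 4))"
    by (rule eventually_real_gt)
  with fr have "\<exists>\<^sub>F m in sequentially. ereal z < w_exp m \<zeta> / ereal (real m) \<and>
    real m > max ((2 * real n0 + 4) / z) (2 * y / (z * y - 4))" by (rule frequently_eventually_frequently)
  then obtain m where m: "ereal z < w_exp m \<zeta> / ereal (real m)"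
    "real m > (2 * real n0 + 4) / z" "real m > 2 * y / (z * y - 4)"
    by (auto dest: frequently_ex)
  have zm: "z * real m > 2 * real n0 + 4" using m(2) zy by (simp add: field_simps)
  have m1: "m \<ge> 1" using zm by (cases m) auto
  define n where "n = nat \<lfloor>z * real m / 2\<rfloor>"
  have n: "real n \<le> z * real m / 2" "real n > z * real m / 2 - 1" using zm unfolding n_def by linarith+
  have n1: "n \<ge> 1" "n \<ge> n0" using n zm by linarith+
  have "ereal (real (2 * n)) \<le> ereal (z * real m)" using n by simp
  also have "\<dots> < w_exp m \<zeta>" using m(1) m1 by (simp add: ratio_gt_iff)
  finally have "w_hat_star_exp n \<zeta> \<le> ereal (real (2 * m))" by (rule w_hat_star_exp_le[OF trans n1(1)])
  moreover have "ereal (y * real n) < w_hat_star_exp n \<zeta>" using n0[OF n1(2)] n1(1) by (simp add: ratio_gt_iff)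
  ultimately have "ereal (y * real n) < ereal (real (2 * m))" by (rule less_le_trans[rotated])
  then have "y * real n < 2 * real m" by simp
  moreover have "y * (z * real m / 2 - 1) \<le> y * real n" using n y'(1) by (intro mult_left_mono) auto
  ultimately have "y * (z * real m / 2 - 1) < 2 * real m" by linarith
  then have "real m * (z * y - 4) < 2 * y" by (simp add: algebra_simps)
  moreover have "2 * y < real m * (z * y - 4)" using m(3) zy(2) by (simp add: pos_divide_less_eq)
  ultimately show False by simp
qed

text \<open>Here \<open>w_exp m \<zeta> > z * m\<close> for all large \<open>m\<close>, so
  \<open>n\<close> may be prescribed and \<open>m = \<lceil>2 * n / z\<rceil>\<close> is the least
  index with \<open>2 * n \<le> z * m\<close>.\<close>

lemma w_hat_star_upper_le: "w_hat_star_upper \<zeta> \<le> 4 / w_lower \<zeta>"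
proof (rule ccontr)
  assume "\<not> w_hat_star_upper \<zeta> \<le> 4 / w_lower \<zeta>"
  then have "4 / w_lower \<zeta> < w_hat_star_upper \<zeta>" by simp
  then obtain y where y: "4 / w_lower \<zeta> < ereal y" "ereal y < w_hat_star_upper \<zeta>"
    using ereal_dense2 by blast
  note y' = four_div_less_real[OF one_le_w_lower y(1)]
  obtain z where z: "ereal (4 / y) < ereal z" "ereal z < w_lower \<zeta>" using ereal_dense2[OF y'(2)] by blast
  have zy: "4 / y < z" "4 < z * y" "z > 0"
  proof -
    show less: "4 / y < z" using z(1) by simp
    then show "4 < z * y" using y'(1) by (simp add: field_simps)
    have "4 / y > 0" using y'(1) by simp
    with less show "z > 0" by linarith
  qed
  have fr: "\<exists>\<^sub>F n in sequentially. ereal y < w_hat_star_exp n \<zeta> / ereal (real n)"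
    using y(2) unfolding w_hat_star_upper_def by (rule frequently_gt_Limsup)
  from z(2) have "\<forall>\<^sub>F m in sequentially. ereal z < w_exp m \<zeta> / ereal (real m)"
    unfolding w_lower_def by (rule less_LiminfD)
  then obtain m0 where m0: "\<And>m. m \<ge> m0 \<Longrightarrow> ereal z < w_exp m \<zeta> / ereal (real m)"
    unfolding eventually_sequentially by blast
  have "\<forall>\<^sub>F n in sequentially. real n > max (z * (real m0 + 1)) (2 * z / (z * y - 4))"
    by (rule eventually_real_gt)
  with fr have "\<exists>\<^sub>F n in sequentially. ereal y < w_hat_star_exp n \<zeta> / ereal (real n) \<and>
    real n > max (z * (real m0 + 1)) (2 * z / (z * y - 4))" by (rule frequently_eventually_frequently)
  then obtain n where n: "ereal y < w_hat_star_exp n \<zeta> / ereal (real n)"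
    "real n > z * (real m0 + 1)" "real n > 2 * z / (z * y - 4)"
    by (auto dest: frequently_ex)
  have "z * (real m0 + 1) > 0" using zy by simp
  then have n1: "n \<ge> 1" using n(2) by linarith
  define m where "m = nat \<lceil>2 * real n / z\<rceil>"
  have "2 * real n / z \<ge> 0" using zy by simp
  then have m: "2 * real n / z \<le> real m" "real m < 2 * real n / z + 1" unfolding m_def by linarith+
  have "real m0 + 1 < 2 * real n / z" using n(2) zy n1 by (simp add: field_simps)
  with m have m1: "m \<ge> 1" "m \<ge> m0" by linarith+
  have "ereal (real (2 * n)) \<le> ereal (z * real m)" using m zy by (simp add: field_simps)
  also have "\<dots> < w_exp m \<zeta>" using m0[OF m1(2)] m1 by (simp add: ratio_gt_iff)
  finally have "w_hat_star_exp n \<zeta> \<le> ereal (real (2 * m))" by (rule w_hat_star_exp_le[OF trans n1])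
  moreover have "ereal (y * real n) < w_hat_star_exp n \<zeta>" using n(1) n1 by (simp add: ratio_gt_iff)
  ultimately have "ereal (y * real n) < ereal (real (2 * m))" by (rule less_le_trans[rotated])
  then have "y * real n < 2 * real m" by simp
  with m(2) have "y * real n < 4 * real n / z + 2" by simp
  then have "y * real n * z < (4 * real n / z + 2) * z" using zy(3) by (rule mult_strict_right_mono)
  also have "\<dots> = 4 * real n + 2 * z" using zy(3) by (simp add: distrib_right)
  finally have "real n * (z * y - 4) < 2 * z" by (simp add: algebra_simps)
  moreover have "2 * z < real n * (z * y - 4)" using n(3) zy(2) by (simp add: pos_divide_less_eq)
  ultimately show False by simp
qed

section \<open>The identities on the logarithmic scale\<close>

lemma eventually_powr_lower_bounds:
  assumes t: "tau_exp \<zeta> = ereal t" and y: "y < 1 / t"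
  shows "\<forall>\<^sub>F n in sequentially. ereal (real n powr y) < w_hat_star_exp n \<zeta> \<and>
     lambda_exp n \<zeta> < ereal (real n powr (- y))"
proof -
  have t1: "t \<ge> 1" using one_le_tau_exp t by simp
  \<comment> \<open>A nonnegative exponent gives \<open>X powr u \<ge> 1\<close>, so
    \<open>V > 2 * X powr u\<close> survives rounding down to \<open>m\<close>.\<close>
  define u where "u = max y 0"
  have u: "u \<ge> 0" "y \<le> u" "u < 1 / t" using y t1 by (auto simp: u_def)
  define z where "z = (u + 1 / t) / 2"
  have z: "u < z" "z < 1 / t" "z > 0" using u by (auto simp: z_def)
  define C where "C = 1 / z"
  have tC: "t < C" using z t1 by (simp add: C_def field_simps)
  then have C1: "C \<ge> 1" using t1 by simp
  have "tau_exp \<zeta> < ereal C" using t tC by simp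
  then have "\<forall>\<^sub>F m in sequentially. ereal_ln (w_exp m \<zeta>) / ereal (ln (real m)) < ereal C"
    unfolding tau_exp_def by (rule Limsup_lessD)
  then obtain m0 where m0: "\<And>m. m \<ge> m0 \<Longrightarrow> ereal_ln (w_exp m \<zeta>) / ereal (ln (real m)) < ereal C"
    unfolding eventually_sequentially by blast
  have "\<forall>\<^sub>F X :: real in at_top. (2 * 3 powr z) * X powr u < X powr z"
    using z by (intro eventually_powr_less)
  moreover have "\<forall>\<^sub>F X :: real in at_top. ((real m0 + 3) * 3 powr z) * X powr 0 < X powr z"
    using z by (intro eventually_powr_less)
  ultimately have "\<forall>\<^sub>F X :: real in at_top. (2 * 3 powr z) * X powr u < X powr z \<and>
      ((real m0 + 3) * 3 powr z) * X powr 0 < X powr z \<and> X \<ge> 1"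
    using eventually_ge_at_top[of 1] by eventually_elim blast
  from eventually_compose_filterlim[OF this filterlim_real_sequentially] show ?thesis
  proof eventually_elim
    case (elim n)
    define X where "X = real n"
    have X: "(2 * 3 powr z) * X powr u < X powr z" "((real m0 + 3) * 3 powr z) < X powr z" "X \<ge> 1"
      using elim by (auto simp: X_def)
    \<comment> \<open>With \<open>C = 1 / z\<close> this makes
      \<open>w_exp m \<zeta> \<le> m powr C \<le> n / 3\<close>, and since
      \<open>m \<le> m powr C\<close>, the summand \<open>2 * m\<close> takes at most the other two
      thirds of \<open>n\<close>.\<close>
    define V where "V = (X / 3) powr z"
    have V: "X powr z = V * 3 powr z" using X(3) by (simp add: V_def powr_divide)
    have V1: "2 * X powr u < V" "real m0 + 3 < V"
      using X(1,2) unfolding V by (auto simp: mult.commute[of _ "3 powr z"] mult.left_commute[of _ "3 powr z"])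
    define m where "m = nat \<lfloor>V\<rfloor>"
    have m: "real m \<le> V" "real m > V - 1" using V1 unfolding m_def by linarith+
    have m1: "m \<ge> 2" "m \<ge> m0" "m \<ge> 1" using m V1 by linarith+
    have w: "w_exp m \<zeta> \<le> ereal (real m powr C)"
      using m0[OF m1(2)] m1(1) by (simp add: log_ratio_less_iff)
    have "real m powr C \<le> V powr C" using m C1 by (intro powr_mono2) auto
    also have "\<dots> = X / 3" using z X(3) by (simp add: V_def C_def powr_powr)
    finally have mC: "real m powr C \<le> X / 3" .
    have "real m powr 1 \<le> real m powr C" using m1 C1 by (intro powr_mono) auto
    then have "real m powr C + 2 * real m \<le> real n" using mC m1 by (simp add: X_def)
    note bounds = lower_bounds_from_w_exp[OF m1(3) w this]
    have "1 \<le> X powr u" using X(3) u by (intro ge_one_powr_ge_zero) auto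
    moreover have "X powr y \<le> X powr u" using X(3) u by (intro powr_mono) auto
    ultimately have Xm: "X powr y < real m" using V1 m by linarith
    then have "ereal (real n powr y) < ereal (real m)" by (simp add: X_def)
    then have "ereal (real n powr y) < w_hat_star_exp n \<zeta>" using bounds(1) by (rule less_le_trans)
    moreover have "lambda_exp n \<zeta> < ereal (real n powr (- y))"
    proof (rule le_less_trans[OF bounds(2)])
      have "1 / real m < 1 / X powr y" using Xm X(3) m1(3) by (intro divide_strict_left_mono mult_pos_pos) auto
      then show "ereal (1 / real m) < ereal (real n powr (- y))" by (simp add: X_def powr_minus_divide)
    qed
    ultimately show ?case by blast
  qed
qed

lemma theta_exp_nonneg: "0 \<le> theta_exp \<zeta>"
  unfolding theta_exp_def
proof (rule Liminf_bounded)
  show "\<forall>\<^sub>F n in sequentially. 0 \<le> ereal_ln (w_hat_star_exp n \<zeta>) / ereal (ln (real n))"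
    using eventually_ge_at_top[of 2]
  proof eventually_elim
    case (elim n)
    have "\<not> ereal_ln (w_hat_star_exp n \<zeta>) / ereal (ln (real n)) < ereal 0"
      using w_hat_star_exp_ge_1[OF trans, of n] elim by (subst log_ratio_less_iff) (auto simp: not_less one_ereal_def)
    then show ?case by (simp add: zero_ereal_def not_less)
  qed
qed

lemma theta_exp_ge: "1 / tau_exp \<zeta> \<le> theta_exp \<zeta>"
proof (cases "tau_exp \<zeta>")
  case (real t)
  have t1: "t \<ge> 1" using one_le_tau_exp real by simp
  have "ereal (1 / t) \<le> theta_exp \<zeta>"
  proof (rule le_ereal_if_reals_below)
    fix y assume y: "y < 1 / t"
    show "ereal y \<le> theta_exp \<zeta>" unfolding theta_exp_def
    proof (rule Liminf_bounded)
      show "\<forall>\<^sub>F n in sequentially. ereal y \<le> ereal_ln (w_hat_star_exp n \<zeta>) / ereal (ln (real n))"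
        using eventually_powr_lower_bounds[OF real y] eventually_ge_at_top[of 2]
      proof eventually_elim
        case (elim n)
        then have "ereal y < ereal_ln (w_hat_star_exp n \<zeta>) / ereal (ln (real n))"
          by (simp only: log_ratio_gt_iff)
        then show ?case by (rule less_imp_le)
      qed
    qed
  qed
  then show ?thesis using real t1 by (simp add: one_ereal_def)
next
  case PInf
  then show ?thesis using theta_exp_nonneg by simp
qed (use one_le_tau_exp in auto)

lemma theta_exp_le: "theta_exp \<zeta> \<le> 1 / tau_exp \<zeta>"
proof (rule ccontr)
  assume "\<not> theta_exp \<zeta> \<le> 1 / tau_exp \<zeta>"
  then have "1 / tau_exp \<zeta> < theta_exp \<zeta>" by simp
  then obtain y where y: "1 / tau_exp \<zeta> < ereal y" "ereal y < theta_exp \<zeta>" using ereal_dense2 by blast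
  have y': "y > 0 \<and> ereal (1 / y) < tau_exp \<zeta>"
  proof (cases "tau_exp \<zeta>")
    case (real r)
    have r: "r \<ge> 1" using one_le_tau_exp real by simp
    have less: "1 / r < y" using y(1) real r by (simp add: one_ereal_def)
    moreover have "1 / r > 0" using r by simp
    ultimately have "y > 0" by linarith
    with less r real show ?thesis by (simp add: field_simps)
  next
    case PInf
    then show ?thesis using y(1) by (simp add: zero_ereal_def)
  next
    case MInf
    then show ?thesis using one_le_tau_exp by simp
  qed
  then obtain z where z: "ereal (1 / y) < ereal z" "ereal z < tau_exp \<zeta>" using ereal_dense2 by blast
  have zy: "1 < z * y" "z > 0"
  proof -
    have less: "1 / y < z" using z(1) by simp
    then show "1 < z * y" using y' by (simp add: pos_divide_less_eq)
    have "1 / y > 0" using y' by simp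
    with less show "z > 0" by linarith
  qed
  have fr: "\<exists>\<^sub>F m in sequentially. ereal z < ereal_ln (w_exp m \<zeta>) / ereal (ln (real m))"
    using z(2) unfolding tau_exp_def by (rule frequently_gt_Limsup)
  from y(2) have "\<forall>\<^sub>F n in sequentially. ereal y < ereal_ln (w_hat_star_exp n \<zeta>) / ereal (ln (real n))"
    unfolding theta_exp_def by (rule less_LiminfD)
  then obtain n0 where n0: "\<And>n. n \<ge> n0 \<Longrightarrow> ereal y < ereal_ln (w_hat_star_exp n \<zeta>) / ereal (ln (real n))"
    unfolding eventually_sequentially by blast
  have "\<forall>\<^sub>F X :: real in at_top. (2 * 4 powr y) * X powr 1 < X powr (z * y)"
    using zy by (intro eventually_powr_less)
  moreover have "\<forall>\<^sub>F X :: real in at_top. (2 * real n0 + 6) * X powr 0 < X powr z"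
    using zy by (intro eventually_powr_less)
  ultimately have "\<forall>\<^sub>F X :: real in at_top. (2 * 4 powr y) * X powr 1 < X powr (z * y) \<and>
      (2 * real n0 + 6) * X powr 0 < X powr z \<and> X \<ge> 2"
    using eventually_ge_at_top[of 2] by eventually_elim blast
  from frequently_eventually_frequently[OF fr eventually_compose_filterlim[OF this filterlim_real_sequentially]]
  obtain m where m: "ereal z < ereal_ln (w_exp m \<zeta>) / ereal (ln (real m))"
    "(2 * 4 powr y) * real m powr 1 < real m powr (z * y)"
    "(2 * real n0 + 6) * real m powr 0 < real m powr z" "real m \<ge> 2"
    by (blast dest: frequently_ex)
  define V where "V = real m powr z"
  have V: "2 * real n0 + 6 < V" using m(3,4) by (simp add: V_def)
  \<comment> \<open>Then \<open>2 * n \<le> m powr z < w_exp m \<zeta>\<close> bounds the uniform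
    exponent by \<open>2 * m\<close>, whereas \<open>n powr y\<close> is of order
    \<open>m powr (z * y)\<close> with \<open>z * y > 1\<close>.\<close>
  define n where "n = nat \<lfloor>V / 2\<rfloor>"
  have n: "real n \<le> V / 2" "real n > V / 2 - 1" using V unfolding n_def by linarith+
  have n1: "n \<ge> 1" "n \<ge> 2" "n \<ge> n0" "V / 4 \<le> real n" using n V by linarith+
  have m2: "m \<ge> 2" using m(4) by linarith
  have "ereal (real (2 * n)) \<le> ereal V" using n by simp
  also have "\<dots> < w_exp m \<zeta>" using m(1) unfolding V_def by (simp only: log_ratio_gt_iff[OF m2])
  finally have "w_hat_star_exp n \<zeta> \<le> ereal (real (2 * m))" by (rule w_hat_star_exp_le[OF trans n1(1)])
  moreover have "ereal (real n powr y) < w_hat_star_exp n \<zeta>"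
    using n0[OF n1(3)] by (simp only: log_ratio_gt_iff[OF n1(2)])
  ultimately have "ereal (real n powr y) < ereal (real (2 * m))" by (rule less_le_trans[rotated])
  then have "real n powr y < 2 * real m" by simp
  moreover have "(V / 4) powr y \<le> real n powr y" using n1(4) V y' by (intro powr_mono2) auto
  ultimately have "(V / 4) powr y < 2 * real m" by linarith
  moreover have "(V / 4) powr y = real m powr (z * y) / 4 powr y"
    unfolding V_def using m(4) by (simp add: powr_divide powr_powr)
  ultimately have "real m powr (z * y) < 2 * real m * 4 powr y" by (simp add: pos_divide_less_eq)
  with m(2,4) show False by (simp add: mult_ac)
qed

text \<open>Holds for each single \<open>n\<close> from
  \<open>1 / v\<^sub>n \<le> \<lambda>\<^sub>n\<close>; negation turns the lower limit into an upper
  one.\<close>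

lemma uminus_theta_exp_le_sigma_exp: "- theta_exp \<zeta> \<le> sigma_exp \<zeta>"
proof -
  have "\<forall>\<^sub>F n in sequentially. - (ereal_ln (w_hat_star_exp n \<zeta>) / ereal (ln (real n)))
      \<le> ereal_ln (lambda_exp n \<zeta>) / ereal (ln (real n))"
    using eventually_ge_at_top[of 2]
  proof eventually_elim
    case (elim n)
    then have n: "n \<ge> 1" "ln (real n) > 0" by auto
    obtain h where h: "w_hat_star_exp n \<zeta> = ereal h" "h \<ge> 1" using w_hat_star_exp_finite[OF n(1)] .
    have eq: "- (ereal_ln (w_hat_star_exp n \<zeta>) / ereal (ln (real n))) = ereal (- ln h / ln (real n))"
      using h n(2) by (simp add: ereal_ln_def zero_ereal_def)
    have "\<not> ereal_ln (lambda_exp n \<zeta>) / ereal (ln (real n)) < ereal (- ln h / ln (real n))"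
    proof -
      have "real n powr (- ln h / ln (real n)) = 1 / h"
        using n h(2) elim by (simp add: powr_def exp_minus inverse_eq_divide)
      then show ?thesis
        using inverse_w_hat_star_exp_le_lambda_exp[OF n(1) h] by (simp add: log_ratio_less_iff[OF elim] not_less)
    qed
    then show ?case unfolding eq by (simp add: not_less)
  qed
  then have "limsup (\<lambda>n. - (ereal_ln (w_hat_star_exp n \<zeta>) / ereal (ln (real n)))) \<le> sigma_exp \<zeta>"
    unfolding sigma_exp_def by (rule Limsup_mono)
  then show ?thesis unfolding theta_exp_def by (simp add: ereal_Limsup_uminus)
qed

lemma sigma_exp_le:
  assumes "lambda_exp 1 \<zeta> < \<infinity>"
  shows "sigma_exp \<zeta> \<le> - (1 / tau_exp \<zeta>)"
proof (cases "tau_exp \<zeta>")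
  case (real t)
  have t1: "t \<ge> 1" using one_le_tau_exp real by simp
  have "ereal (1 / t) \<le> - sigma_exp \<zeta>"
  proof (rule le_ereal_if_reals_below)
    fix y assume y: "y < 1 / t"
    have "sigma_exp \<zeta> \<le> ereal (- y)" unfolding sigma_exp_def
    proof (rule Limsup_bounded)
      show "\<forall>\<^sub>F n in sequentially. ereal_ln (lambda_exp n \<zeta>) / ereal (ln (real n)) \<le> ereal (- y)"
        using eventually_powr_lower_bounds[OF real y] eventually_ge_at_top[of 2]
      proof eventually_elim
        case (elim n)
        then have "ereal_ln (lambda_exp n \<zeta>) / ereal (ln (real n)) < ereal (- y)"
          by (simp only: log_ratio_less_iff)
        then show ?case by (rule less_imp_le)
      qed
    qed
    then have "- ereal (- y) \<le> - sigma_exp \<zeta>" by (simp only: ereal_minus_le_minus)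
    then show "ereal y \<le> - sigma_exp \<zeta>" by simp
  qed
  then have "- (- sigma_exp \<zeta>) \<le> - ereal (1 / t)" by (simp only: ereal_minus_le_minus)
  then show ?thesis using real t1 by (simp add: one_ereal_def)
next
  \<comment> \<open>The claim becomes \<open>sigma_exp \<zeta> \<le> 0\<close>. Here the finiteness
    of \<open>lambda_exp 1 \<zeta>\<close> enters: all later exponents stay below one constant
    \<open>c\<close>, which is less than \<open>n powr e\<close> for large \<open>n\<close>.\<close>
  case PInf
  obtain c where c: "lambda_exp 1 \<zeta> < ereal c" using ereal_dense2[OF assms] by blast
  have "sigma_exp \<zeta> \<le> 0"
    unfolding sigma_exp_def Limsup_le_iff
  proof (intro allI impI)
    fix e' :: ereal assume "0 < e'"
    then obtain e where e: "0 < ereal e" "ereal e < e'" using ereal_dense2 by blast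
    have "\<forall>\<^sub>F X :: real in at_top. c * X powr 0 < X powr e"
      using e by (intro eventually_powr_less) simp
    from eventually_compose_filterlim[OF this filterlim_real_sequentially] eventually_ge_at_top[of 2]
    show "\<forall>\<^sub>F n in sequentially. ereal_ln (lambda_exp n \<zeta>) / ereal (ln (real n)) < e'"
    proof eventually_elim
      case (elim n)
      have "lambda_exp n \<zeta> \<le> lambda_exp 1 \<zeta>" using elim(2) by (intro lambda_exp_antimono) simp
      also note c
      also have "ereal c < ereal (real n powr e)" using elim by simp
      finally have "ereal_ln (lambda_exp n \<zeta>) / ereal (ln (real n)) < ereal e"
        using elim(2) by (simp only: log_ratio_less_iff)
      then show ?case using e(2) by (rule less_trans)
    qed
  qed
  then show ?thesis using PInf by simp
qed (use one_le_tau_exp in auto)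

end

theorem theorem2p7:
  fixes \<zeta> :: real
  assumes "\<not> algebraic \<zeta>"
  shows "1 / (w_upper \<zeta> + 2) \<le> w_hat_star_lower \<zeta>
    \<and> w_hat_star_lower \<zeta> \<le> min (w_lower \<zeta>) (4 / w_upper \<zeta>)
    \<and> 1 / (w_lower \<zeta> + 2) \<le> w_hat_star_upper \<zeta>
    \<and> w_hat_star_upper \<zeta> \<le> min (w_upper \<zeta>) (4 / w_lower \<zeta>)
    \<and> theta_exp \<zeta> = 1 / tau_exp \<zeta>
    \<and> (lambda_exp 1 \<zeta> < \<infinity> \<longrightarrow> 1 / tau_exp \<zeta> = - sigma_exp \<zeta>)"
proof (intro conjI impI min.boundedI)
  show "1 / (w_upper \<zeta> + 2) \<le> w_hat_star_lower \<zeta>" by (rule w_hat_star_lower_ge[OF assms])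
  show "w_hat_star_lower \<zeta> \<le> w_lower \<zeta>" unfolding w_hat_star_lower_def w_lower_def
    by (rule Liminf_mono[OF w_hat_star_ratio_le_eventually[OF assms]])
  show "w_hat_star_lower \<zeta> \<le> 4 / w_upper \<zeta>" by (rule w_hat_star_lower_le[OF assms])
  show "1 / (w_lower \<zeta> + 2) \<le> w_hat_star_upper \<zeta>" by (rule w_hat_star_upper_ge[OF assms])
  show "w_hat_star_upper \<zeta> \<le> w_upper \<zeta>" unfolding w_hat_star_upper_def w_upper_def
    by (rule Limsup_mono[OF w_hat_star_ratio_le_eventually[OF assms]])
  show "w_hat_star_upper \<zeta> \<le> 4 / w_lower \<zeta>" by (rule w_hat_star_upper_le[OF assms])
  show theta: "theta_exp \<zeta> = 1 / tau_exp \<zeta>" using theta_exp_le[OF assms] theta_exp_ge[OF assms] by (rule antisym)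
  assume "lambda_exp 1 \<zeta> < \<infinity>"
  then have "sigma_exp \<zeta> \<le> - (1 / tau_exp \<zeta>)" by (rule sigma_exp_le[OF assms])
  with uminus_theta_exp_le_sigma_exp[OF assms] have "sigma_exp \<zeta> = - (1 / tau_exp \<zeta>)"
    unfolding theta by (intro antisym)
  then show "1 / tau_exp \<zeta> = - sigma_exp \<zeta>" by simp
qed

end
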